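(* Let $f:(0,\infty)\to\mathbb{R}$ be operator convex, and let $\mathcal{E}_1$ and $\mathcal{E}_2$ be completely positive trace-preserving (CPTP) quantum operations on a system $Q$ such that, for each $\mathcal{E}\in\{\mathcal{E}_1,\mathcal{E}_2,\mathcal{E}_2\circ\mathcal{E}_1\}$ and each density matrix $\rho_Q$ on $Q$ with purification $|\psi_{QR}\rangle$, the matrices $(\mathcal{E}\otimes\mathcal{I}_R)(|\psi_{QR}\rangle\langle\psi_{QR}|)$ and $\mathcal{E}(\rho_Q)\otimes\rho_R$ are strictly positive. Then the $f$-generalization of the entanglement-assisted capacity satisfies the data processing inequality $$C_{E,f}(\mathcal{E}_2\circ\mathcal{E}_1)\ \leq\ \min\left\{C_{E,f}(\mathcal{E}_1),\,C_{E,f}(\mathcal{E}_2)\right\}.$$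
   Context: All Hilbert spaces are finite-dimensional and complex. "Strictly positive" means Hermitian positive definite. A density matrix is a positive semidefinite matrix of unit trace. A real function $f$ on an interval is operator convex if $f[\lambda A+(1-\lambda)B]\leq\lambda f(A)+(1-\lambda)f(B)$ for all Hermitian matrices $A,B$ (of the same, arbitrary size) with spectra in the domain of $f$ and all $0\le\lambda\le1$. Quantum $f$-relative entropy: for strictly positive $\rho,\sigma$ on the same $d$-dimensional space, $$S_f(\rho||\sigma)=\mathrm{vec}(\sqrt{\rho})^\dagger f\left[\sigma\otimes(\rho^{-1})^{\mathsf T}\right]\mathrm{vec}(\sqrt{\rho})=\sum_{i,j=1}^d p_i f\left(\frac{q_j}{p_i}\right)|\langle i_\rho|j_\sigma\rangle|^2,$$ where $\rho=\sum_i p_i|i_\rho\rangle\langle i_\rho|$ and $\sigma=\sum_j q_j|j_\sigma\rangle\langle j_\sigma|$ are spectral decompositions and $\mathrm{vec}(A)$ stacks the entries of $A$ row by row. $f$-entanglement-assisted capacity: for a CPTP operation $\mathcal{E}$ on $Q$, $$C_{E,f}(\mathcal{E})=\max_{\rho_Q}S_f\left[(\mathcal{E}\otimes\mathcal{I}_R)(|\psi_{QR}\rangle\langle\psi_{QR}|)\,\Big|\Big|\,(\mathcal{E}\otimes\mathcal{I}_R)(\rho_Q\otimes\rho_R)\right],$$ where $\rho_Q$ ranges over density matrices on $Q$, $|\psi_{QR}\rangle$ is a purification of $\rho_Q$ in $QR$ with reference system $R$ of dimension $\mathrm{rank}(\rho_Q)$ (so that $\rho_R=\mathrm{Tr}_Q(|\psi_{QR}\rangle\langle\psi_{QR}|)$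 is strictly positive), $\mathcal{I}_R$ is the identity operation on $R$, and the maximum is understood as a supremum in $(-\infty,+\infty]$. *)

theory Defs
  imports
    "Jordan_Normal_Form.Schur_Decomposition"
    "Jordan_Normal_Form.Gauss_Jordan_Elimination"
    "Jordan_Normal_Form.Spectral_Radius"
    "Jordan_Normal_Form.DL_Rank"
    "HOL-Library.Extended_Real"
begin

definition hermitian_mat :: "nat \<Rightarrow> complex mat \<Rightarrow> bool" where
  "hermitian_mat n A \<longleftrightarrow> A \<in> carrier_mat n n \<and> mat_adjoint A = A"

definition psd_mat :: "nat \<Rightarrow> complex mat \<Rightarrow> bool" where
  "psd_mat n A \<longleftrightarrow> hermitian_mat n A \<and>
     (\<forall>v \<in> carrier_vec n. 0 \<le> Re ((A *\<^sub>v v) \<bullet>c v))"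

definition strictly_positive_mat :: "nat \<Rightarrow> complex mat \<Rightarrow> bool" where
  "strictly_positive_mat n A \<longleftrightarrow> hermitian_mat n A \<and>
     (\<forall>v \<in> carrier_vec n. v \<noteq> 0\<^sub>v n \<longrightarrow> 0 < Re ((A *\<^sub>v v) \<bullet>c v))"

definition loewner_le :: "nat \<Rightarrow> complex mat \<Rightarrow> complex mat \<Rightarrow> bool" where
  "loewner_le n A B \<longleftrightarrow> psd_mat n (B - A)"

definition mat_trace :: "complex mat \<Rightarrow> complex" where
  "mat_trace A = (\<Sum>i<dim_row A. A $$ (i, i))"

definition density_matrix :: "nat \<Rightarrow> complex mat \<Rightarrow> bool" where
  "density_matrix n \<rho> \<longleftrightarrow> psd_mat n \<rho> \<and> mat_trace \<rho> = 1"

definition unitary_mat :: "nat \<Rightarrow> complex mat \<Rightarrow> bool" where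
  "unitary_mat n U \<longleftrightarrow> U \<in> carrier_mat n n \<and>
     U * mat_adjoint U = 1\<^sub>m n \<and> mat_adjoint U * U = 1\<^sub>m n"

definition spectral_decomposition ::
    "nat \<Rightarrow> complex mat \<Rightarrow> complex mat \<Rightarrow> (nat \<Rightarrow> real) \<Rightarrow> bool" where
  "spectral_decomposition n A U a \<longleftrightarrow> unitary_mat n U \<and>
     A = U * mat_diag n (\<lambda>i. complex_of_real (a i)) * mat_adjoint U"

text \<open>Meaningful only for Hermitian \<open>A\<close>; the value does not depend on the chosen
  decomposition, see \<open>mat_fun_eq\<close> below.\<close>

definition mat_fun :: "(real \<Rightarrow> real) \<Rightarrow> complex mat \<Rightarrow> complex mat" where
  "mat_fun f A = (THE B. \<exists>U a. spectral_decomposition (dim_row A) A U a \<and>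
     B = U * mat_diag (dim_row A) (\<lambda>i. complex_of_real (f (a i))) * mat_adjoint U)"

definition operator_convex_on :: "real set \<Rightarrow> (real \<Rightarrow> real) \<Rightarrow> bool" where
  "operator_convex_on I f \<longleftrightarrow>
     (\<forall>n A B t. hermitian_mat n A \<longrightarrow> hermitian_mat n B \<longrightarrow>
        spectrum A \<subseteq> complex_of_real ` I \<longrightarrow> spectrum B \<subseteq> complex_of_real ` I \<longrightarrow>
        0 \<le> t \<longrightarrow> t \<le> 1 \<longrightarrow>
        loewner_le n
          (mat_fun f (complex_of_real t \<cdot>\<^sub>m A + complex_of_real (1 - t) \<cdot>\<^sub>m B))
          (complex_of_real t \<cdot>\<^sub>m mat_fun f A + complex_of_real (1 - t) \<cdot>\<^sub>m mat_fun f B))"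

text \<open>The basis vector \<open>|a\<rangle> \<otimes> |i\<rangle>\<close> of the tensor product of a space with one
  of dimension \<open>r\<close> has index \<open>a * r + i\<close>.\<close>

definition kronecker :: "complex mat \<Rightarrow> complex mat \<Rightarrow> complex mat" where
  "kronecker A B = mat (dim_row A * dim_row B) (dim_col A * dim_col B)
     (\<lambda>(k, l). A $$ (k div dim_row B, l div dim_col B) * B $$ (k mod dim_row B, l mod dim_col B))"

definition vec_rows :: "complex mat \<Rightarrow> complex vec" where
  "vec_rows A = vec (dim_row A * dim_col A) (\<lambda>k. A $$ (k div dim_col A, k mod dim_col A))"

definition ket_bra :: "complex vec \<Rightarrow> complex mat" where
  "ket_bra \<psi> = mat (dim_vec \<psi>) (dim_vec \<psi>) (\<lambda>(k, l). \<psi> $ k * cnj (\<psi> $ l))"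

definition trace_right :: "nat \<Rightarrow> nat \<Rightarrow> complex mat \<Rightarrow> complex mat" where
  "trace_right d r X = mat d d (\<lambda>(a, b). \<Sum>i<r. X $$ (a * r + i, b * r + i))"

definition trace_left :: "nat \<Rightarrow> nat \<Rightarrow> complex mat \<Rightarrow> complex mat" where
  "trace_left d r X = mat r r (\<lambda>(i, j). \<Sum>a<d. X $$ (a * r + i, a * r + j))"

definition linear_superop ::
    "nat \<Rightarrow> nat \<Rightarrow> (complex mat \<Rightarrow> complex mat) \<Rightarrow> bool" where
  "linear_superop d d' E \<longleftrightarrow>
     (\<forall>A \<in> carrier_mat d d. E A \<in> carrier_mat d' d') \<and>
     (\<forall>A \<in> carrier_mat d d. \<forall>B \<in> carrier_mat d d. E (A + B) = E A + E B) \<and>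
     (\<forall>c. \<forall>A \<in> carrier_mat d d. E (c \<cdot>\<^sub>m A) = c \<cdot>\<^sub>m E A)"

text \<open>\<open>E \<otimes> I\<close> with the identity on a space of dimension \<open>r\<close>: writing
  \<open>X = (\<Sum>i j. X\<^sub>i\<^sub>j \<otimes> |i\<rangle>\<langle>j|)\<close>, the operation \<open>E\<close> is applied to every \<open>X\<^sub>i\<^sub>j\<close>;
  see \<open>tensor_id_kronecker\<close>.\<close>

definition tensor_id ::
    "nat \<Rightarrow> nat \<Rightarrow> nat \<Rightarrow> (complex mat \<Rightarrow> complex mat) \<Rightarrow> complex mat \<Rightarrow> complex mat" where
  "tensor_id d d' r E X = mat (d' * r) (d' * r)
     (\<lambda>(k, l). E (mat d d (\<lambda>(a, b). X $$ (a * r + k mod r, b * r + l mod r)))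
                 $$ (k div r, l div r))"

definition completely_positive ::
    "nat \<Rightarrow> nat \<Rightarrow> (complex mat \<Rightarrow> complex mat) \<Rightarrow> bool" where
  "completely_positive d d' E \<longleftrightarrow>
     (\<forall>r X. psd_mat (d * r) X \<longrightarrow> psd_mat (d' * r) (tensor_id d d' r E X))"

definition trace_preserving :: "nat \<Rightarrow> (complex mat \<Rightarrow> complex mat) \<Rightarrow> bool" where
  "trace_preserving d E \<longleftrightarrow> (\<forall>A \<in> carrier_mat d d. mat_trace (E A) = mat_trace A)"

definition cptp :: "nat \<Rightarrow> nat \<Rightarrow> (complex mat \<Rightarrow> complex mat) \<Rightarrow> bool" where
  "cptp d d' E \<longleftrightarrow>
     linear_superop d d' E \<and> completely_positive d d' E \<and> trace_preserving d E"

text \<open>The quadratic form is real because the matrix is Hermitian.\<close>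

definition f_relative_entropy ::
    "(real \<Rightarrow> real) \<Rightarrow> complex mat \<Rightarrow> complex mat \<Rightarrow> real" where
  "f_relative_entropy f \<rho> \<sigma> =
     Re ((mat_fun f (kronecker \<sigma> (transpose_mat (the (mat_inverse \<rho>))))
            *\<^sub>v vec_rows (mat_fun sqrt \<rho>)) \<bullet>c vec_rows (mat_fun sqrt \<rho>))"

definition purification :: "nat \<Rightarrow> complex mat \<Rightarrow> complex vec \<Rightarrow> bool" where
  "purification d \<rho> \<psi> \<longleftrightarrow> \<psi> \<in> carrier_vec (d * vec_space.rank d \<rho>) \<and>
     trace_right d (vec_space.rank d \<rho>) (ket_bra \<psi>) = \<rho>"

definition reference_state :: "nat \<Rightarrow> complex mat \<Rightarrow> complex vec \<Rightarrow> complex mat" where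
  "reference_state d \<rho> \<psi> = trace_left d (vec_space.rank d \<rho>) (ket_bra \<psi>)"

text \<open>The entropy does not depend on the purification, so the supremum is taken over all
  pairs of a density matrix and one of its purifications.\<close>

definition f_capacity ::
    "(real \<Rightarrow> real) \<Rightarrow> nat \<Rightarrow> (complex mat \<Rightarrow> complex mat) \<Rightarrow> ereal" where
  "f_capacity f d E =
     (SUP (\<rho>, \<psi>) \<in> {(\<rho>, \<psi>). density_matrix d \<rho> \<and> purification d \<rho> \<psi>}.
        ereal (f_relative_entropy f
          (tensor_id d d (vec_space.rank d \<rho>) E (ket_bra \<psi>))
          (tensor_id d d (vec_space.rank d \<rho>) E (kronecker \<rho> (reference_state d \<rho> \<psi>)))))"

definition strictly_positive_outputs :: "nat \<Rightarrow> (complex mat \<Rightarrow> complex mat) \<Rightarrow> bool" where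
  "strictly_positive_outputs d E \<longleftrightarrow>
     (\<forall>\<rho> \<psi>. density_matrix d \<rho> \<longrightarrow> purification d \<rho> \<psi> \<longrightarrow>
        strictly_positive_mat (d * vec_space.rank d \<rho>)
          (tensor_id d d (vec_space.rank d \<rho>) E (ket_bra \<psi>)) \<and>
        strictly_positive_mat (d * vec_space.rank d \<rho>)
          (kronecker (E \<rho>) (reference_state d \<rho> \<psi>)))"

lemma mat_adjoint_carrier: "A \<in> carrier_mat n n \<Longrightarrow> mat_adjoint A \<in> carrier_mat n n"
  by (auto simp: mat_adjoint_def mat_of_rows_def)

lemma mat_fun_unique:
  assumes A: "spectral_decomposition n A U a" and B: "spectral_decomposition n A V b"
  shows "U * mat_diag n (\<lambda>i. complex_of_real (f (a i))) * mat_adjoint U =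
         V * mat_diag n (\<lambda>i. complex_of_real (f (b i))) * mat_adjoint V"
proof -
  let ?D = "\<lambda>a. mat_diag n (\<lambda>i. complex_of_real (a i))"
  define W where "W = mat_adjoint V * U"
  have U: "U \<in> carrier_mat n n" "mat_adjoint U \<in> carrier_mat n n"
      "U * mat_adjoint U = 1\<^sub>m n" "mat_adjoint U * U = 1\<^sub>m n"
    and V: "V \<in> carrier_mat n n" "mat_adjoint V \<in> carrier_mat n n"
      "V * mat_adjoint V = 1\<^sub>m n" "mat_adjoint V * V = 1\<^sub>m n"
    and eq: "U * ?D a * mat_adjoint U = V * ?D b * mat_adjoint V"
    using A B mat_adjoint_carrier
    by (auto simp: spectral_decomposition_def unitary_mat_def)
  have W: "W \<in> carrier_mat n n" using U V by (auto simp: W_def)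
  have D: "?D c \<in> carrier_mat n n" for c by simp
  have M [simp]: "X * Y \<in> carrier_mat n n"
    if "X \<in> carrier_mat n n" "Y \<in> carrier_mat n n" for X Y :: "complex mat"
    using that by simp
  note assoc = assoc_mult_mat[of _ n n _ n _ n]
  have cV: "mat_adjoint V * (V * X) = X" "V * (mat_adjoint V * X) = X"
    if "X \<in> carrier_mat n n" for X
    using that U V by (simp_all flip: assoc)
  have l: "W * ?D c = mat_adjoint V * (U * ?D c * mat_adjoint U) * U" for c
    using U V D[of c] by (simp add: W_def assoc right_mult_one_mat[of _ n n])
  have r: "?D c * W = mat_adjoint V * (V * ?D c * mat_adjoint V) * U" for c
    using U V D[of c] by (simp add: W_def assoc cV)
  have "W * ?D a = ?D b * W" unfolding l r eq ..
  hence e: "W $$ (i, j) * complex_of_real (a j) = complex_of_real (b i) * W $$ (i, j)"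
    if "i < n" "j < n" for i j
    using that W by (auto simp: mat_diag_mult_right mat_diag_mult_left dest!: arg_cong[of _ _ "\<lambda>M. M $$ (i, j)"])
  have "W $$ (i, j) * complex_of_real (f (a j)) = complex_of_real (f (b i)) * W $$ (i, j)"
    if "i < n" "j < n" for i j
    using e[OF that] by (cases "W $$ (i, j) = 0") auto
  hence WW: "W * ?D (\<lambda>i. f (a i)) = ?D (\<lambda>i. f (b i)) * W"
    using W by (intro eq_matI) (auto simp: mat_diag_mult_right mat_diag_mult_left)
  have VW: "V * W = U"
    using U V by (simp add: W_def cV)
  have WU: "W * mat_adjoint U = mat_adjoint V"
    unfolding W_def using U V by (simp add: assoc right_mult_one_mat[of _ n n])
  have "U * ?D (\<lambda>i. f (a i)) * mat_adjoint U = V * (W * ?D (\<lambda>i. f (a i))) * mat_adjoint U"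
    unfolding VW[symmetric] using U V W D[of "\<lambda>i. f (a i)"]
    by (simp add: assoc right_mult_one_mat[of _ n n])
  also have "\<dots> = V * ?D (\<lambda>i. f (b i)) * (W * mat_adjoint U)"
    unfolding WW using U V W D[of "\<lambda>i. f (b i)"]
    by (simp add: assoc right_mult_one_mat[of _ n n])
  finally show ?thesis unfolding WU .
qed

lemma mat_fun_eq:
  assumes "spectral_decomposition n A U a"
  shows "mat_fun f A = U * mat_diag n (\<lambda>i. complex_of_real (f (a i))) * mat_adjoint U"
proof -
  have n: "dim_row A = n"
    using assms by (auto simp: spectral_decomposition_def unitary_mat_def)
  show ?thesis unfolding mat_fun_def n
    by (rule the_equality) (use assms mat_fun_unique[OF _ assms] in blast)+
qed

lemma tensor_id_kronecker:
  assumes E: "linear_superop d d' E" and A: "A \<in> carrier_mat d d" and B: "B \<in> carrier_mat r r"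
  shows "tensor_id d d' r E (kronecker A B) = kronecker (E A) B"
proof (rule eq_matI)
  have EA: "E A \<in> carrier_mat d' d'" using E A by (auto simp: linear_superop_def)
  fix k l assume "k < dim_row (kronecker (E A) B)" "l < dim_col (kronecker (E A) B)"
  hence kl: "k < d' * r" "l < d' * r" using EA B by (auto simp: kronecker_def)
  hence r: "r > 0" by (cases r) auto
  have b: "a * r + i < d * r" if "a < d" "i < r" for a i
  proof -
    have "a * r + i < Suc a * r" using that by simp
    also have "\<dots> \<le> d * r" using that by (intro mult_le_mono1) simp
    finally show ?thesis .
  qed
  have dv: "k div r < d'" "l div r < d'" "k mod r < r" "l mod r < r"
    using kl r by (auto simp: less_mult_imp_div_less)
  have "mat d d (\<lambda>(a, b). kronecker A B $$ (a * r + k mod r, b * r + l mod r))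
      = B $$ (k mod r, l mod r) \<cdot>\<^sub>m A"
    using A B dv r b by (intro eq_matI) (auto simp: kronecker_def)
  thus "tensor_id d d' r E (kronecker A B) $$ (k, l) = kronecker (E A) B $$ (k, l)"
    using kl dv E A B carrier_matD[OF EA]
    by (simp add: tensor_id_def kronecker_def linear_superop_def)
qed (use assms in \<open>auto simp: tensor_id_def kronecker_def linear_superop_def\<close>)

end

(* Operator Jensen: if V is an isometry, f is operator convex and D > 0, then
   f(V^* D V) <= V^* f(D) V. For D diagonal this says that <v, f(A) v> <= sum_j f(l_j) |<w_j, v>|^2
   whenever sum_j w_j w_j^* = 1 and sum_j l_j w_j w_j^* = A. With A the relative modular operator of
   two output states, this bounds their relative entropy by a double sum over ensembles of the inputs.
   A Stinespring isometry only produces singular states on system and environment; they are made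
   strictly positive by mixing in a small part of the output, which is possible because the outputs
   are strictly positive, and the mixing disappears in the limit. This gives monotonicity of the
   relative entropy under channels.

   C(E2 o E1) <= C(E1) is monotonicity under E2 on the output system. For C(E2 o E1) <= C(E2), the
   state (E1 x I)(psi) arises from a purification of E1(rho), which has full rank, by a channel
   acting on the reference alone; it commutes with E2, and monotonicity applies to it. *)

theory Submission
  imports Defs
begin

section \<open>Spectral decompositions\<close>

text \<open>\<open>f\<close> is controlled only on the open half-line, so all weights of the dilated
  ensembles must stay strictly positive, also off the range of the isometry. The regularization is
  built so that no limit inside \<open>f\<close> occurs. An extra environment state
  \<open>None\<close> absorbs what the mixing adds: with D the \<open>defect\<close>, the three
  parts of the ensemble reduce to \<alpha> \<rho>', (1 - \<alpha>) s D and (1 - \<alpha>) (\<rho>' -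
  s D), which sum to \<rho>' for each \<alpha>. Both states share \<alpha> and s. Kets of different
  kinds are orthogonal, and for kets of the same kind \<alpha> cancels from the ratio of the
  weights. The bound is therefore affine in \<alpha>, namely \<alpha> S(\<rho>||\<sigma>) + (1 -
  \<alpha>) L with L constant, and \<alpha> tends to 1.

  For the comparison with \<open>E2\<close>, the obstacle is that the state which \<open>E1\<close>
  hands over is mixed in general, hence no admissible input in the capacity of \<open>E2\<close>. It
  is the image of a purification of its own marginal under a channel on the reference. Since
  \<open>E1\<close> does not change the reference marginal, the same channel also carries one
  product state to the other.\<close>

lemma mat_adjoint_eq:
  "mat_adjoint A = mat (dim_col A) (dim_row A) (\<lambda>(i, j). cnj (A $$ (j, i)))"
  by (rule eq_matI) (auto simp: mat_adjoint_def mat_of_rows_def)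

lemma mat_adjoint_index [simp]:
  "i < dim_col A \<Longrightarrow> j < dim_row A \<Longrightarrow> mat_adjoint A $$ (i, j) = cnj (A $$ (j, i))"
  by (simp add: mat_adjoint_eq)

lemma mat_adjoint_dims [simp]:
  "dim_row (mat_adjoint A) = dim_col (A :: complex mat)"
  "dim_col (mat_adjoint A) = dim_row A"
  by (simp_all add: mat_adjoint_eq)

lemma mat_adjoint_carrier_mat [simp]:
  "A \<in> carrier_mat n m \<Longrightarrow> mat_adjoint (A :: complex mat) \<in> carrier_mat m n"
  by auto

lemma mat_adjoint_adjoint [simp]: "mat_adjoint (mat_adjoint A) = (A :: complex mat)"
  by (rule eq_matI) auto

lemma index_mult_mat_sum:
  assumes "i < dim_row A" "j < dim_col B" "dim_row B = n" "dim_col A = n"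
  shows "(A * B) $$ (i, j) = (\<Sum>k<n. A $$ (i, k) * B $$ (k, j))"
  using assms by (auto simp: scalar_prod_def lessThan_atLeast0 intro!: sum.cong)

lemma mult_square_carrier [simp]:
  "A \<in> carrier_mat n n \<Longrightarrow> B \<in> carrier_mat n n \<Longrightarrow> A * B \<in> carrier_mat n n"
  by simp

lemma mat_adjoint_mult:
  assumes "A \<in> carrier_mat n m" "B \<in> carrier_mat m k"
  shows "mat_adjoint (A * B) = mat_adjoint B * mat_adjoint (A :: complex mat)"
  using assms
  by (intro eq_matI) (auto simp: index_mult_mat_sum simp del: index_mult_mat(1) intro!: sum.cong)

lemma mat_adjoint_one [simp]: "mat_adjoint (1\<^sub>m n) = (1\<^sub>m n :: complex mat)"
  by (rule eq_matI) auto

lemma mat_adjoint_zero [simp]: "mat_adjoint (0\<^sub>m n m) = (0\<^sub>m m n :: complex mat)"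
  by (rule eq_matI) auto

lemma mat_adjoint_four_block:
  assumes "A \<in> carrier_mat n1 m1" "B \<in> carrier_mat n1 m2"
    "C \<in> carrier_mat n2 m1" "D \<in> carrier_mat n2 m2"
  shows "mat_adjoint (four_block_mat A B C D) =
    four_block_mat (mat_adjoint A) (mat_adjoint C) (mat_adjoint B) (mat_adjoint (D :: complex mat))"
  using assms by (intro eq_matI) auto

lemma mat_adjoint_diag_real [simp]:
  "mat_adjoint (mat_diag n (\<lambda>i. complex_of_real (a i))) = mat_diag n (\<lambda>i. complex_of_real (a i))"
  by (rule eq_matI) (auto simp: mat_diag_def)

lemma mat_adjoint_add:
  assumes "A \<in> carrier_mat n m" "B \<in> carrier_mat n m"
  shows "mat_adjoint (A + B) = mat_adjoint A + mat_adjoint (B :: complex mat)"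
  using assms by (intro eq_matI) auto

lemma mat_adjoint_minus:
  assumes "A \<in> carrier_mat n m" "B \<in> carrier_mat n m"
  shows "mat_adjoint (A - B) = mat_adjoint A - mat_adjoint (B :: complex mat)"
  using assms by (intro eq_matI) auto

lemma mat_adjoint_smult: "mat_adjoint (c \<cdot>\<^sub>m A) = cnj c \<cdot>\<^sub>m mat_adjoint (A :: complex mat)"
  by (intro eq_matI) auto

lemma cscalar_prod_sum:
  "dim_vec w = n \<Longrightarrow> v \<bullet>c w = (\<Sum>i<n. v $ i * cnj (w $ i :: complex))"
  by (auto simp: scalar_prod_def lessThan_atLeast0 intro!: sum.cong)

lemma index_mult_mat_vec_sum:
  "dim_vec v = n \<Longrightarrow> dim_col A = n \<Longrightarrow> i < dim_row A \<Longrightarrow>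
    (A *\<^sub>v v) $ i = (\<Sum>j<n. A $$ (i, j) * v $ j)"
  by (auto simp: scalar_prod_def lessThan_atLeast0 intro!: sum.cong)

lemma cscalar_prod_self: "v \<bullet>c v = complex_of_real (\<Sum>i<dim_vec v. (cmod (v $ i))\<^sup>2)"
  by (simp add: cscalar_prod_sum complex_mult_cnj cmod_power2)

lemma cscalar_prod_adjoint:
  fixes A :: "complex mat"
  assumes "A \<in> carrier_mat n m" "v \<in> carrier_vec m" "w \<in> carrier_vec n"
  shows "(A *\<^sub>v v) \<bullet>c w = v \<bullet>c (mat_adjoint A *\<^sub>v w)"
proof -
  have "(A *\<^sub>v v) \<bullet>c w = (\<Sum>i<n. \<Sum>j<m. A $$ (i, j) * v $ j * cnj (w $ i))"
    using assms
    by (auto simp: cscalar_prod_sum index_mult_mat_vec_sum sum_distrib_right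
        simp del: index_mult_mat_vec intro!: sum.cong)
  also have "\<dots> = (\<Sum>j<m. \<Sum>i<n. A $$ (i, j) * v $ j * cnj (w $ i))" by (rule sum.swap)
  also have "\<dots> = v \<bullet>c (mat_adjoint A *\<^sub>v w)"
    using assms
    by (auto simp: cscalar_prod_sum index_mult_mat_vec_sum sum_distrib_left mult_ac
        simp del: index_mult_mat_vec intro!: sum.cong)
  finally show ?thesis .
qed

section \<open>Unitary conjugation, direct sums and diagonalization of Hermitian matrices\<close>

lemma unitary_mat_mult:
  assumes "unitary_mat n U" "unitary_mat n V"
  shows "unitary_mat n (U * V)"
proof -
  have U: "U \<in> carrier_mat n n" "mat_adjoint U \<in> carrier_mat n n"
      "U * mat_adjoint U = 1\<^sub>m n" "mat_adjoint U * U = 1\<^sub>m n"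
    and V: "V \<in> carrier_mat n n" "mat_adjoint V \<in> carrier_mat n n"
      "V * mat_adjoint V = 1\<^sub>m n" "mat_adjoint V * V = 1\<^sub>m n"
    using assms by (auto simp: unitary_mat_def)
  note assoc = assoc_mult_mat[of _ n n _ n _ n]
  have "mat_adjoint V * (mat_adjoint U * (U * V)) = mat_adjoint V * ((mat_adjoint U * U) * V)"
    using U(1,2) V(1,2) by (simp add: assoc)
  moreover have "U * (V * (mat_adjoint V * mat_adjoint U)) = U * ((V * mat_adjoint V) * mat_adjoint U)"
    using U(1,2) V(1,2) by (simp add: assoc)
  ultimately show ?thesis
    using U V by (simp add: unitary_mat_def mat_adjoint_mult[of _ n n _ n] assoc)
qed

lemma spectral_decomposition_conj:
  assumes M: "spectral_decomposition n M U a" and W: "unitary_mat n W"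
  shows "spectral_decomposition n (W * M * mat_adjoint W) (W * U) a"
proof -
  let ?D = "mat_diag n (\<lambda>i. complex_of_real (a i))"
  have U: "U \<in> carrier_mat n n" "mat_adjoint U \<in> carrier_mat n n"
    and Me: "M = U * ?D * mat_adjoint U"
    and W': "W \<in> carrier_mat n n" "mat_adjoint W \<in> carrier_mat n n"
    and UU: "unitary_mat n U"
    using assms by (auto simp: spectral_decomposition_def unitary_mat_def)
  have "W * M * mat_adjoint W = (W * U) * ?D * mat_adjoint (W * U)"
    using U W' by (simp add: Me mat_adjoint_mult[of _ n n _ n] assoc_mult_mat[of _ n n _ n _ n])
  thus ?thesis using unitary_mat_mult[OF W UU] by (simp add: spectral_decomposition_def)
qed

lemma mat_diag_append:
  "mat_diag (p + q) (\<lambda>i. if i < p then a i else c (i - p)) =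
    four_block_mat (mat_diag p a) (0\<^sub>m p q) (0\<^sub>m q p) (mat_diag q c)"
  by (rule eq_matI) (auto simp: mat_diag_def)

lemma spectral_decomposition_diag:
  "spectral_decomposition n (mat_diag n (\<lambda>i. complex_of_real (a i))) (1\<^sub>m n) a"
  unfolding spectral_decomposition_def unitary_mat_def mat_adjoint_one
  by (intro conjI) (simp_all only: left_mult_one_mat[OF mat_diag_dim] right_mult_one_mat[OF mat_diag_dim]
      left_mult_one_mat[OF one_carrier_mat] one_carrier_mat)

lemma mult_block_diag:
  assumes "A \<in> carrier_mat p p" "C \<in> carrier_mat p p" "B \<in> carrier_mat q q" "D \<in> carrier_mat q q"
  shows "four_block_mat A (0\<^sub>m p q) (0\<^sub>m q p) B * four_block_mat C (0\<^sub>m p q) (0\<^sub>m q p) D =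
    four_block_mat (A * C) (0\<^sub>m p q) (0\<^sub>m q p) (B * D :: complex mat)"
  using assms by (subst mult_four_block_mat[of _ p p _ q _ q _ _ p _ q]) auto

lemma unitary_mat_block_diag:
  assumes "unitary_mat p U" "unitary_mat q V"
  shows "unitary_mat (p + q) (four_block_mat U (0\<^sub>m p q) (0\<^sub>m q p) V)"
proof -
  have U: "U \<in> carrier_mat p p" "mat_adjoint U \<in> carrier_mat p p"
    and V: "V \<in> carrier_mat q q" "mat_adjoint V \<in> carrier_mat q q"
    using assms by (auto simp: unitary_mat_def)
  show ?thesis
    using assms U V unfolding unitary_mat_def
    by (simp add: mat_adjoint_four_block[of _ p p _ q _ q] mult_block_diag)
qed

lemma spectral_decomposition_block_diag:
  assumes A: "spectral_decomposition p A U a" and C: "spectral_decomposition q C V c"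
  shows "spectral_decomposition (p + q) (four_block_mat A (0\<^sub>m p q) (0\<^sub>m q p) C)
    (four_block_mat U (0\<^sub>m p q) (0\<^sub>m q p) V) (\<lambda>i. if i < p then a i else c (i - p))"
proof -
  have U: "U \<in> carrier_mat p p" "mat_adjoint U \<in> carrier_mat p p" "unitary_mat p U"
    and V: "V \<in> carrier_mat q q" "mat_adjoint V \<in> carrier_mat q q" "unitary_mat q V"
    and e: "A = U * mat_diag p (\<lambda>i. complex_of_real (a i)) * mat_adjoint U"
       "C = V * mat_diag q (\<lambda>i. complex_of_real (c i)) * mat_adjoint V"
    using assms by (auto simp: spectral_decomposition_def unitary_mat_def)
  have *: "mat_diag (p + q) (\<lambda>i. complex_of_real (if i < p then a i else c (i - p))) =
    four_block_mat (mat_diag p (\<lambda>i. complex_of_real (a i))) (0\<^sub>m p q) (0\<^sub>m q p)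
      (mat_diag q (\<lambda>i. complex_of_real (c i)))"
    unfolding mat_diag_append[symmetric] by (simp add: if_distrib cong: if_cong)
  show ?thesis
    unfolding spectral_decomposition_def *
    using unitary_mat_block_diag[OF U(3) V(3)] U V
    by (simp add: e mat_adjoint_four_block[of _ p p _ q _ q]
       mult_block_diag)
qed

text \<open>Complete \<open>v\<close> to a basis, orthogonalize and normalize; Gram-Schmidt keeps
  the first vector. The scalar \<open>c\<close> is left open because being an eigenvector does not
  depend on scale.\<close>

lemma unitary_first_column:
  assumes v: "v \<in> carrier_vec n" and v0: "v \<noteq> 0\<^sub>v n"
  obtains W c where "unitary_mat n W" "col W 0 = c \<cdot>\<^sub>v v"
proof -
  interpret cof_vec_space n "TYPE(complex)" .
  have n: "n > 0"
  proof (rule ccontr)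
    assume "\<not> n > 0"
    hence "v = 0\<^sub>v n" using v by (intro eq_vecI) auto
    thus False using v0 by simp
  qed
  define b where "b = basis_completion v"
  define ws where "ws = gram_schmidt n b"
  from basis_completion[OF v v0, folded b_def]
  have b: "distinct b" "\<not> lin_dep (set b)" "set b \<subseteq> carrier_vec n" "hd b = v" "length b = n"
    by auto
  then obtain vs where bv: "b = v # vs" using n by (cases b) auto
  from gram_schmidt_result[OF b(3,1,2) refl, folded ws_def]
  have ws: "set ws \<subseteq> carrier_vec n" "corthogonal ws" "length ws = n" by (auto simp: b)
  have hd: "hd ws = v" using gram_schmidt_hd[OF v, of vs] by (simp add: ws_def bv)
  \<comment> \<open>The Gram-Schmidt vectors are orthogonal but not normalized; \<open>g i\<close>
    is the squared norm of the \<open>i\<close>-th one.\<close>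
  define g where "g i = (\<Sum>x<n. (cmod (ws ! i $ x))\<^sup>2)" for i
  have wsc: "ws ! i \<in> carrier_vec n" if "i < n" for i using ws that by auto
  have self: "ws ! i \<bullet>c ws ! i = complex_of_real (g i)" if "i < n" for i
    using wsc[OF that] by (simp add: cscalar_prod_self g_def)
  have g: "g i > 0" if "i < n" for i
  proof -
    have "g i \<noteq> 0" using corthogonalD[OF ws(2), of i i] self[OF that] that ws(3) by auto
    moreover have "g i \<ge> 0" by (auto simp: g_def intro: sum_nonneg)
    ultimately show ?thesis by simp
  qed
  define W where "W = mat n n (\<lambda>(x, i). ws ! i $ x / complex_of_real (sqrt (g i)))"
  have W: "W \<in> carrier_mat n n" by (simp add: W_def)
  have "mat_adjoint W * W = 1\<^sub>m n"
  proof (rule eq_matI)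
    fix i j assume "i < dim_row (1\<^sub>m n)" "j < dim_col (1\<^sub>m n)"
    hence ij: "i < n" "j < n" by auto
    have "(mat_adjoint W * W) $$ (i, j)
        = (\<Sum>x<n. cnj (ws ! i $ x) * (ws ! j $ x)) / (complex_of_real (sqrt (g i)) * complex_of_real (sqrt (g j)))"
      using ij by (simp add: index_mult_mat_sum W_def sum_divide_distrib del: index_mult_mat(1))
    also have "(\<Sum>x<n. cnj (ws ! i $ x) * (ws ! j $ x)) = ws ! j \<bullet>c ws ! i"
      using wsc[OF ij(1)] by (simp add: cscalar_prod_sum[of _ n] mult_ac)
    also have "\<dots> / (complex_of_real (sqrt (g i)) * complex_of_real (sqrt (g j))) = (if i = j then 1 else 0)"
    proof (cases "i = j")
      case True
      have "complex_of_real (sqrt (g j)) * complex_of_real (sqrt (g j)) = complex_of_real (g j)"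
        using g[OF ij(2)] by (metis less_eq_real_def of_real_mult real_sqrt_mult_self abs_of_pos)
      thus ?thesis using True ij self g[OF ij(2)] by simp
    next
      case False
      hence "ws ! j \<bullet>c ws ! i = 0" using corthogonalD[OF ws(2), of j i] ij ws(3) by auto
      thus ?thesis using False by simp
    qed
    finally show "(mat_adjoint W * W) $$ (i, j) = 1\<^sub>m n $$ (i, j)" using ij by simp
  qed (auto simp: W_def)
  moreover from this have "W * mat_adjoint W = 1\<^sub>m n"
    using mat_mult_left_right_inverse[of "mat_adjoint W" n W] W by auto
  ultimately have "unitary_mat n W" using W by (simp add: unitary_mat_def)
  moreover have "ws ! 0 = v" using hd ws(3) n by (cases ws) auto
  hence "col W 0 = (1 / complex_of_real (sqrt (g 0))) \<cdot>\<^sub>v v"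
    using n v by (intro eq_vecI) (auto simp: W_def)
  ultimately show ?thesis using that by blast
qed

text \<open>Deflation: in a basis that starts with an eigenvector, the first column of the matrix
  vanishes below the diagonal. Hermitian symmetry clears the first row too, so a Hermitian block of
  size \<open>n\<close> remains for the induction.\<close>

theorem hermitian_spectral_decomposition:
  "hermitian_mat n A \<Longrightarrow> \<exists>U a. spectral_decomposition n A U a"
proof (induction n arbitrary: A)
  case 0
  have "unitary_mat 0 (1\<^sub>m 0)" by (simp add: unitary_mat_def)
  moreover have "A = 1\<^sub>m 0 * mat_diag 0 (\<lambda>i. complex_of_real (0::real)) * mat_adjoint (1\<^sub>m 0)"
    using 0 by (intro eq_matI) (auto simp: hermitian_mat_def)
  ultimately have "spectral_decomposition 0 A (1\<^sub>m 0) (\<lambda>_. 0)"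
    by (simp add: spectral_decomposition_def)
  thus ?case by blast
next
  case (Suc n)
  let ?n = "Suc n"
  from Suc.prems have A: "A \<in> carrier_mat ?n ?n" and Ah: "mat_adjoint A = A"
    by (auto simp: hermitian_mat_def)
  from spectrum_non_empty[OF A] obtain e where "e \<in> spectrum A" by auto
  then obtain v where "eigenvector A v e" by (auto simp: spectrum_def eigenvalue_def)
  hence v: "v \<in> carrier_vec ?n" "v \<noteq> 0\<^sub>v ?n" "A *\<^sub>v v = e \<cdot>\<^sub>v v"
    using A by (auto simp: eigenvector_def)
  obtain W c where Wu: "unitary_mat ?n W" and c: "col W 0 = c \<cdot>\<^sub>v v"
    using unitary_first_column[OF v(1,2)] .
  hence W: "W \<in> carrier_mat ?n ?n" "mat_adjoint W \<in> carrier_mat ?n ?n"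
      "W * mat_adjoint W = 1\<^sub>m ?n" "mat_adjoint W * W = 1\<^sub>m ?n"
    by (auto simp: unitary_mat_def)
  note assoc = assoc_mult_mat[of _ ?n ?n _ ?n _ ?n]
  define M where "M = mat_adjoint W * A * W"
  have M: "M \<in> carrier_mat ?n ?n" using W A by (simp add: M_def)
  have Mh: "mat_adjoint M = M"
    using W A by (simp add: M_def mat_adjoint_mult[of _ ?n ?n _ ?n] Ah assoc)
  have "col (A * W) 0 = A *\<^sub>v (c \<cdot>\<^sub>v v)"
    unfolding c[symmetric] by (rule col_mult2[OF A W(1)]) simp
  also have "\<dots> = c \<cdot>\<^sub>v (e \<cdot>\<^sub>v v)"
    unfolding v(3)[symmetric] by (rule mult_mat_vec[OF A v(1)])
  also have "\<dots> = e \<cdot>\<^sub>v col W 0"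
    unfolding c by (simp add: smult_smult_assoc mult.commute)
  finally have "col (A * W) 0 = e \<cdot>\<^sub>v col W 0" .
  hence AW: "(A * W) $$ (x, 0) = e * W $$ (x, 0)" if "x < ?n" for x
    using that A W by (auto dest!: arg_cong[of _ _ "\<lambda>u. u $ x"])
  have M0: "M $$ (i, 0) = e * (if i = 0 then 1 else 0)" if i: "i < ?n" for i
  proof -
    have "M = mat_adjoint W * (A * W)" using W A by (simp add: M_def assoc)
    hence "M $$ (i, 0) = (\<Sum>x<?n. mat_adjoint W $$ (i, x) * (A * W) $$ (x, 0))"
      using i W A by (simp add: index_mult_mat_sum[of i _ 0 _ ?n] del: index_mult_mat(1) sum.lessThan_Suc)
    also have "\<dots> = (\<Sum>x<?n. e * (mat_adjoint W $$ (i, x) * W $$ (x, 0)))"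
      using AW by (intro sum.cong) (auto simp del: index_mult_mat(1))
    also have "\<dots> = e * (mat_adjoint W * W) $$ (i, 0)"
      using i W(1,2) by (subst index_mult_mat_sum[of i _ 0 _ ?n]) (auto simp only: sum_distrib_left carrier_matD)
    finally show ?thesis unfolding W(4) using i by simp
  qed
  \<comment> \<open>For \<open>i > 0\<close> this clears the first row; for \<open>i = 0\<close> it
    makes the eigenvalue \<open>e\<close> real.\<close>
  have M0': "M $$ (0, i) = cnj (M $$ (i, 0))" if "i < ?n" for i
    using that M by (subst Mh[symmetric]) auto
  define C where "C = mat n n (\<lambda>(i, j). M $$ (Suc i, Suc j))"
  define a0 where "a0 = Re e"
  have "M $$ (0,0) = e" using M0[of 0] by simp
  hence "cnj e = e" using M0'[of 0] by (metis zero_less_Suc)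
  hence e: "e = complex_of_real a0"
    by (simp add: a0_def complex_eq_iff)
  have "mat_adjoint C = C"
  proof (rule eq_matI)
    fix i j assume "i < dim_row C" "j < dim_col C"
    hence ij: "i < n" "j < n" by (auto simp: C_def)
    have "cnj (M $$ (Suc j, Suc i)) = mat_adjoint M $$ (Suc i, Suc j)"
      using ij M by auto
    thus "mat_adjoint C $$ (i, j) = C $$ (i, j)" using ij by (simp add: C_def Mh)
  qed (auto simp: C_def)
  hence "hermitian_mat n C" by (simp add: hermitian_mat_def C_def)
  then obtain V b where Vb: "spectral_decomposition n C V b" using Suc.IH by blast
  have Mb: "M = four_block_mat (mat_diag 1 (\<lambda>_. complex_of_real a0)) (0\<^sub>m 1 n) (0\<^sub>m n 1) C"
    using M by (intro eq_matI) (auto simp: C_def mat_diag_def M0 M0' e)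
  obtain U a where "spectral_decomposition ?n M U a"
    using spectral_decomposition_block_diag[OF spectral_decomposition_diag[of 1 "\<lambda>_. a0"] Vb] unfolding Mb by auto
  from spectral_decomposition_conj[OF this Wu]
  have "spectral_decomposition ?n (W * M * mat_adjoint W) (W * U) a" .
  also have "W * M * mat_adjoint W = (W * mat_adjoint W) * A * (W * mat_adjoint W)"
    using W(1,2) A by (simp add: M_def assoc)
  also have "\<dots> = A" using W A by simp
  finally show ?case by blast
qed

section \<open>Jensen's operator inequality\<close>

lemma spectral_decompositionD:
  assumes "spectral_decomposition n A U a"
  shows "U \<in> carrier_mat n n" "U * mat_adjoint U = 1\<^sub>m n" "mat_adjoint U * U = 1\<^sub>m n"
    "A = U * mat_diag n (\<lambda>i. complex_of_real (a i)) * mat_adjoint U" "A \<in> carrier_mat n n"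
  using assms by (auto simp: spectral_decomposition_def unitary_mat_def)

lemma spectral_decomposition_mat_fun:
  "spectral_decomposition n A U a \<Longrightarrow> spectral_decomposition n (mat_fun f A) U (\<lambda>i. f (a i))"
  by (auto simp: mat_fun_eq) (auto simp: spectral_decomposition_def)

lemma spectral_decomposition_hermitian:
  assumes "spectral_decomposition n A U a"
  shows "hermitian_mat n A"
proof -
  note U = spectral_decompositionD[OF assms]
  have "mat_adjoint A = A"
    unfolding U(4) using U(1)
    by (simp add: mat_adjoint_mult[of _ n n _ n] assoc_mult_mat[of _ n n _ n _ n])
  thus ?thesis using U(5) by (simp add: hermitian_mat_def)
qed

lemma spectral_decomposition_quadratic_form:
  assumes A: "spectral_decomposition n A U a" and v: "v \<in> carrier_vec n"
  shows "(A *\<^sub>v v) \<bullet>c v = complex_of_real (\<Sum>i<n. a i * (cmod ((mat_adjoint U *\<^sub>v v) $ i))\<^sup>2)"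
proof -
  note U = spectral_decompositionD[OF A]
  define w where "w = mat_adjoint U *\<^sub>v v"
  let ?D = "mat_diag n (\<lambda>i. complex_of_real (a i))"
  have w: "w \<in> carrier_vec n" using U v by (auto simp: w_def intro!: mult_mat_vec_carrier)
  have Dw: "?D *\<^sub>v w = vec n (\<lambda>i. complex_of_real (a i) * w $ i)"
    using w by (intro eq_vecI)
      (auto simp: mat_diag_def index_mult_mat_vec_sum[of _ n] if_distrib[of "\<lambda>x. x * _"] sum.delta
        simp del: index_mult_mat_vec cong: if_cong)
  have "A *\<^sub>v v = U *\<^sub>v (?D *\<^sub>v w)"
    unfolding U(4) w_def using U(1) v mult_mat_vec_carrier[OF mat_adjoint_carrier_mat[OF U(1)] v]
    by (simp add: assoc_mult_mat_vec[of _ n n _ n])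
  hence "(A *\<^sub>v v) \<bullet>c v = (?D *\<^sub>v w) \<bullet>c w"
    using U(1) v mult_mat_vec_carrier[OF mat_diag_dim w]
    by (simp only: w_def cscalar_prod_adjoint[of U n n])
  also have "\<dots> = complex_of_real (\<Sum>i<n. a i * (cmod (w $ i))\<^sup>2)"
    using w unfolding Dw
    by (simp add: cscalar_prod_sum[of _ n] complex_norm_square[unfolded of_real_power] mult.assoc)
  finally show ?thesis by (simp add: w_def)
qed

lemma unitary_mat_norm:
  assumes U: "U \<in> carrier_mat n n" "U * mat_adjoint U = 1\<^sub>m n" and v: "v \<in> carrier_vec n"
  shows "(\<Sum>i<n. (cmod ((mat_adjoint U *\<^sub>v v) $ i))\<^sup>2) = (\<Sum>i<n. (cmod (v $ i))\<^sup>2)"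
proof -
  have c: "mat_adjoint U *\<^sub>v v \<in> carrier_vec n" using U v by (auto intro!: mult_mat_vec_carrier)
  have "(mat_adjoint U *\<^sub>v v) \<bullet>c (mat_adjoint U *\<^sub>v v) = v \<bullet>c ((U * mat_adjoint U) *\<^sub>v v)"
    using U(1) v c by (simp add: cscalar_prod_adjoint[of _ n n] assoc_mult_mat_vec[of _ n n _ n])
  also have "\<dots> = v \<bullet>c v" using U v by simp
  finally show ?thesis using U c v by (simp add: cscalar_prod_self del: of_real_sum)
qed

text \<open>Passes from the eigenvalues of a chosen decomposition to the spectrum condition in
  \<open>operator_convex_on\<close>. In the basis \<open>U\<close> an eigenvector has some nonzero
  coordinate \<open>i\<close>, and comparing that coordinate gives \<open>e = a i\<close>.\<close>

lemma spectral_decomposition_spectrum: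
  assumes A: "spectral_decomposition n A U a" and I: "\<And>i. i < n \<Longrightarrow> a i \<in> I"
  shows "spectrum A \<subseteq> complex_of_real ` I"
proof
  fix e assume "e \<in> spectrum A"
  note U = spectral_decompositionD[OF A]
  let ?D = "mat_diag n (\<lambda>i. complex_of_real (a i))"
  obtain v where v: "v \<in> carrier_vec n" "v \<noteq> 0\<^sub>v n" "A *\<^sub>v v = e \<cdot>\<^sub>v v"
    using \<open>e \<in> spectrum A\<close> U(5) by (auto simp: spectrum_def eigenvalue_def eigenvector_def)
  define w where "w = mat_adjoint U *\<^sub>v v"
  have w: "w \<in> carrier_vec n" using U v by (auto simp: w_def intro!: mult_mat_vec_carrier)
  have Uw: "U *\<^sub>v w = v"
    unfolding w_def using U v by (simp flip: assoc_mult_mat_vec[of _ n n _ n])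
  have "w \<noteq> 0\<^sub>v n"
  proof
    assume "w = 0\<^sub>v n"
    hence "v = 0\<^sub>v n" using Uw U(1) by (auto intro!: eq_vecI)
    thus False using v by simp
  qed
  moreover have "w = 0\<^sub>v n" if "\<forall>i<n. w $ i = 0" using w that by (intro eq_vecI) auto
  ultimately obtain i where i: "i < n" "w $ i \<noteq> 0" by blast
  have Dw: "(?D *\<^sub>v w) $ i = complex_of_real (a i) * w $ i"
    using w i by (auto simp: mat_diag_def index_mult_mat_vec_sum[of _ n] if_distrib[of "\<lambda>x. x * _"] sum.delta
        simp del: index_mult_mat_vec cong: if_cong)
  have "?D *\<^sub>v w = (mat_adjoint U * U) *\<^sub>v (?D *\<^sub>v w)"
    unfolding U(3) using mult_mat_vec_carrier[OF mat_diag_dim w] by (simp only: one_mult_mat_vec)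
  also have "\<dots> = mat_adjoint U *\<^sub>v (A *\<^sub>v v)"
    unfolding U(4) w_def using U(1) v mult_mat_vec_carrier[OF mat_adjoint_carrier_mat[OF U(1)] v(1)]
      mult_mat_vec_carrier[OF mat_diag_dim w[unfolded w_def]]
    by (simp add: assoc_mult_mat_vec[of _ n n _ n])
  also have "\<dots> = e \<cdot>\<^sub>v w" 
    unfolding w_def v(3) by (rule mult_mat_vec[OF mat_adjoint_carrier_mat[OF U(1)] v(1)])
  finally have "complex_of_real (a i) * w $ i = e * w $ i" using Dw i w by simp
  hence "e = complex_of_real (a i)" using i by simp
  thus "e \<in> complex_of_real ` I" using I[OF i(1)] by auto
qed

lemma quadratic_form_sum:
  assumes "A \<in> carrier_mat n n" "z \<in> carrier_vec n"
  shows "(A *\<^sub>v z) \<bullet>c z = (\<Sum>i<n. \<Sum>j<n. A $$ (i, j) * z $ j * cnj (z $ i :: complex))"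
  using assms
  by (simp add: cscalar_prod_sum[of _ n] index_mult_mat_vec_sum[of _ n] sum_distrib_right
      del: index_mult_mat_vec)

text \<open>Turns the Loewner inequality of operator convexity into an inequality between
  numbers.\<close>

lemma quadratic_form_combination:
  assumes "X \<in> carrier_mat n n" "Y \<in> carrier_mat n n" "Z \<in> carrier_mat n n" "z \<in> carrier_vec n"
  shows "(((s \<cdot>\<^sub>m X + t \<cdot>\<^sub>m Y) - Z) *\<^sub>v z) \<bullet>c z =
    s * ((X *\<^sub>v z) \<bullet>c z) + t * ((Y *\<^sub>v z) \<bullet>c z) - (Z *\<^sub>v z) \<bullet>c (z :: complex vec)"
proof -
  have "(s \<cdot>\<^sub>m X + t \<cdot>\<^sub>m Y) - Z \<in> carrier_mat n n" using assms by auto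
  thus ?thesis
    using assms quadratic_form_sum[of _ n z]
    by (simp add: algebra_simps sum.distrib sum_subtractf sum_distrib_left)
qed

lemma zero_mult_mat_vec: "v \<in> carrier_vec m \<Longrightarrow> 0\<^sub>m n m *\<^sub>v v = (0\<^sub>v n :: complex vec)"
  by (intro eq_vecI) auto

text \<open>On a vector padded by zeros only the first block column acts, so the quadratic form of a
  block diagonal matrix sees only its upper left block.\<close>

lemma four_block_mult_append_zero:
  assumes "A \<in> carrier_mat n1 m1" "B \<in> carrier_mat n1 m2" "C \<in> carrier_mat n2 m1"
    "D \<in> carrier_mat n2 m2" "v \<in> carrier_vec m1"
  shows "four_block_mat A B C D *\<^sub>v (v @\<^sub>v 0\<^sub>v m2) = (A *\<^sub>v v) @\<^sub>v (C *\<^sub>v (v :: complex vec))"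
proof -
  have "B *\<^sub>v 0\<^sub>v m2 = 0\<^sub>v n1" "D *\<^sub>v 0\<^sub>v m2 = 0\<^sub>v n2"
    using assms by (auto intro!: eq_vecI)
  moreover have "A *\<^sub>v v \<in> carrier_vec n1" "C *\<^sub>v v \<in> carrier_vec n2"
    using assms by auto
  ultimately show ?thesis
    by (subst four_block_mat_mult_vec[OF assms(1-5)]) simp_all
qed

text \<open>The isometry \<open>V\<close> is dilated to the unitary matrix \<open>U = [V, 1 - V V\<^sup>*; 0, V\<^sup>*]\<close>. Pinching
  \<open>U\<^sup>* (\<Lambda> \<oplus> 1) U\<close> to its diagonal blocks averages it with a unitary conjugate, and operator
  convexity applies to this average.\<close>

lemma operator_jensen_isometry:
  assumes f: "operator_convex_on {0<..} f"
    and V: "V \<in> carrier_mat N p" and iso: "mat_adjoint V * V = 1\<^sub>m p"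
    and lam: "\<And>j. j < N \<Longrightarrow> \<mu> j > (0::real)"
    and A: "A = mat_adjoint V * mat_diag N (\<lambda>j. complex_of_real (\<mu> j)) * V"
    and v: "v \<in> carrier_vec p"
  shows "Re ((mat_fun f A *\<^sub>v v) \<bullet>c v) \<le> (\<Sum>j<N. f (\<mu> j) * (cmod ((V *\<^sub>v v) $ j))\<^sup>2)"
proof -
  let ?L = "mat_diag N (\<lambda>j. complex_of_real (\<mu> j))"
  let ?V' = "mat_adjoint V"
  let ?n = "p + N"
  define Q where "Q = 1\<^sub>m N - V * ?V'"
  have V': "?V' \<in> carrier_mat p N" and VV: "V * ?V' \<in> carrier_mat N N" using V by auto
  have Q: "Q \<in> carrier_mat N N" using V by (auto simp: Q_def)
  have Qh: "mat_adjoint Q = Q"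
    using V V' VV by (simp add: Q_def mat_adjoint_minus[of _ N N] mat_adjoint_mult[of _ N p _ N])
  have c1: "V * ?V' * V = V"
    using V V' iso by (simp add: assoc_mult_mat[of _ N p _ N _ p])
  have QV: "Q * V = 0\<^sub>m N p"
    using V VV c1 by (simp add: Q_def minus_mult_distrib_mat[of _ N N _ _ p])
  have VQ: "?V' * Q = 0\<^sub>m p N"
    using arg_cong[OF QV, of mat_adjoint] Q V by (simp add: mat_adjoint_mult[of _ N N _ p] Qh)
  have QQ: "Q * Q = Q"
  proof -
    have "V * ?V' * Q = V * (?V' * Q)" using V V' Q by (simp add: assoc_mult_mat[of _ N p _ N _ N])
    hence "V * ?V' * Q = 0\<^sub>m N N" using VQ V by simp
    hence "(1\<^sub>m N - V * ?V') * Q = Q - 0\<^sub>m N N" using VV Q by (simp add: minus_mult_distrib_mat[of _ N N _ _ N])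
    moreover have "Q - 0\<^sub>m N N = Q" using Q by (intro eq_matI) auto
    ultimately show ?thesis by (simp flip: Q_def)
  qed
  \<comment> \<open>The block rows have heights \<open>N\<close>, \<open>p\<close> and the block
    columns widths \<open>p\<close>, \<open>N\<close>: \<open>U\<close> maps the splitting
    \<open>p + N\<close> to the splitting \<open>N + p\<close>.\<close>
  define U where "U = four_block_mat V Q (0\<^sub>m p p) ?V'"
  have Uc: "U \<in> carrier_mat ?n ?n" using V V' Q by (auto simp: U_def add.commute)
  have Ua: "mat_adjoint U = four_block_mat ?V' (0\<^sub>m p p) Q V"
    using V V' Q by (simp add: U_def mat_adjoint_four_block[of _ N p _ N _ p] Qh)
  have Qs: "Q + V * ?V' = 1\<^sub>m N" using VV by (intro eq_matI) (auto simp: Q_def simp del: index_mult_mat(1))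
  have "mat_adjoint U * U = four_block_mat (1\<^sub>m p) (0\<^sub>m p N) (0\<^sub>m N p) (1\<^sub>m N)"
    unfolding Ua unfolding U_def using V V' Q VV
    by (subst mult_four_block_mat[of _ p N _ p _ N _ _ p _ N])
       (auto simp: iso QV VQ QQ Qs)
  hence UU: "mat_adjoint U * U = 1\<^sub>m ?n" by simp
  have UU': "U * mat_adjoint U = 1\<^sub>m ?n"
    by (rule mat_mult_left_right_inverse[OF mat_adjoint_carrier_mat[OF Uc] Uc UU])
  have uni: "unitary_mat ?n (mat_adjoint U)" using Uc UU UU' by (auto simp: unitary_mat_def)
  \<comment> \<open>The padding value is 1 instead of 0 to keep the spectrum inside the domain of
    \<open>f\<close>; the padded vector does not see it.\<close>
  define x where "x i = (if i < N then \<mu> i else 1)" for i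
  have xpos: "x i > 0" if "i < ?n" for i using lam by (auto simp: x_def)
  let ?X = "mat_diag ?n (\<lambda>i. complex_of_real (x i))"
  have X: "?X = four_block_mat ?L (0\<^sub>m N p) (0\<^sub>m p N) (1\<^sub>m p)"
    by (intro eq_matI) (auto simp: mat_diag_def x_def)
  define M1 where "M1 = mat_adjoint U * ?X * U"
  have s1: "spectral_decomposition ?n M1 (mat_adjoint U) x"
    using spectral_decomposition_conj[OF spectral_decomposition_diag[of ?n x] uni]
    by (simp only: M1_def mat_adjoint_adjoint right_mult_one_mat[OF mat_adjoint_carrier_mat[OF Uc]])
  define B where "B = ?V' * (?L * Q)"
  define B' where "B' = Q * (?L * V)"
  define C where "C = Q * (?L * Q) + V * ?V'"
  have L: "?L \<in> carrier_mat N N" by simp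
  have A': "A = ?V' * (?L * V)" unfolding A by (rule assoc_mult_mat[OF V' L V])
  have LV: "?L * V \<in> carrier_mat N p" "?L * Q \<in> carrier_mat N N" 
    using mult_carrier_mat[OF L V] mult_carrier_mat[OF L Q] by blast+
  have Ac: "A \<in> carrier_mat p p" and Bc: "B \<in> carrier_mat p N" and B'c: "B' \<in> carrier_mat N p"
    and Cc: "C \<in> carrier_mat N N"
    unfolding A' B_def B'_def C_def
    using mult_carrier_mat[OF V' LV(1)] mult_carrier_mat[OF V' LV(2)] mult_carrier_mat[OF Q LV(1)]
      mult_carrier_mat[OF Q LV(2)] VV by (auto simp del: index_mult_mat)
  have XU: "?X * U = four_block_mat (?L * V) (?L * Q) (0\<^sub>m p p) ?V'"
    unfolding X U_def
    by (subst mult_four_block_mat[OF L zero_carrier_mat zero_carrier_mat one_carrier_mat V Q zero_carrier_mat V'])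
      (use V V' Q LV in simp)
  have "M1 = mat_adjoint U * (?X * U)"
    unfolding M1_def by (rule assoc_mult_mat[of _ ?n ?n _ ?n _ ?n]) (use Uc in auto)
  also have "\<dots> = four_block_mat A B B' C"
    unfolding XU Ua A' B_def B'_def C_def
    by (subst mult_four_block_mat[OF V' zero_carrier_mat Q V LV zero_carrier_mat V'])
      (use V V' Q LV VV mult_carrier_mat[OF V' LV(1)] mult_carrier_mat[OF V' LV(2)] in simp)
  finally have M1: "M1 = four_block_mat A B B' C" .
  \<comment> \<open>Conjugation by this reflection flips the signs of the off-diagonal blocks, so
    the mean of \<open>M1\<close> and \<open>R * M1 * R\<close> is the pinching of
    \<open>M1\<close>.\<close>
  define R where "R = four_block_mat (1\<^sub>m p) (0\<^sub>m p N) (0\<^sub>m N p) (- 1\<^sub>m N :: complex mat)"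
  have Rc: "R \<in> carrier_mat ?n ?n" by (auto simp: R_def)
  have Rh: "mat_adjoint R = R" by (intro eq_matI) (auto simp: R_def)
  have "R * R = four_block_mat (1\<^sub>m p) (0\<^sub>m p N) (0\<^sub>m N p) (1\<^sub>m N)"
    unfolding R_def by (subst mult_block_diag) auto
  hence RR: "R * R = 1\<^sub>m ?n" by simp
  have Ru: "unitary_mat ?n R" using Rc RR by (simp add: unitary_mat_def Rh)
  define M2 where "M2 = R * M1 * R"
  have s2: "spectral_decomposition ?n M2 (R * mat_adjoint U) x"
    using spectral_decomposition_conj[OF s1 Ru] by (simp add: M2_def Rh)
  have RM: "R * M1 = four_block_mat A B (- B') (- C)"
    unfolding R_def M1 using Ac Bc B'c Cc
    by (subst mult_four_block_mat[of _ p p _ N _ N _ _ p _ N]) auto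
  have M2: "M2 = four_block_mat A (- B) (- B') C"
    unfolding M2_def RM unfolding R_def using Ac Bc B'c Cc
    by (subst mult_four_block_mat[of _ p p _ N _ N _ _ p _ N]) auto
  let ?h = "complex_of_real (1/2)"
  define M where "M = ?h \<cdot>\<^sub>m M1 + complex_of_real (1 - 1/2) \<cdot>\<^sub>m M2"
  have M: "M = four_block_mat A (0\<^sub>m p N) (0\<^sub>m N p) C"
    unfolding M_def M1 M2 using Ac Bc B'c Cc
    by (intro eq_matI) (auto simp: algebra_simps)
  have h1: "hermitian_mat ?n M1" and h2: "hermitian_mat ?n M2"
    using s1 s2 spectral_decomposition_hermitian by blast+
  have "mat_adjoint A = A"
    unfolding A' using V V' L LV
    by (simp add: mat_adjoint_mult[of _ p N _ p] mat_adjoint_mult[of _ N N _ p]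
        assoc_mult_mat[of _ p N _ N _ p])
  then obtain UA a where sA: "spectral_decomposition p A UA a"
    using hermitian_spectral_decomposition[of p A] Ac by (auto simp: hermitian_mat_def)
  have "mat_adjoint C = C"
    unfolding C_def using V V' Q L LV VV
    by (simp add: mat_adjoint_add[of _ N N] mat_adjoint_mult[of _ N N _ N] mat_adjoint_mult[of _ N p _ N] Qh
        assoc_mult_mat[of _ N N _ N _ N])
  then obtain UC c where sC: "spectral_decomposition N C UC c"
    using hermitian_spectral_decomposition[of N C] Cc by (auto simp: hermitian_mat_def)
  note UA = spectral_decompositionD[OF sA] and UC = spectral_decompositionD[OF sC]
  have sM: "spectral_decomposition ?n M (four_block_mat UA (0\<^sub>m p N) (0\<^sub>m N p) UC) (\<lambda>i. if i < p then a i else c (i - p))"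
    unfolding M by (rule spectral_decomposition_block_diag[OF sA sC])
  have fM: "mat_fun f M = four_block_mat (mat_fun f A) (0\<^sub>m p N) (0\<^sub>m N p) (mat_fun f C)"
    using spectral_decompositionD(4)[OF spectral_decomposition_block_diag[OF
        spectral_decomposition_mat_fun[OF sA, of f] spectral_decomposition_mat_fun[OF sC, of f]]]
    unfolding mat_fun_eq[OF sM] if_distrib[of f] by simp
  note fc = spectral_decomposition_mat_fun[of _ _ _ _ f, THEN spectral_decompositionD(5)]
  have fAc: "mat_fun f A \<in> carrier_mat p p" and fCc: "mat_fun f C \<in> carrier_mat N N"
    and fMc: "mat_fun f M \<in> carrier_mat ?n ?n"
    and f1c: "mat_fun f M1 \<in> carrier_mat ?n ?n" and f2c: "mat_fun f M2 \<in> carrier_mat ?n ?n"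
    using fc[OF sA] fc[OF sC] fc[OF s1] fc[OF s2] fc[OF sM] by blast+
  have "loewner_le ?n (mat_fun f M)
      (?h \<cdot>\<^sub>m mat_fun f M1 + complex_of_real (1 - 1/2) \<cdot>\<^sub>m mat_fun f M2)"
    unfolding M_def
    using f[unfolded operator_convex_on_def, rule_format, OF h1 h2, of "1/2"]
      spectral_decomposition_spectrum[OF s1, of "{0<..}"] spectral_decomposition_spectrum[OF s2, of "{0<..}"] xpos
    by simp
  moreover define z where "z = v @\<^sub>v (0\<^sub>v N :: complex vec)"
  have z: "z \<in> carrier_vec ?n" using v by (auto simp: z_def)
  ultimately have le: "0 \<le> Re ((((?h \<cdot>\<^sub>m mat_fun f M1 + complex_of_real (1 - 1/2) \<cdot>\<^sub>m mat_fun f M2) - mat_fun f M) *\<^sub>v z) \<bullet>c z)"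
    by (simp add: loewner_le_def psd_mat_def)
  have avg: "Re ((((?h \<cdot>\<^sub>m mat_fun f M1 + complex_of_real (1 - 1/2) \<cdot>\<^sub>m mat_fun f M2) - mat_fun f M) *\<^sub>v z) \<bullet>c z)
     = (Re ((mat_fun f M1 *\<^sub>v z) \<bullet>c z) + Re ((mat_fun f M2 *\<^sub>v z) \<bullet>c z)) / 2 - Re ((mat_fun f M *\<^sub>v z) \<bullet>c z)"
    unfolding quadratic_form_combination[OF f1c f2c fMc z] by simp
  have fMz: "(mat_fun f M *\<^sub>v z) \<bullet>c z = (mat_fun f A *\<^sub>v v) \<bullet>c v"
  proof -
    have "mat_fun f M *\<^sub>v z = (mat_fun f A *\<^sub>v v) @\<^sub>v 0\<^sub>v N"
      unfolding fM z_def using v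
      by (subst four_block_mult_append_zero[OF fAc _ _ fCc]) (auto simp: zero_mult_mat_vec)
    moreover have "conjugate z = conjugate v @\<^sub>v 0\<^sub>v N"
      by (intro eq_vecI) (auto simp: z_def)
    moreover have "conjugate v \<in> carrier_vec p" "mat_fun f A *\<^sub>v v \<in> carrier_vec p" using v fAc by auto
    ultimately show ?thesis
      by (simp add: scalar_prod_append[of _ p _ N])
  qed
  \<comment> \<open>The image lives on the first \<open>N\<close> coordinates, where the eigenvalues
    are the given \<mu>.\<close>
  have Uz: "U *\<^sub>v z = (V *\<^sub>v v) @\<^sub>v 0\<^sub>v p"
    unfolding U_def z_def using v
    by (subst four_block_mult_append_zero[OF V Q _ V']) (auto simp: zero_mult_mat_vec)
  have "(\<Sum>i<?n. f (x i) * (cmod ((U *\<^sub>v z) $ i))\<^sup>2) = (\<Sum>i\<in>{..<N} \<union> {N..<N+p}. f (x i) * (cmod ((U *\<^sub>v z) $ i))\<^sup>2)"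
    by (intro sum.cong) auto
  also have "\<dots> = (\<Sum>j<N. f (x j) * (cmod ((U *\<^sub>v z) $ j))\<^sup>2) + (\<Sum>j=N..<N+p. f (x j) * (cmod ((U *\<^sub>v z) $ j))\<^sup>2)"
    by (intro sum.union_disjoint) auto
  also have "(\<Sum>j=N..<N+p. f (x j) * (cmod ((U *\<^sub>v z) $ j))\<^sup>2) = 0"
    unfolding Uz using V by (intro sum.neutral) auto
  also have "(\<Sum>j<N. f (x j) * (cmod ((U *\<^sub>v z) $ j))\<^sup>2) + 0 = (\<Sum>j<N. f (\<mu> j) * (cmod ((V *\<^sub>v v) $ j))\<^sup>2)"
    unfolding Uz x_def using V by (auto intro!: sum.cong)
  finally have S: "(\<Sum>i<?n. f (x i) * (cmod ((U *\<^sub>v z) $ i))\<^sup>2) = (\<Sum>j<N. f (\<mu> j) * (cmod ((V *\<^sub>v v) $ j))\<^sup>2)" .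
  have q1: "(mat_fun f M1 *\<^sub>v z) \<bullet>c z = complex_of_real (\<Sum>j<N. f (\<mu> j) * (cmod ((V *\<^sub>v v) $ j))\<^sup>2)"
    using spectral_decomposition_quadratic_form[OF spectral_decomposition_mat_fun[OF s1] z] S
    by (simp del: of_real_sum)
  \<comment> \<open>The reflection fixes the padded vector, so the two averaged terms take the same
    value.\<close>
  have Rz: "R *\<^sub>v z = z"
    unfolding R_def z_def using v
    by (subst four_block_mult_append_zero[of _ p p _ N _ N]) (auto simp: zero_mult_mat_vec)
  have "mat_adjoint (R * mat_adjoint U) *\<^sub>v z = U *\<^sub>v (R *\<^sub>v z)"
    using Rc Uc z by (simp add: mat_adjoint_mult[of _ ?n ?n _ ?n] Rh assoc_mult_mat_vec[of _ ?n ?n _ ?n])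
  hence q2: "(mat_fun f M2 *\<^sub>v z) \<bullet>c z = complex_of_real (\<Sum>j<N. f (\<mu> j) * (cmod ((V *\<^sub>v v) $ j))\<^sup>2)"
    using spectral_decomposition_quadratic_form[OF spectral_decomposition_mat_fun[OF s2] z] S
    by (simp add: Rz del: of_real_sum)
  show ?thesis using le avg fMz q1 q2 by simp
qed

section \<open>The relative entropy in terms of spectral decompositions\<close>

text \<open>Splits a flattened tensor index along \<open>k = a * n + b\<close>, the convention of
  \<open>kronecker\<close> and \<open>vec_rows\<close>.\<close>

lemma sum_lessThan_mult:
  fixes g :: "nat \<Rightarrow> nat \<Rightarrow> 'a :: comm_monoid_add"
  assumes "\<And>k. k < m * n \<Longrightarrow> h k = g (k div n) (k mod n)"
  shows "(\<Sum>k<m * n. h k) = (\<Sum>a<m. \<Sum>b<n. g a b)"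
proof -
  have "a * n + b < m * n" if "a < m" "b < n" for a b
    using that mult_le_mono1[of "Suc a" m n] by simp
  moreover have "k mod n < n" if "k < m * n" for k
    using that by (cases n) auto
  ultimately have "(\<Sum>k<m * n. h k) = (\<Sum>(a, b)\<in>{..<m} \<times> {..<n}. g a b)"
    by (intro sum.reindex_bij_witness[of _ "\<lambda>(a, b). a * n + b" "\<lambda>k. (k div n, k mod n)"])
      (auto simp: less_mult_imp_div_less assms)
  thus ?thesis by (simp add: sum.cartesian_product)
qed

text \<open>Let \<open>V\<close> have the conjugated vectors \<open>w j\<close> as rows. The frame
  condition says that \<open>V\<close> is an isometry, and \<open>A\<close> is the compression of
  the diagonal matrix of the \<open>l j\<close>. The vectors may be linearly dependent, which lets
  \<open>J\<close> be larger than \<open>p\<close>. The index set is enumerated by \<open>h\<close>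
  only to form matrices.\<close>

lemma operator_jensen_frame:
  fixes w :: "'j \<Rightarrow> nat \<Rightarrow> complex" and l :: "'j \<Rightarrow> real"
  assumes f: "operator_convex_on {0<..} f" and J: "finite J"
    and l: "\<And>j. j \<in> J \<Longrightarrow> l j > 0"
    and frame: "\<And>x y. x < p \<Longrightarrow> y < p \<Longrightarrow>
      (\<Sum>j\<in>J. w j x * cnj (w j y)) = (if x = y then 1 else 0)"
    and A: "A \<in> carrier_mat p p"
      "\<And>x y. x < p \<Longrightarrow> y < p \<Longrightarrow> A $$ (x, y) = (\<Sum>j\<in>J. complex_of_real (l j) * (w j x * cnj (w j y)))"
    and v: "v \<in> carrier_vec p"
  shows "Re ((mat_fun f A *\<^sub>v v) \<bullet>c v) \<le> (\<Sum>j\<in>J. f (l j) * (cmod (\<Sum>x<p. cnj (w j x) * v $ x))\<^sup>2)"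
proof -
  define N where "N = card J"
  obtain h where h: "bij_betw h {..<N} J"
    using ex_bij_betw_nat_finite[OF J] by (auto simp: N_def lessThan_atLeast0)
  have re: "(\<Sum>k<N. g (h k)) = (\<Sum>j\<in>J. g j)" for g :: "'j \<Rightarrow> 'b :: comm_monoid_add"
    by (rule sum.reindex_bij_betw[OF h])
  have hJ: "h k \<in> J" if "k < N" for k using h that by (auto simp: bij_betw_def)
  define V where "V = mat N p (\<lambda>(k, x). cnj (w (h k) x))"
  have V: "V \<in> carrier_mat N p" by (simp add: V_def)
  let ?L = "mat_diag N (\<lambda>k. complex_of_real (l (h k)))"
  have iso: "mat_adjoint V * V = 1\<^sub>m p"
    by (intro eq_matI) (auto simp: index_mult_mat_sum[of _ _ _ _ N] V_def re[of "\<lambda>j. w j _ * cnj (w j _)"] frame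
        simp del: index_mult_mat(1))
  have "?L * V = mat N p (\<lambda>(k, x). complex_of_real (l (h k)) * cnj (w (h k) x))"
    unfolding mat_diag_mult_left[OF V] by (intro eq_matI) (auto simp: V_def)
  hence "mat_adjoint V * (?L * V) = A"
    using A(1) V
    by (intro eq_matI)
      (auto simp: index_mult_mat_sum[of _ _ _ _ N] V_def A(2) mult_ac
        re[of "\<lambda>j. complex_of_real (l j) * (w j _ * cnj (w j _))", symmetric]
        simp del: index_mult_mat(1))
  hence Ae: "A = mat_adjoint V * ?L * V"
    using V by (simp add: assoc_mult_mat[of _ p N _ N _ p])
  have "Re ((mat_fun f A *\<^sub>v v) \<bullet>c v) \<le> (\<Sum>k<N. f (l (h k)) * (cmod ((V *\<^sub>v v) $ k))\<^sup>2)"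
    by (rule operator_jensen_isometry[OF f V iso _ Ae v]) (use l hJ in auto)
  also have "\<dots> = (\<Sum>k<N. f (l (h k)) * (cmod (\<Sum>x<p. cnj (w (h k) x) * v $ x))\<^sup>2)"
    using V v by (intro sum.cong) (auto simp: index_mult_mat_vec_sum[of _ p] V_def simp del: index_mult_mat_vec)
  also have "\<dots> = (\<Sum>j\<in>J. f (l j) * (cmod (\<Sum>x<p. cnj (w j x) * v $ x))\<^sup>2)"
    by (rule re)
  finally show ?thesis .
qed

section \<open>Entrywise functional calculus and positive eigenvalues\<close>

lemma mult_diag_adjoint_index:
  assumes "U \<in> carrier_mat n n" "V \<in> carrier_mat n n" "x < n" "y < n"
  shows "(U * mat_diag n d * mat_adjoint V) $$ (x, y) = (\<Sum>i<n. d i * (U $$ (x, i) * cnj (V $$ (y, i))))"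
  using assms
  by (simp add: mat_diag_mult_right index_mult_mat_sum[of _ _ _ _ n] mult_ac del: index_mult_mat(1))

lemma spectral_decomposition_index:
  assumes "spectral_decomposition n A U a"
  shows "x < n \<Longrightarrow> y < n \<Longrightarrow>
      A $$ (x, y) = (\<Sum>i<n. complex_of_real (a i) * (U $$ (x, i) * cnj (U $$ (y, i))))"
    "x < n \<Longrightarrow> y < n \<Longrightarrow> (\<Sum>i<n. U $$ (x, i) * cnj (U $$ (y, i))) = (if x = y then 1 else 0)"
    "i < n \<Longrightarrow> j < n \<Longrightarrow> (\<Sum>x<n. cnj (U $$ (x, i)) * U $$ (x, j)) = (if i = j then 1 else 0)"
proof -
  note U = spectral_decompositionD[OF assms]
  show "x < n \<Longrightarrow> y < n \<Longrightarrow>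
      A $$ (x, y) = (\<Sum>i<n. complex_of_real (a i) * (U $$ (x, i) * cnj (U $$ (y, i))))"
    unfolding U(4) using U(1) by (simp add: mult_diag_adjoint_index del: index_mult_mat(1))
  show "x < n \<Longrightarrow> y < n \<Longrightarrow> (\<Sum>i<n. U $$ (x, i) * cnj (U $$ (y, i))) = (if x = y then 1 else 0)"
    using arg_cong[OF U(2), of "\<lambda>M. M $$ (x, y)"] U(1)
    by (simp add: index_mult_mat_sum[of _ _ _ _ n] del: index_mult_mat(1))
  show "i < n \<Longrightarrow> j < n \<Longrightarrow> (\<Sum>x<n. cnj (U $$ (x, i)) * U $$ (x, j)) = (if i = j then 1 else 0)"
    using arg_cong[OF U(3), of "\<lambda>M. M $$ (i, j)"] U(1)
    by (simp add: index_mult_mat_sum[of _ _ _ _ n] del: index_mult_mat(1))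
qed

lemma spectral_decompositionI:
  assumes A: "A \<in> carrier_mat n n" and U: "U \<in> carrier_mat n n"
    and e: "\<And>x y. x < n \<Longrightarrow> y < n \<Longrightarrow>
      A $$ (x, y) = (\<Sum>i<n. complex_of_real (a i) * (U $$ (x, i) * cnj (U $$ (y, i))))"
    and u: "\<And>x y. x < n \<Longrightarrow> y < n \<Longrightarrow> (\<Sum>i<n. U $$ (x, i) * cnj (U $$ (y, i))) = (if x = y then 1 else 0)"
  shows "spectral_decomposition n A U a"
proof -
  have 1: "U * mat_adjoint U = 1\<^sub>m n"
    using U u by (intro eq_matI) (auto simp: index_mult_mat_sum[of _ _ _ _ n] simp del: index_mult_mat(1))
  have 2: "mat_adjoint U * U = 1\<^sub>m n"
    by (rule mat_mult_left_right_inverse[OF U mat_adjoint_carrier_mat[OF U] 1])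
  have "A = U * mat_diag n (\<lambda>i. complex_of_real (a i)) * mat_adjoint U"
    using A U e by (intro eq_matI) (auto simp: mult_diag_adjoint_index simp del: index_mult_mat(1))
  thus ?thesis using 1 2 U by (simp add: spectral_decomposition_def unitary_mat_def)
qed

lemma mat_fun_mult:
  assumes "spectral_decomposition n A U a"
  shows "mat_fun f A * mat_fun g A = mat_fun (\<lambda>x. f x * g x) A"
proof -
  note U = spectral_decompositionD[OF assms]
  let ?D = "\<lambda>f. mat_diag n (\<lambda>i. complex_of_real (f (a i)))"
  have D: "?D f \<in> carrier_mat n n" for f :: "real \<Rightarrow> real" by simp
  have U': "mat_adjoint U \<in> carrier_mat n n" using U by simp
  have "mat_fun f A * mat_fun g A = U * ?D f * ((mat_adjoint U * U) * (?D g * mat_adjoint U))"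
    unfolding mat_fun_eq[OF assms] using U(1) U' D[of f] D[of g]
    by (simp add: assoc_mult_mat[of _ n n _ n _ n])
  also have "\<dots> = U * (?D f * ?D g) * mat_adjoint U"
    unfolding U(3) left_mult_one_mat[OF mult_square_carrier[OF D U']]
    using U(1) U' D[of f] D[of g] by (simp only: assoc_mult_mat[of _ n n _ n _ n] mult_square_carrier)
  finally show ?thesis by (simp add: mat_fun_eq[OF assms])
qed

lemma mat_fun_cong:
  assumes "spectral_decomposition n A U a" "\<And>i. i < n \<Longrightarrow> f (a i) = g (a i)"
  shows "mat_fun f A = mat_fun g A"
  unfolding mat_fun_eq[OF assms(1)]
  by (intro arg_cong2[of _ _ _ _ "(*)"] refl eq_matI) (auto simp: mat_diag_def assms(2))

lemma mat_fun_id: "spectral_decomposition n A U a \<Longrightarrow> mat_fun (\<lambda>x. x) A = A"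
  using mat_fun_eq[of n A U a "\<lambda>x. x"] spectral_decompositionD(4)[of n A U a] by (simp only:)

lemma mat_fun_one:
  assumes "spectral_decomposition n A U a" "\<And>i. i < n \<Longrightarrow> f (a i) = 1"
  shows "mat_fun f A = 1\<^sub>m n"
proof -
  note U = spectral_decompositionD[OF assms(1)]
  have "mat_fun f A = U * mat_diag n (\<lambda>i. complex_of_real 1) * mat_adjoint U"
    using mat_fun_cong[OF assms(1), of f "\<lambda>_. 1"] assms(2) mat_fun_eq[OF assms(1), of "\<lambda>_. 1"]
    by metis
  thus ?thesis using right_mult_one_mat[OF U(1)] U(2) by simp
qed

text \<open>A right inverse of a square matrix is two-sided, so \<open>A\<close> is a unit of the
  matrix ring; this excludes the value \<open>None\<close> of \<open>mat_inverse\<close>.\<close>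

lemma mat_inverse_eqI:
  assumes A: "(A :: 'a :: field mat) \<in> carrier_mat n n" and B: "B \<in> carrier_mat n n" and AB: "A * B = 1\<^sub>m n"
  shows "the (mat_inverse A) = B"
proof -
  have BA: "B * A = 1\<^sub>m n" by (rule mat_mult_left_right_inverse[OF A B AB])
  have "A \<in> Units (ring_mat TYPE('a) n ())"
    using A B AB BA by (auto simp: Units_def ring_mat_def)
  then obtain C where C: "mat_inverse A = Some C"
    using mat_inverse(1)[OF A, of "()"] by (cases "mat_inverse A") auto
  with mat_inverse(2)[OF A C] have "C * A = 1\<^sub>m n" "C \<in> carrier_mat n n" by auto
  hence "C = C * (A * B)" using AB by simp
  also have "\<dots> = B" using \<open>C * A = 1\<^sub>m n\<close> \<open>C \<in> _\<close> A B by (simp flip: assoc_mult_mat[of _ n n _ n _ n])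
  finally show ?thesis using C by simp
qed

text \<open>The columns of \<open>U\<close> serve as test vectors through which positivity of the
  quadratic form becomes positivity of the eigenvalues.\<close>

lemma spectral_decomposition_eigenvalue:
  assumes s: "spectral_decomposition n A U a" and i: "i < n"
  shows "Re ((A *\<^sub>v col U i) \<bullet>c col U i) = a i" "col U i \<in> carrier_vec n" "col U i \<noteq> 0\<^sub>v n"
proof -
  note U = spectral_decompositionD[OF s]
  let ?v = "col U i"
  show v: "?v \<in> carrier_vec n" using U(1) i by auto
  have Uv: "(mat_adjoint U *\<^sub>v ?v) $ j = (if j = i then 1 else 0)" if "j < n" for j
    using that i U(1) v spectral_decomposition_index(3)[OF s that i]
    by (simp add: index_mult_mat_vec_sum[of _ n] del: index_mult_mat_vec)
  show "?v \<noteq> 0\<^sub>v n"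
  proof
    assume "?v = 0\<^sub>v n"
    hence "(mat_adjoint U *\<^sub>v ?v) $ i = 0" using U i by auto
    thus False using Uv[OF i] by simp
  qed
  have "Re ((A *\<^sub>v ?v) \<bullet>c ?v) = (\<Sum>j<n. a j * (if j = i then 1 else 0))"
    unfolding spectral_decomposition_quadratic_form[OF s v] Re_complex_of_real
    by (intro sum.cong) (auto simp: Uv simp del: index_mult_mat_vec)
  also have "\<dots> = a i" using i by (simp add: if_distrib[of "\<lambda>x. _ * x"] cong: if_cong)
  finally show "Re ((A *\<^sub>v ?v) \<bullet>c ?v) = a i" .
qed

lemma strictly_positive_eigenvalues:
  assumes "strictly_positive_mat n A" "spectral_decomposition n A U a" "i < n"
  shows "a i > 0"
  using assms(1) spectral_decomposition_eigenvalue[OF assms(2,3)]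
  by (auto simp: strictly_positive_mat_def)

lemma strictly_positive_imp_psd:
  assumes "strictly_positive_mat n A"
  shows "psd_mat n A"
  unfolding psd_mat_def
proof (intro conjI ballI)
  show "hermitian_mat n A" using assms by (simp add: strictly_positive_mat_def)
  fix v :: "complex vec" assume v: "v \<in> carrier_vec n"
  have "A \<in> carrier_mat n n" using assms by (simp add: strictly_positive_mat_def hermitian_mat_def)
  thus "0 \<le> Re ((A *\<^sub>v v) \<bullet>c v)"
    using assms v quadratic_form_sum[of A n v]
    by (cases "v = 0\<^sub>v n") (auto simp: strictly_positive_mat_def less_imp_le)
qed

lemma strictly_positive_decomposition:
  assumes "strictly_positive_mat n A"
  obtains U a where "spectral_decomposition n A U a" "\<And>i. i < n \<Longrightarrow> a i > 0"
  using assms hermitian_spectral_decomposition[of n A] strictly_positive_eigenvalues[OF assms]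
  by (auto simp: strictly_positive_mat_def)

lemma inverse_eq_mat_fun:
  assumes s: "spectral_decomposition n A U a" and pos: "\<And>i. i < n \<Longrightarrow> a i > 0"
  shows "the (mat_inverse A) = mat_fun inverse A"
proof (rule mat_inverse_eqI)
  show "A \<in> carrier_mat n n" "mat_fun inverse A \<in> carrier_mat n n"
    by (rule spectral_decompositionD(5)[OF s]
        spectral_decompositionD(5)[OF spectral_decomposition_mat_fun[OF s, of inverse]])+
  have "A * mat_fun inverse A = mat_fun (\<lambda>x. x * inverse x) A"
    using mat_fun_mult[OF s, of "\<lambda>x. x" inverse] by (simp add: mat_fun_id[OF s])
  also have "\<dots> = 1\<^sub>m n" by (rule mat_fun_one[OF s]) (use pos in force)
  finally show "A * mat_fun inverse A = 1\<^sub>m n" .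
qed

text \<open>The relative modular operator has the eigenvalues \<open>q j / p i\<close> with
  eigenvectors formed from column \<open>j\<close> of \<open>V\<close> and the conjugate of column
  \<open>i\<close> of \<open>U\<close>. The coefficient of the vectorized square root of \<rho>
  along such an eigenvector is the root of \<open>p i\<close> times the overlap of the two
  columns.\<close>

theorem f_relative_entropy_spectral:
  assumes r: "spectral_decomposition n \<rho> U p" and pos: "\<And>i. i < n \<Longrightarrow> p i > 0"
    and s: "spectral_decomposition n \<sigma> V q"
  shows "f_relative_entropy f \<rho> \<sigma> =
    (\<Sum>j<n. \<Sum>i<n. p i * f (q j / p i) * (cmod (\<Sum>x<n. cnj (V $$ (x, j)) * U $$ (x, i)))\<^sup>2)"
proof -
  let ?I = "mat_fun inverse \<rho>" and ?R = "mat_fun sqrt \<rho>"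
  let ?K = "kronecker \<sigma> (transpose_mat (the (mat_inverse \<rho>)))"
  note i = spectral_decomposition_mat_fun[OF r, of inverse] and R = spectral_decomposition_mat_fun[OF r, of sqrt]
  note rI = spectral_decomposition_index[OF r] and sI = spectral_decomposition_index[OF s]
    and iI = spectral_decomposition_index[OF i] and RI = spectral_decomposition_index[OF R]
  have c: "\<sigma> \<in> carrier_mat n n" "?I \<in> carrier_mat n n" "?R \<in> carrier_mat n n"
    "U \<in> carrier_mat n n" "V \<in> carrier_mat n n"
    by (rule spectral_decompositionD[OF s] spectral_decompositionD[OF i] spectral_decompositionD[OF R]
        spectral_decompositionD[OF r])+
  \<comment> \<open>The conjugate on \<open>U\<close> comes from the transpose of the inverse of
    \<rho>. A column index \<open>l\<close> encodes the pair \<open>j = l div n\<close>,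
    \<open>i = l mod n\<close>.\<close>
  define W where "W = mat (n * n) (n * n) (\<lambda>(k, l). V $$ (k div n, l div n) * cnj (U $$ (k mod n, l mod n)))"
  define \<mu> where "\<mu> l = q (l div n) / p (l mod n)" for l
  have dm: "k div n < n \<and> k mod n < n" if "k < n * n" for k
    using that by (cases "n = 0") (auto simp: less_mult_imp_div_less)
  have K: "spectral_decomposition (n * n) ?K W \<mu>"
  proof (rule spectral_decompositionI)
    fix x y assume xy: "x < n * n" "y < n * n"
    have "(\<Sum>l<n * n. W $$ (x, l) * cnj (W $$ (y, l))) =
      (\<Sum>l<n * n. (V $$ (x div n, l div n) * cnj (V $$ (y div n, l div n))) *
        (U $$ (y mod n, l mod n) * cnj (U $$ (x mod n, l mod n))))"
      using xy by (intro sum.cong) (auto simp: W_def)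
    also have "\<dots> = (\<Sum>a<n. V $$ (x div n, a) * cnj (V $$ (y div n, a))) *
        (\<Sum>b<n. U $$ (y mod n, b) * cnj (U $$ (x mod n, b)))"
      unfolding sum_product by (rule sum_lessThan_mult) simp
    also have "\<dots> = (if x = y then 1 else 0)"
    proof -
      have "x = y \<longleftrightarrow> x div n = y div n \<and> y mod n = x mod n" by (metis div_mult_mod_eq)
      thus ?thesis using dm[OF xy(1)] dm[OF xy(2)] by (simp add: sI(2) rI(2))
    qed
    finally show "(\<Sum>l<n * n. W $$ (x, l) * cnj (W $$ (y, l))) = (if x = y then 1 else 0)" .
    have "?K $$ (x, y) = \<sigma> $$ (x div n, y div n) * ?I $$ (y mod n, x mod n)"
      using xy c dm[OF xy(1)] dm[OF xy(2)] by (simp add: kronecker_def inverse_eq_mat_fun[OF r pos])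
    also have "\<dots> = (\<Sum>a<n. complex_of_real (q a) * (V $$ (x div n, a) * cnj (V $$ (y div n, a)))) *
        (\<Sum>b<n. complex_of_real (inverse (p b)) * (U $$ (y mod n, b) * cnj (U $$ (x mod n, b))))"
      using dm[OF xy(1)] dm[OF xy(2)] by (simp only: iI(1) sI(1))
    also have "\<dots> = (\<Sum>l<n * n. complex_of_real (q (l div n)) * (V $$ (x div n, l div n) * cnj (V $$ (y div n, l div n))) *
        (complex_of_real (inverse (p (l mod n))) * (U $$ (y mod n, l mod n) * cnj (U $$ (x mod n, l mod n)))))"
      unfolding sum_product by (rule sum_lessThan_mult[symmetric]) simp
    also have "\<dots> = (\<Sum>l<n * n. complex_of_real (\<mu> l) * (W $$ (x, l) * cnj (W $$ (y, l))))"
      using xy by (intro sum.cong) (auto simp: W_def \<mu>_def divide_inverse)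
    finally show "?K $$ (x, y) = \<dots>" .
  qed (use c in \<open>auto simp: W_def kronecker_def inverse_eq_mat_fun[OF r pos]\<close>)
  let ?v = "vec_rows ?R"
  have v: "?v \<in> carrier_vec (n * n)" using c by (simp add: vec_rows_def)
  have Wv: "(mat_adjoint W *\<^sub>v ?v) $ l = complex_of_real (sqrt (p (l mod n))) * (\<Sum>x<n. cnj (V $$ (x, l div n)) * U $$ (x, l mod n))"
    if l: "l < n * n" for l
  proof -
    have URU: "(\<Sum>y<n. U $$ (y, l mod n) * ?R $$ (x, y)) = complex_of_real (sqrt (p (l mod n))) * U $$ (x, l mod n)"
      if x: "x < n" for x
    proof -
      have "(\<Sum>y<n. U $$ (y, l mod n) * ?R $$ (x, y)) =
        (\<Sum>y<n. \<Sum>k<n. complex_of_real (sqrt (p k)) * U $$ (x, k) * (cnj (U $$ (y, k)) * U $$ (y, l mod n)))"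
        using x by (auto simp: RI(1) sum_distrib_left mult_ac intro!: sum.cong)
      also have "\<dots> = (\<Sum>k<n. \<Sum>y<n. complex_of_real (sqrt (p k)) * U $$ (x, k) * (cnj (U $$ (y, k)) * U $$ (y, l mod n)))"
        by (rule sum.swap)
      also have "\<dots> = (\<Sum>k<n. complex_of_real (sqrt (p k)) * U $$ (x, k) * (if k = l mod n then 1 else 0))"
        using dm[OF l] by (simp flip: sum_distrib_left add: rI(3))
      also have "\<dots> = complex_of_real (sqrt (p (l mod n))) * U $$ (x, l mod n)"
        using dm[OF l] by (simp add: if_distrib[of "\<lambda>x. _ * x"] cong: if_cong)
      finally show ?thesis .
    qed
    have "(mat_adjoint W *\<^sub>v ?v) $ l = (\<Sum>k<n * n. cnj (V $$ (k div n, l div n)) * (U $$ (k mod n, l mod n) * ?R $$ (k div n, k mod n)))"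
      using l c by (subst index_mult_mat_vec_sum[of _ "n * n"]) (auto simp: W_def vec_rows_def mult_ac intro!: sum.cong)
    also have "\<dots> = (\<Sum>x<n. \<Sum>y<n. cnj (V $$ (x, l div n)) * (U $$ (y, l mod n) * ?R $$ (x, y)))"
      by (rule sum_lessThan_mult) simp
    also have "\<dots> = (\<Sum>x<n. cnj (V $$ (x, l div n)) * (complex_of_real (sqrt (p (l mod n))) * U $$ (x, l mod n)))"
      by (simp flip: sum_distrib_left add: URU)
    finally show ?thesis by (simp add: sum_distrib_left mult_ac)
  qed
  have "f_relative_entropy f \<rho> \<sigma> = (\<Sum>l<n * n. f (\<mu> l) * (cmod ((mat_adjoint W *\<^sub>v ?v) $ l))\<^sup>2)"
    unfolding f_relative_entropy_def
      spectral_decomposition_quadratic_form[OF spectral_decomposition_mat_fun[OF K] v] Re_complex_of_real ..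
  also have "\<dots> = (\<Sum>l<n * n. p (l mod n) * f (q (l div n) / p (l mod n)) *
      (cmod (\<Sum>x<n. cnj (V $$ (x, l div n)) * U $$ (x, l mod n)))\<^sup>2)"
    using dm pos by (intro sum.cong) (auto simp: Wv norm_mult power_mult_distrib \<mu>_def less_imp_le
        simp del: index_mult_mat_vec)
  also have "\<dots> = (\<Sum>j<n. \<Sum>i<n. p i * f (q j / p i) * (cmod (\<Sum>x<n. cnj (V $$ (x, j)) * U $$ (x, i)))\<^sup>2)"
    by (rule sum_lessThan_mult) simp
  finally show ?thesis .
qed

text \<open>Moves the ensemble sums over \<open>I\<close> and \<open>J\<close> inside, where the
  completeness and reduction identities of the two ensembles apply separately; \<open>K\<close> and
  \<open>L\<close> are two copies of the environment index.\<close>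

lemma sum_bilinear:
  fixes c d :: "_ \<Rightarrow> complex"
  shows "(\<Sum>i\<in>I. \<Sum>j\<in>J. c i * d j * (\<Sum>k\<in>K. b j k * a i k) * (\<Sum>l\<in>L. b' j l * a' i l)) =
    (\<Sum>k\<in>K. \<Sum>l\<in>L. (\<Sum>j\<in>J. d j * (b j k * b' j l)) * (\<Sum>i\<in>I. c i * (a i k * a' i l)))"
proof -
  let ?T = "\<lambda>i j k l. c i * d j * (b j k * a i k) * (b' j l * a' i l)"
  have "(\<Sum>i\<in>I. \<Sum>j\<in>J. c i * d j * (\<Sum>k\<in>K. b j k * a i k) * (\<Sum>l\<in>L. b' j l * a' i l)) =
      (\<Sum>i\<in>I. \<Sum>j\<in>J. \<Sum>k\<in>K. \<Sum>l\<in>L. ?T i j k l)"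
    by (simp only: mult.assoc sum_product) (simp only: sum_distrib_left mult.assoc)
  also have "\<dots> = (\<Sum>i\<in>I. \<Sum>k\<in>K. \<Sum>j\<in>J. \<Sum>l\<in>L. ?T i j k l)"
    by (intro sum.cong refl) (rule sum.swap)
  also have "\<dots> = (\<Sum>k\<in>K. \<Sum>i\<in>I. \<Sum>j\<in>J. \<Sum>l\<in>L. ?T i j k l)"
    by (rule sum.swap)
  also have "\<dots> = (\<Sum>k\<in>K. \<Sum>i\<in>I. \<Sum>l\<in>L. \<Sum>j\<in>J. ?T i j k l)"
    by (intro sum.cong refl) (rule sum.swap)
  also have "\<dots> = (\<Sum>k\<in>K. \<Sum>l\<in>L. \<Sum>i\<in>I. \<Sum>j\<in>J. ?T i j k l)"
    by (intro sum.cong refl) (rule sum.swap)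
  also have "\<dots> = (\<Sum>k\<in>K. \<Sum>l\<in>L. \<Sum>j\<in>J. \<Sum>i\<in>I. ?T i j k l)"
    by (intro sum.cong refl) (rule sum.swap)
  also have "\<dots> = (\<Sum>k\<in>K. \<Sum>l\<in>L. (\<Sum>j\<in>J. d j * (b j k * b' j l)) * (\<Sum>i\<in>I. c i * (a i k * a' i l)))"
    by (simp only: sum_product) (simp only: mult_ac)
  finally show ?thesis .
qed

lemma sum_sesquilinear:
  fixes c :: "_ \<Rightarrow> complex"
  shows "(\<Sum>j\<in>J. c j * ((\<Sum>k\<in>K. a k * b j k) * (\<Sum>l\<in>L. a' l * b' j l))) =
    (\<Sum>k\<in>K. \<Sum>l\<in>L. (\<Sum>j\<in>J. c j * (b j k * b' j l)) * (a k * a' l))"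
  using sum_bilinear[where I = "{()}" and J = J and K = K and L = L and c = "\<lambda>_. 1" and d = c
      and a = "\<lambda>_. a" and a' = "\<lambda>_. a'" and b = b and b' = b']
  by (simp add: mult_ac)

text \<open>The guard \<open>P\<close> carries the Kronecker delta of the system while the delta of
  the environment is summed away.\<close>

lemma sum_if_and:
  assumes "finite K"
  shows "(\<Sum>k\<in>K. \<Sum>l\<in>K. (if P \<and> k = l then 1 else 0) * X k l) = (if P then \<Sum>k\<in>K. X k k else (0 :: complex))"
  using assms by (auto simp: if_distrib[of "\<lambda>x. x * _"] cong: if_cong intro!: sum.neutral)

lemma hermitian_mat_index:
  "hermitian_mat n A \<Longrightarrow> x < n \<Longrightarrow> y < n \<Longrightarrow> cnj (A $$ (x, y)) = A $$ (y, x)"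
  by (metis carrier_matD(1) carrier_matD(2) hermitian_mat_def mat_adjoint_index)

lemma mat_index_mult3:
  assumes "A \<in> carrier_mat n n" "B \<in> carrier_mat n n" "C \<in> carrier_mat n n" "x < n" "y < n"
  shows "(A * B * C) $$ (x, y) = (\<Sum>u<n. \<Sum>v<n. A $$ (x, v) * B $$ (v, u) * C $$ (u, y))"
proof -
  have "(A * B * C) $$ (x, y) = (\<Sum>u<n. (A * B) $$ (x, u) * C $$ (u, y))"
    using assms by (subst index_mult_mat_sum[of _ _ _ _ n]) auto
  also have "\<dots> = (\<Sum>u<n. \<Sum>v<n. A $$ (x, v) * B $$ (v, u) * C $$ (u, y))"
    using assms by (intro sum.cong refl) (simp add: index_mult_mat_sum[of _ _ _ _ n] sum_distrib_right
        del: index_mult_mat(1))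
  finally show ?thesis .
qed

lemma positive_square_roots:
  assumes r: "spectral_decomposition n \<rho> U p" and p: "\<And>i. i < n \<Longrightarrow> p i > 0"
  defines "R \<equiv> mat_fun sqrt \<rho>" and "S \<equiv> mat_fun (\<lambda>x. inverse (sqrt x)) \<rho>"
  shows "R * R = \<rho>" "R * S = 1\<^sub>m n" "S * S = mat_fun inverse \<rho>" "S * \<rho> * S = 1\<^sub>m n"
proof -
  show "R * S = 1\<^sub>m n"
    unfolding R_def S_def mat_fun_mult[OF r] by (rule mat_fun_one[OF r]) (use p in force)
  have "R * R = mat_fun (\<lambda>x. x) \<rho>"
    unfolding R_def mat_fun_mult[OF r]
    by (rule mat_fun_cong[OF r]) (use p in \<open>force simp: less_imp_le\<close>)
  thus "R * R = \<rho>" by (simp add: mat_fun_id[OF r])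
  show "S * S = mat_fun inverse \<rho>"
    unfolding S_def mat_fun_mult[OF r]
    by (rule mat_fun_cong[OF r]) (use p in \<open>force simp flip: inverse_mult_distrib\<close>)
  have "S * \<rho> = mat_fun (\<lambda>x. inverse (sqrt x) * x) \<rho>"
    using mat_fun_mult[OF r, of "\<lambda>x. inverse (sqrt x)" "\<lambda>x. x"] by (simp add: S_def mat_fun_id[OF r])
  hence "S * \<rho> * S = mat_fun (\<lambda>x. (inverse (sqrt x) * x) * inverse (sqrt x)) \<rho>"
    unfolding S_def by (simp only: mat_fun_mult[OF r])
  also have "\<dots> = 1\<^sub>m n"
  proof (rule mat_fun_one[OF r])
    fix i assume "i < n"
    hence "sqrt (p i) * sqrt (p i) = p i" "sqrt (p i) \<noteq> 0" using p[of i] by auto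
    thus "inverse (sqrt (p i)) * p i * inverse (sqrt (p i)) = 1" by (simp add: field_simps)
  qed
  finally show "S * \<rho> * S = 1\<^sub>m n" .
qed

text \<open>The data are pure-state ensembles on a system of dimension \<open>m\<close> with environment \<open>K\<close>, and
  \<open>\<rho>\<close>, \<open>\<sigma>\<close> are their reduced states. Jensen's inequality is applied to the frame
  \<open>w\<^sub>i\<^sub>j = \<surd>a\<^sub>i vec (B\<^sub>j (\<rho>\<^sup>-\<^sup>1\<^sup>/\<^sup>2 A\<^sub>i)\<^sup>*)\<close>, which resolves the relative modular operator of \<open>\<sigma>\<close>
  and \<open>\<rho>\<close>.\<close>

theorem f_relative_entropy_le_frame:
  fixes A :: "'i \<Rightarrow> nat \<Rightarrow> 'k \<Rightarrow> complex" and B :: "'j \<Rightarrow> nat \<Rightarrow> 'k \<Rightarrow> complex"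
    and a :: "'i \<Rightarrow> real" and b :: "'j \<Rightarrow> real"
  assumes f: "operator_convex_on {0<..} f"
    and \<rho>: "strictly_positive_mat m \<rho>" and \<sigma>: "\<sigma> \<in> carrier_mat m m"
    and fin: "finite I" "finite J" "finite K"
    and a: "\<And>i. i \<in> I \<Longrightarrow> a i > 0" and b: "\<And>j. j \<in> J \<Longrightarrow> b j > 0"
    and A: "\<And>x y k l. x < m \<Longrightarrow> y < m \<Longrightarrow> k \<in> K \<Longrightarrow> l \<in> K \<Longrightarrow>
      (\<Sum>i\<in>I. A i x k * cnj (A i y l)) = (if x = y \<and> k = l then 1 else 0)"
    and B: "\<And>x y k l. x < m \<Longrightarrow> y < m \<Longrightarrow> k \<in> K \<Longrightarrow> l \<in> K \<Longrightarrow>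
      (\<Sum>j\<in>J. B j x k * cnj (B j y l)) = (if x = y \<and> k = l then 1 else 0)"
    and \<rho>A: "\<And>x y. x < m \<Longrightarrow> y < m \<Longrightarrow>
      \<rho> $$ (x, y) = (\<Sum>k\<in>K. \<Sum>i\<in>I. complex_of_real (a i) * (A i x k * cnj (A i y k)))"
    and \<sigma>B: "\<And>x y. x < m \<Longrightarrow> y < m \<Longrightarrow>
      \<sigma> $$ (x, y) = (\<Sum>k\<in>K. \<Sum>j\<in>J. complex_of_real (b j) * (B j x k * cnj (B j y k)))"
  shows "f_relative_entropy f \<rho> \<sigma> \<le>
    (\<Sum>i\<in>I. \<Sum>j\<in>J. a i * f (b j / a i) * (cmod (\<Sum>x<m. \<Sum>k\<in>K. cnj (B j x k) * A i x k))\<^sup>2)"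
proof -
  obtain U p where r: "spectral_decomposition m \<rho> U p" and p: "\<And>i. i < m \<Longrightarrow> p i > 0"
    using strictly_positive_decomposition[OF \<rho>] by blast
  let ?I = "mat_fun inverse \<rho>" and ?R = "mat_fun sqrt \<rho>"
  define S where "S = mat_fun (\<lambda>x. inverse (sqrt x)) \<rho>"
  note rS = spectral_decomposition_mat_fun[OF r, of "\<lambda>x. inverse (sqrt x)", folded S_def]
    and rR = spectral_decomposition_mat_fun[OF r, of sqrt] and rI = spectral_decomposition_mat_fun[OF r, of inverse]
  note c = spectral_decompositionD(5)[OF r] spectral_decompositionD(5)[OF rS]
    spectral_decompositionD(5)[OF rR] spectral_decompositionD(5)[OF rI]
  note Sh = hermitian_mat_index[OF spectral_decomposition_hermitian[OF rS]]
  note roots = positive_square_roots[OF r p, folded S_def]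
  have RS: "(\<Sum>y<m. ?R $$ (x, y) * S $$ (y, z)) = (if x = z then 1 else 0)" if "x < m" "z < m" for x z
    using that c arg_cong[OF roots(2), of "\<lambda>M. M $$ (x, z)"] by (simp add: index_mult_mat_sum[of _ _ _ _ m]
        del: index_mult_mat(1))
  have SS: "(\<Sum>y<m. S $$ (x, y) * S $$ (y, z)) = ?I $$ (x, z)" if "x < m" "z < m" for x z
    using that c arg_cong[OF roots(3), of "\<lambda>M. M $$ (x, z)"] by (simp add: index_mult_mat_sum[of _ _ _ _ m]
        del: index_mult_mat(1))
  have S\<rho>S: "(\<Sum>u<m. \<Sum>v<m. S $$ (x, v) * \<rho> $$ (v, u) * S $$ (u, y)) = (if x = y then 1 else 0)"
    if "x < m" "y < m" for x y
    using that roots(4) mat_index_mult3[OF c(2) c(1) c(2) that] by (simp del: index_mult_mat(1))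
  \<comment> \<open>\<open>C i\<close> is \<rho> to the power -1/2 applied to the system part of
    \<open>A i\<close>; multiplying by the square root \<open>?R\<close> undoes this.\<close>
  define C where "C i y k = (\<Sum>u<m. S $$ (y, u) * A i u k)" for i y k
  have RC: "(\<Sum>y<m. ?R $$ (x, y) * C i y k) = A i x k" if x: "x < m" for i x k
  proof -
    have "(\<Sum>y<m. ?R $$ (x, y) * C i y k) = (\<Sum>u<m. (\<Sum>y<m. ?R $$ (x, y) * S $$ (y, u)) * A i u k)"
      unfolding C_def sum_distrib_left sum_distrib_right mult.assoc by (rule sum.swap)
    also have "\<dots> = (\<Sum>u<m. (if x = u then 1 else 0) * A i u k)"
      using x by (intro sum.cong) (auto simp: RS)
    finally show ?thesis using x by (simp add: if_distrib[of "\<lambda>x. x * _"] cong: if_cong)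
  qed
  have CC: "(\<Sum>i\<in>I. d i * (cnj (C i y k) * C i y' l)) =
      (\<Sum>u<m. \<Sum>v<m. (\<Sum>i\<in>I. d i * (A i v l * cnj (A i u k))) * (S $$ (u, y) * S $$ (y', v)))"
    if "y < m" "y' < m" for d y k y' l
  proof -
    have "(\<Sum>i\<in>I. d i * (cnj (C i y k) * C i y' l)) =
      (\<Sum>i\<in>I. d i * ((\<Sum>u<m. S $$ (u, y) * cnj (A i u k)) * (\<Sum>v<m. S $$ (y', v) * A i v l)))"
      using that by (simp add: C_def Sh)
    also have "\<dots> = (\<Sum>u<m. \<Sum>v<m. (\<Sum>i\<in>I. d i * (cnj (A i u k) * A i v l)) * (S $$ (u, y) * S $$ (y', v)))"
      by (rule sum_sesquilinear)
    finally show ?thesis by (simp add: mult_ac)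
  qed
  define w where "w = (\<lambda>(i, j) z. complex_of_real (sqrt (a i)) *
    (\<Sum>k\<in>K. B j (z div m) k * cnj (C i (z mod m) k)))"
  have ww: "w (i, j) z * cnj (w (i, j) z') = complex_of_real (a i) *
      ((\<Sum>k\<in>K. B j (z div m) k * cnj (C i (z mod m) k)) *
       (\<Sum>k\<in>K. cnj (B j (z' div m) k) * C i (z' mod m) k))" if "i \<in> I" for i j z z'
  proof -
    have "complex_of_real (sqrt (a i)) * complex_of_real (sqrt (a i)) = complex_of_real (a i)"
      using a[OF that] by (simp flip: of_real_mult)
    thus ?thesis by (simp add: w_def mult_ac)
  qed
  have dm: "z div m < m \<and> z mod m < m" if "z < m * m" for z
    using that by (cases "m = 0") (auto simp: less_mult_imp_div_less)
  let ?K = "kronecker \<sigma> (transpose_mat (the (mat_inverse \<rho>)))"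
  have "f_relative_entropy f \<rho> \<sigma> = Re ((mat_fun f ?K *\<^sub>v vec_rows ?R) \<bullet>c vec_rows ?R)"
    by (simp add: f_relative_entropy_def)
  also have "\<dots> \<le> (\<Sum>ij\<in>I \<times> J. f (b (snd ij) / a (fst ij)) * (cmod (\<Sum>z<m * m. cnj (w ij z) * vec_rows ?R $ z))\<^sup>2)"
  proof (rule operator_jensen_frame[OF f])
    show "finite (I \<times> J)" using fin by simp
    show "b (snd ij) / a (fst ij) > 0" if "ij \<in> I \<times> J" for ij using that a b by auto
    show "?K \<in> carrier_mat (m * m) (m * m)" "vec_rows ?R \<in> carrier_vec (m * m)"
      using c \<sigma> by (auto simp: kronecker_def vec_rows_def inverse_eq_mat_fun[OF r p])
    fix z z' assume z: "z < m * m" "z' < m * m"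
    let ?x = "z div m" and ?y = "z mod m" and ?x' = "z' div m" and ?y' = "z' mod m"
    have xy: "?x < m" "?y < m" "?x' < m" "?y' < m" using dm z by auto
    \<comment> \<open>Completeness of the \<open>B j\<close> forces equal system indices and
      \<open>k = l\<close>. What remains is the sum over \<open>i\<close> with the weights
      \<open>a i\<close>, which traces out the environment and yields \<rho> between two factors
      \<open>S\<close>, that is, the identity.\<close>
    have "(\<Sum>ij\<in>I \<times> J. w ij z * cnj (w ij z')) =
      (\<Sum>i\<in>I. \<Sum>j\<in>J. complex_of_real (a i) * 1 * (\<Sum>k\<in>K. B j ?x k * cnj (C i ?y k)) *
       (\<Sum>k\<in>K. cnj (B j ?x' k) * C i ?y' k))"
      unfolding sum.cartesian_product' by (intro sum.cong refl) (simp add: ww mult.assoc)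
    also have "\<dots> = (\<Sum>k\<in>K. \<Sum>l\<in>K. (\<Sum>j\<in>J. 1 * (B j ?x k * cnj (B j ?x' l))) *
        (\<Sum>i\<in>I. complex_of_real (a i) * (cnj (C i ?y k) * C i ?y' l)))"
      by (rule sum_bilinear)
    also have "\<dots> = (\<Sum>k\<in>K. \<Sum>l\<in>K. (if ?x = ?x' \<and> k = l then 1 else 0) *
        (\<Sum>i\<in>I. complex_of_real (a i) * (cnj (C i ?y k) * C i ?y' l)))"
      using xy by (intro sum.cong refl) (simp add: B)
    also have "\<dots> = (if ?x = ?x' then \<Sum>k\<in>K. \<Sum>i\<in>I. complex_of_real (a i) * (cnj (C i ?y k) * C i ?y' k) else 0)"
      by (rule sum_if_and[OF fin(3)])
    also have "(\<Sum>k\<in>K. \<Sum>i\<in>I. complex_of_real (a i) * (cnj (C i ?y k) * C i ?y' k)) =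
        (\<Sum>k\<in>K. \<Sum>u<m. \<Sum>v<m. (\<Sum>i\<in>I. complex_of_real (a i) * (A i v k * cnj (A i u k))) * (S $$ (u, ?y) * S $$ (?y', v)))"
      using xy by (simp only: CC)
    also have "\<dots> = (\<Sum>u<m. \<Sum>k\<in>K. \<Sum>v<m. (\<Sum>i\<in>I. complex_of_real (a i) * (A i v k * cnj (A i u k))) * (S $$ (u, ?y) * S $$ (?y', v)))"
      by (rule sum.swap)
    also have "\<dots> = (\<Sum>u<m. \<Sum>v<m. \<Sum>k\<in>K. (\<Sum>i\<in>I. complex_of_real (a i) * (A i v k * cnj (A i u k))) * (S $$ (u, ?y) * S $$ (?y', v)))"
      by (intro sum.cong refl) (rule sum.swap)
    also have "\<dots> = (\<Sum>u<m. \<Sum>v<m. S $$ (?y', v) * \<rho> $$ (v, u) * S $$ (u, ?y))"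
      by (intro sum.cong refl) (simp add: \<rho>A sum_distrib_left sum_distrib_right mult_ac)
    also have "\<dots> = (if ?y' = ?y then 1 else 0)" using xy by (simp add: S\<rho>S)
    also have "(if ?x = ?x' then if ?y' = ?y then 1 else 0 else 0) = (if z = z' then 1 else (0::complex))"
      by (auto, metis div_mult_mod_eq)
    finally show "(\<Sum>ij\<in>I \<times> J. w ij z * cnj (w ij z')) = (if z = z' then 1 else 0)" .
    \<comment> \<open>Now \<open>a i\<close> cancels, so completeness of the \<open>A i\<close>
      applies and leaves \<open>S * S\<close>, the inverse of \<rho>, with \<open>k = l\<close>. The
      weights \<open>b j\<close> then produce \<sigma>. The swapped indices of the inverse account
      for the transpose in \<open>?K\<close>.\<close>
    have "(\<Sum>ij\<in>I \<times> J. complex_of_real (b (snd ij) / a (fst ij)) * (w ij z * cnj (w ij z'))) =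
      (\<Sum>i\<in>I. \<Sum>j\<in>J. 1 * complex_of_real (b j) * (\<Sum>k\<in>K. B j ?x k * cnj (C i ?y k)) *
       (\<Sum>k\<in>K. cnj (B j ?x' k) * C i ?y' k))"
      unfolding sum.cartesian_product'
    proof (intro sum.cong refl)
      fix i j assume "i \<in> I"
      hence "a i \<noteq> 0" using a by force
      thus "complex_of_real (b (snd (i, j)) / a (fst (i, j))) * (w (i, j) z * cnj (w (i, j) z')) =
        1 * complex_of_real (b j) * (\<Sum>k\<in>K. B j ?x k * cnj (C i ?y k)) * (\<Sum>k\<in>K. cnj (B j ?x' k) * C i ?y' k)"
        by (simp add: ww[OF \<open>i \<in> I\<close>])
    qed
    also have "\<dots> = (\<Sum>k\<in>K. \<Sum>l\<in>K. (\<Sum>j\<in>J. complex_of_real (b j) * (B j ?x k * cnj (B j ?x' l))) *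
        (\<Sum>i\<in>I. 1 * (cnj (C i ?y k) * C i ?y' l)))"
      by (rule sum_bilinear)
    also have "\<dots> = (\<Sum>k\<in>K. \<Sum>l\<in>K. (if True \<and> k = l then 1 else 0) *
        ((\<Sum>j\<in>J. complex_of_real (b j) * (B j ?x k * cnj (B j ?x' l))) * ?I $$ (?y', ?y)))"
    proof (intro sum.cong refl)
      fix k l assume kl: "k \<in> K" "l \<in> K"
      have "(\<Sum>i\<in>I. 1 * (cnj (C i ?y k) * C i ?y' l)) =
          (\<Sum>u<m. \<Sum>v<m. (if k = l \<and> u = v then 1 else 0) * (S $$ (u, ?y) * S $$ (?y', v)))"
        unfolding CC[OF xy(2,4)] using kl by (intro sum.cong refl) (simp add: A)
      also have "\<dots> = (if k = l then \<Sum>u<m. S $$ (u, ?y) * S $$ (?y', u) else 0)"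
        by (rule sum_if_and) simp
      also have "\<dots> = (if k = l then ?I $$ (?y', ?y) else 0)"
        using xy by (simp add: SS mult.commute[of "S $$ (_, ?y)"])
      finally show "(\<Sum>j\<in>J. complex_of_real (b j) * (B j ?x k * cnj (B j ?x' l))) *
          (\<Sum>i\<in>I. 1 * (cnj (C i ?y k) * C i ?y' l)) =
        (if True \<and> k = l then 1 else 0) *
        ((\<Sum>j\<in>J. complex_of_real (b j) * (B j ?x k * cnj (B j ?x' l))) * ?I $$ (?y', ?y))"
        by simp
    qed
    also have "\<dots> = (\<Sum>k\<in>K. (\<Sum>j\<in>J. complex_of_real (b j) * (B j ?x k * cnj (B j ?x' k))) * ?I $$ (?y', ?y))"
      unfolding sum_if_and[OF fin(3)] by simp
    also have "\<dots> = \<sigma> $$ (?x, ?x') * ?I $$ (?y', ?y)"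
      using xy by (simp add: \<sigma>B sum_distrib_right)
    also have "\<dots> = ?K $$ (z, z')"
      using z xy c \<sigma> by (simp add: kronecker_def inverse_eq_mat_fun[OF r p])
    finally show "?K $$ (z, z') = (\<Sum>ij\<in>I \<times> J. complex_of_real (b (snd ij) / a (fst ij)) * (w ij z * cnj (w ij z')))"
      by (rule sym)
  qed
  also have "\<dots> = (\<Sum>i\<in>I. \<Sum>j\<in>J. a i * f (b j / a i) * (cmod (\<Sum>x<m. \<Sum>k\<in>K. cnj (B j x k) * A i x k))\<^sup>2)"
    unfolding sum.cartesian_product'
  proof (intro sum.cong refl)
    fix i j assume i: "i \<in> I"
    \<comment> \<open>Pairing with the vectorized square root of \<rho> turns \<open>C i\<close>
      back into \<open>A i\<close>. The coefficient is the inner product of \<open>B j\<close> with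
      \<open>A i\<close> times the root of \<open>a i\<close>, whose square gives the
      prefactor.\<close>
    have "(\<Sum>z<m * m. cnj (w (i, j) z) * vec_rows ?R $ z) =
      (\<Sum>x<m. \<Sum>y<m. complex_of_real (sqrt (a i)) * (\<Sum>k\<in>K. cnj (B j x k) * C i y k) * ?R $$ (x, y))"
      using c by (intro sum_lessThan_mult) (auto simp: w_def vec_rows_def)
    also have "\<dots> = (\<Sum>x<m. complex_of_real (sqrt (a i)) * (\<Sum>k\<in>K. cnj (B j x k) * A i x k))"
    proof (intro sum.cong refl)
      fix x assume x: "x \<in> {..<m}"
      have "(\<Sum>y<m. complex_of_real (sqrt (a i)) * (\<Sum>k\<in>K. cnj (B j x k) * C i y k) * ?R $$ (x, y)) =
        complex_of_real (sqrt (a i)) * (\<Sum>y<m. \<Sum>k\<in>K. cnj (B j x k) * (?R $$ (x, y) * C i y k))"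
        by (simp add: sum_distrib_left sum_distrib_right mult_ac)
      also have "(\<Sum>y<m. \<Sum>k\<in>K. cnj (B j x k) * (?R $$ (x, y) * C i y k)) =
        (\<Sum>k\<in>K. \<Sum>y<m. cnj (B j x k) * (?R $$ (x, y) * C i y k))" by (rule sum.swap)
      also have "\<dots> = (\<Sum>k\<in>K. cnj (B j x k) * A i x k)"
        using x by (simp flip: sum_distrib_left add: RC)
      finally show "(\<Sum>y<m. complex_of_real (sqrt (a i)) * (\<Sum>k\<in>K. cnj (B j x k) * C i y k) * ?R $$ (x, y)) =
        complex_of_real (sqrt (a i)) * (\<Sum>k\<in>K. cnj (B j x k) * A i x k)" .
    qed
    also have "\<dots> = complex_of_real (sqrt (a i)) * (\<Sum>x<m. \<Sum>k\<in>K. cnj (B j x k) * A i x k)"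
      by (simp add: sum_distrib_left)
    finally show "f (b (snd (i, j)) / a (fst (i, j))) * (cmod (\<Sum>z<m * m. cnj (w (i, j) z) * vec_rows ?R $ z))\<^sup>2 =
      a i * f (b j / a i) * (cmod (\<Sum>x<m. \<Sum>k\<in>K. cnj (B j x k) * A i x k))\<^sup>2"
      using a[OF i] by (simp add: norm_mult power_mult_distrib)
  qed
  finally show ?thesis .
qed

section \<open>Monotonicity under Kraus families\<close>

text \<open>If \<open>c > 0\<close> bounds the eigenvalues of \<open>A\<close> from below and
  \<open>C\<close> those of \<open>T\<close> from above, the form of the difference is at least
  \<open>c - s * C\<close> times the squared norm, and \<open>s \<le> c / (2 * C)\<close> keeps this
  positive.\<close>

lemma strictly_positive_perturbation:
  assumes A: "strictly_positive_mat n A" and T: "hermitian_mat n T"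
  shows "\<exists>s0>0. \<forall>s. 0 \<le> s \<longrightarrow> s \<le> s0 \<longrightarrow> strictly_positive_mat n (A - complex_of_real s \<cdot>\<^sub>m T)"
proof -
  obtain U a where sA: "spectral_decomposition n A U a" and a: "\<And>i. i < n \<Longrightarrow> a i > 0"
    using strictly_positive_decomposition[OF A] by blast
  obtain V t where sT: "spectral_decomposition n T V t"
    using hermitian_spectral_decomposition[OF T] by blast
  note U = spectral_decompositionD[OF sA] and V = spectral_decompositionD[OF sT]
  \<comment> \<open>Inserting 1 makes minimum and maximum meaningful for \<open>n = 0\<close> and
    keeps \<open>C\<close> positive for the division.\<close>
  define c where "c = Min (insert 1 (a ` {..<n}))"
  define C where "C = Max (insert 1 (t ` {..<n}))"
  have c: "c > 0" "\<And>i. i < n \<Longrightarrow> c \<le> a i"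
    using a by (auto simp: c_def)
  have C: "C \<ge> 1" "\<And>i. i < n \<Longrightarrow> t i \<le> C"
    unfolding C_def by (rule Max_ge; simp)+
  have "strictly_positive_mat n (A - complex_of_real s \<cdot>\<^sub>m T)" if s: "0 \<le> s" "s \<le> c / (2 * C)" for s
    unfolding strictly_positive_mat_def
  proof (intro conjI ballI impI)
    have "mat_adjoint (A - complex_of_real s \<cdot>\<^sub>m T) = A - complex_of_real s \<cdot>\<^sub>m T"
      using A T U(5) V(5)
      by (simp add: mat_adjoint_minus[of _ n n] mat_adjoint_smult strictly_positive_mat_def hermitian_mat_def)
    thus "hermitian_mat n (A - complex_of_real s \<cdot>\<^sub>m T)"
      using U(5) V(5) by (auto simp: hermitian_mat_def)
  next
    fix v :: "complex vec" assume v: "v \<in> carrier_vec n" "v \<noteq> 0\<^sub>v n"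
    define N where "N = (\<Sum>i<n. (cmod (v $ i))\<^sup>2)"
    have "\<exists>i<n. v $ i \<noteq> 0" using v by (auto intro!: eq_vecI)
    hence N: "N > 0" unfolding N_def by (auto intro!: sum_pos2)
    have "c * N = (\<Sum>i<n. c * (cmod ((mat_adjoint U *\<^sub>v v) $ i))\<^sup>2)"
      unfolding N_def unitary_mat_norm[OF U(1,2) v(1), symmetric] sum_distrib_left ..
    also have "\<dots> \<le> Re ((A *\<^sub>v v) \<bullet>c v)"
      unfolding spectral_decomposition_quadratic_form[OF sA v(1)] Re_complex_of_real
      by (intro sum_mono mult_right_mono) (auto simp: c)
    finally have 1: "c * N \<le> Re ((A *\<^sub>v v) \<bullet>c v)" .
    have "Re ((T *\<^sub>v v) \<bullet>c v) \<le> (\<Sum>i<n. C * (cmod ((mat_adjoint V *\<^sub>v v) $ i))\<^sup>2)"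
      unfolding spectral_decomposition_quadratic_form[OF sT v(1)] Re_complex_of_real
      by (intro sum_mono mult_right_mono) (auto simp: C)
    also have "\<dots> = C * N"
      unfolding N_def unitary_mat_norm[OF V(1,2) v(1), symmetric] sum_distrib_left ..
    finally have "s * Re ((T *\<^sub>v v) \<bullet>c v) \<le> s * (C * N)" using s by (intro mult_left_mono)
    also have "\<dots> \<le> (c / (2 * C)) * (C * N)" using s C N by (intro mult_right_mono) auto
    also have "\<dots> = c * N / 2" using C by simp
    also have "\<dots> < c * N" using c N by simp
    finally have 2: "s * Re ((T *\<^sub>v v) \<bullet>c v) < Re ((A *\<^sub>v v) \<bullet>c v)" using 1 by linarith
    have "((A - complex_of_real s \<cdot>\<^sub>m T) *\<^sub>v v) \<bullet>c v = (A *\<^sub>v v) \<bullet>c v - complex_of_real s * ((T *\<^sub>v v) \<bullet>c v)"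
    proof -
      have "A - complex_of_real s \<cdot>\<^sub>m T \<in> carrier_mat n n" using U V by auto
      hence "((A - complex_of_real s \<cdot>\<^sub>m T) *\<^sub>v v) \<bullet>c v =
          (\<Sum>i<n. \<Sum>j<n. (A - complex_of_real s \<cdot>\<^sub>m T) $$ (i, j) * v $ j * cnj (v $ i))"
        using v(1) by (rule quadratic_form_sum)
      also have "\<dots> = (\<Sum>i<n. \<Sum>j<n. A $$ (i, j) * v $ j * cnj (v $ i)) -
          complex_of_real s * (\<Sum>i<n. \<Sum>j<n. T $$ (i, j) * v $ j * cnj (v $ i))"
        using U(5) V(5) by (simp add: algebra_simps sum_subtractf sum_distrib_left)
      finally show ?thesis
        by (simp only: quadratic_form_sum[OF U(5) v(1)] quadratic_form_sum[OF V(5) v(1)])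
    qed
    thus "0 < Re (((A - complex_of_real s \<cdot>\<^sub>m T) *\<^sub>v v) \<bullet>c v)" using 2 by simp
  qed
  moreover have "c / (2 * C) > 0" using c C by simp
  ultimately show ?thesis by blast
qed

text \<open>The Kraus operators \<open>G k\<close> form an isometry \<open>W\<close> into the system tensored with the environment
  \<open>E\<close>; \<open>Q = 1 - W W\<^sup>*\<close>. The ensemble of a spectral decomposition of the input, transported by \<open>W\<close>,
  is completed by the columns of \<open>Q\<close> and, on the additional environment state \<open>None\<close>, by an
  orthonormal basis.\<close>

locale kraus_family =
  fixes m n :: nat and E :: "'e set" and G :: "'e \<Rightarrow> nat \<Rightarrow> nat \<Rightarrow> complex"
  assumes finE: "finite E"
    and iso: "\<And>i j. i < n \<Longrightarrow> j < n \<Longrightarrow>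
      (\<Sum>k\<in>E. \<Sum>x<m. cnj (G k x i) * G k x j) = (if i = j then 1 else 0)"
begin

definition Z :: "(nat \<times> 'e) set" where "Z = {..<m} \<times> E"

definition W :: "nat \<times> 'e \<Rightarrow> nat \<Rightarrow> complex" where "W z i = G (snd z) (fst z) i"

definition Q :: "nat \<times> 'e \<Rightarrow> nat \<times> 'e \<Rightarrow> complex" where
  "Q z z' = (if z = z' then 1 else 0) - (\<Sum>i<n. W z i * cnj (W z' i))"

text \<open>Image under the isometry \<open>W\<close> of column \<open>i\<close> of
  \<open>U\<close>, the \<open>i\<close>-th eigenvector of an input state.\<close>

definition WU :: "complex mat \<Rightarrow> nat \<times> 'e \<Rightarrow> nat \<Rightarrow> complex" where
  "WU U z i = (\<Sum>j<n. U $$ (j, i) * W z j)"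

text \<open>Partial trace of the projection \<open>Q\<close> over the environment: what a unit
  weight on the complement of the range of \<open>W\<close> adds to the reduced state.\<close>

definition defect :: "complex mat" where
  "defect = mat m m (\<lambda>(x, y). \<Sum>k\<in>E. Q (x, k) (y, k))"

definition dilated_index :: "(nat + (nat \<times> 'e) + nat) set" where
  "dilated_index = {..<n} <+> (Z <+> {..<m})"

text \<open>The columns of \<open>Q\<close> are neither normalized nor independent, but
  \<open>Q\<close> being a projection makes them a Parseval frame of its range, and the ensembles
  only have to be frames. In applications \<open>V\<close> diagonalizes the output minus
  \<open>s\<close> times \<open>defect\<close>.\<close>

fun dilated_ket :: "complex mat \<Rightarrow> complex mat \<Rightarrow> nat + (nat \<times> 'e) + nat \<Rightarrow> nat \<Rightarrow> 'e option \<Rightarrow> complex" where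
  "dilated_ket U V (Inl i) x (Some k) = WU U (x, k) i"
| "dilated_ket U V (Inl i) x None = 0"
| "dilated_ket U V (Inr (Inl z)) x (Some k) = Q (x, k) z"
| "dilated_ket U V (Inr (Inl z)) x None = 0"
| "dilated_ket U V (Inr (Inr i)) x (Some k) = 0"
| "dilated_ket U V (Inr (Inr i)) x None = V $$ (x, i)"

text \<open>The weight on \<open>Q\<close> contains neither \<open>p\<close> nor \<open>q\<close>,
  so it agrees for both states and the ratio there is 1. Within each kind \<alpha> cancels from the
  ratio of the weights of two states.\<close>

fun dilated_weight :: "real \<Rightarrow> real \<Rightarrow> (nat \<Rightarrow> real) \<Rightarrow> (nat \<Rightarrow> real) \<Rightarrow> nat + (nat \<times> 'e) + nat \<Rightarrow> real" where
  "dilated_weight \<alpha> s p q (Inl i) = \<alpha> * p i"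
| "dilated_weight \<alpha> s p q (Inr (Inl z)) = (1 - \<alpha>) * s"
| "dilated_weight \<alpha> s p q (Inr (Inr i)) = (1 - \<alpha>) * q i"

section \<open>Algebra of the isometry and of its complementary projection\<close>

lemma finite_Z [simp]: "finite Z"
  using finE by (simp add: Z_def)

lemma iso_W: "i < n \<Longrightarrow> j < n \<Longrightarrow> (\<Sum>z\<in>Z. cnj (W z i) * W z j) = (if i = j then 1 else 0)"
  using iso[of i j] by (simp add: Z_def W_def sum.cartesian_product' sum.swap[of _ _ E])

lemma cnj_Q: "cnj (Q z z') = Q z' z"
  by (simp add: Q_def mult.commute)

lemma W_Q:
  assumes "i < n" "z' \<in> Z"
  shows "(\<Sum>z\<in>Z. cnj (W z i) * Q z z') = 0"
proof -
  have "(\<Sum>z\<in>Z. cnj (W z i) * Q z z') =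
      cnj (W z' i) - (\<Sum>z\<in>Z. \<Sum>j<n. cnj (W z i) * W z j * cnj (W z' j))"
    using assms by (simp add: Q_def right_diff_distrib sum_subtractf sum_distrib_left mult.assoc
        if_distrib[of "\<lambda>x. _ * x"] cong: if_cong)
  also have "(\<Sum>z\<in>Z. \<Sum>j<n. cnj (W z i) * W z j * cnj (W z' j)) =
      (\<Sum>j<n. (\<Sum>z\<in>Z. cnj (W z i) * W z j) * cnj (W z' j))"
    unfolding sum_distrib_right by (rule sum.swap)
  also have "\<dots> = (\<Sum>j<n. (if i = j then 1 else 0) * cnj (W z' j))"
    using assms by (intro sum.cong) (auto simp: iso_W)
  also have "\<dots> = cnj (W z' i)"
    using assms by (simp add: if_distrib[of "\<lambda>x. x * _"] cong: if_cong)
  finally show ?thesis by simp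
qed

lemma Q_W:
  assumes "i < n" "z \<in> Z"
  shows "(\<Sum>z'\<in>Z. Q z z' * W z' i) = 0"
  using arg_cong[OF W_Q[OF assms], of cnj] by (simp add: cnj_Q mult.commute)

lemma Q_Q:
  assumes "z \<in> Z" "y \<in> Z"
  shows "(\<Sum>z'\<in>Z. Q z z' * cnj (Q y z')) = Q z y"
proof -
  have "(\<Sum>z'\<in>Z. Q z z' * cnj (Q y z')) =
      Q z y - (\<Sum>z'\<in>Z. \<Sum>i<n. Q z z' * W z' i * cnj (W y i))"
    unfolding cnj_Q using assms
    by (simp add: Q_def[of _ y] right_diff_distrib sum_subtractf sum_distrib_left mult.assoc
        if_distrib[of "\<lambda>x. _ * x"] cong: if_cong)
  also have "(\<Sum>z'\<in>Z. \<Sum>i<n. Q z z' * W z' i * cnj (W y i)) = (\<Sum>i<n. (\<Sum>z'\<in>Z. Q z z' * W z' i) * cnj (W y i))"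
    unfolding sum_distrib_right by (rule sum.swap)
  also have "\<dots> = 0" using assms by (simp add: Q_W)
  finally show ?thesis by simp
qed

lemma Q_WU:
  assumes "z \<in> Z"
  shows "(\<Sum>z'\<in>Z. Q z z' * WU U z' i) = 0"
proof -
  have "(\<Sum>z'\<in>Z. Q z z' * WU U z' i) = (\<Sum>z'\<in>Z. \<Sum>j<n. U $$ (j, i) * (Q z z' * W z' j))"
    by (simp add: WU_def sum_distrib_left mult_ac)
  also have "\<dots> = (\<Sum>j<n. \<Sum>z'\<in>Z. U $$ (j, i) * (Q z z' * W z' j))" by (rule sum.swap)
  also have "\<dots> = 0" using assms by (simp flip: sum_distrib_left add: Q_W)
  finally show ?thesis .
qed

lemma WU_WU:
  "(\<Sum>z\<in>Z. cnj (WU V z j) * WU U z i) = (\<Sum>k<n. cnj (V $$ (k, j)) * U $$ (k, i))"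
proof -
  have "(\<Sum>z\<in>Z. cnj (WU V z j) * WU U z i) =
      (\<Sum>z\<in>Z. 1 * ((\<Sum>k<n. cnj (V $$ (k, j)) * cnj (W z k)) * (\<Sum>l<n. U $$ (l, i) * W z l)))"
    by (simp add: WU_def)
  also have "\<dots> = (\<Sum>k<n. \<Sum>l<n. (\<Sum>z\<in>Z. 1 * (cnj (W z k) * W z l)) * (cnj (V $$ (k, j)) * U $$ (l, i)))"
    by (rule sum_sesquilinear)
  also have "\<dots> = (\<Sum>k<n. \<Sum>l<n. (if True \<and> k = l then 1 else 0) * (cnj (V $$ (k, j)) * U $$ (l, i)))"
    by (intro sum.cong refl) (simp add: iso_W)
  also have "\<dots> = (\<Sum>k<n. cnj (V $$ (k, j)) * U $$ (k, i))"
    by (subst sum_if_and) auto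
  finally show ?thesis .
qed

lemma WU_weighted:
  assumes "spectral_decomposition n \<rho> U p"
  shows "(\<Sum>i<n. complex_of_real (p i) * (WU U z i * cnj (WU U z' i))) =
    (\<Sum>k<n. \<Sum>l<n. W z k * \<rho> $$ (k, l) * cnj (W z' l))"
proof -
  have "(\<Sum>i<n. complex_of_real (p i) * (WU U z i * cnj (WU U z' i))) =
     (\<Sum>i<n. complex_of_real (p i) * ((\<Sum>k<n. W z k * U $$ (k, i)) * (\<Sum>l<n. cnj (W z' l) * cnj (U $$ (l, i)))))"
    by (simp add: WU_def mult.commute[of "U $$ _"] mult.commute[of "cnj (U $$ _)"])
  also have "\<dots> = (\<Sum>k<n. \<Sum>l<n. (\<Sum>i<n. complex_of_real (p i) * (U $$ (k, i) * cnj (U $$ (l, i)))) * (W z k * cnj (W z' l)))"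
    by (rule sum_sesquilinear)
  also have "\<dots> = (\<Sum>k<n. \<Sum>l<n. W z k * \<rho> $$ (k, l) * cnj (W z' l))"
    by (intro sum.cong refl) (simp add: spectral_decomposition_index(1)[OF assms] mult_ac)
  finally show ?thesis .
qed

lemma WU_complete:
  assumes "spectral_decomposition n \<rho> U p"
  shows "(\<Sum>i<n. WU U z i * cnj (WU U z' i)) = (\<Sum>i<n. W z i * cnj (W z' i))"
proof -
  have "(\<Sum>i<n. WU U z i * cnj (WU U z' i)) =
     (\<Sum>i<n. 1 * ((\<Sum>k<n. W z k * U $$ (k, i)) * (\<Sum>l<n. cnj (W z' l) * cnj (U $$ (l, i)))))"
    by (simp add: WU_def mult.commute[of "U $$ _"] mult.commute[of "cnj (U $$ _)"])
  also have "\<dots> = (\<Sum>k<n. \<Sum>l<n. (\<Sum>i<n. 1 * (U $$ (k, i) * cnj (U $$ (l, i)))) * (W z k * cnj (W z' l)))"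
    by (rule sum_sesquilinear)
  also have "\<dots> = (\<Sum>k<n. \<Sum>l<n. (if True \<and> k = l then 1 else 0) * (W z k * cnj (W z' l)))"
    by (intro sum.cong refl) (simp add: spectral_decomposition_index(2)[OF assms])
  also have "\<dots> = (\<Sum>i<n. W z i * cnj (W z' i))"
    by (subst sum_if_and) auto
  finally show ?thesis .
qed

section \<open>Completeness, reduced states and overlaps of the completed ensembles\<close>

lemma sum_dilated_index:
  "(\<Sum>i\<in>dilated_index. g i) =
    (\<Sum>i<n. g (Inl i)) + (\<Sum>z\<in>Z. g (Inr (Inl z))) + (\<Sum>i<m. g (Inr (Inr i)) :: 'c :: comm_monoid_add)"
  by (simp add: dilated_index_def sum.Plus add.assoc)

lemma sum_environment:
  "(\<Sum>k\<in>insert None (Some ` E). g k) = g None + (\<Sum>k\<in>E. g (Some k) :: 'c :: comm_monoid_add)"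
  using finE by (simp add: sum.reindex)

text \<open>On the environment \<open>E\<close> the first two kinds add up to the range projection
  of \<open>W\<close> plus \<open>Q\<close>, which is the identity; on \<open>None\<close> the
  columns of \<open>V\<close> are an orthonormal basis. Mixed terms vanish since each ket lives on
  one side only.\<close>

lemma dilated_ket_frame:
  assumes U: "spectral_decomposition n \<rho> U p" and V: "spectral_decomposition m \<tau> V q"
    and xy: "x < m" "y < m" and kl: "k \<in> insert None (Some ` E)" "l \<in> insert None (Some ` E)"
  shows "(\<Sum>i\<in>dilated_index. dilated_ket U V i x k * cnj (dilated_ket U V i y l)) =
    (if x = y \<and> k = l then 1 else 0)"
proof (cases k)
  case None
  thus ?thesis
    using spectral_decomposition_index(2)[OF V xy] by (cases l) (simp_all add: sum_dilated_index)
next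
  case k: (Some a)
  show ?thesis
  proof (cases l)
    case None
    thus ?thesis using k by (simp add: sum_dilated_index)
  next
    case l: (Some b)
    have "(x, a) \<in> Z" "(y, b) \<in> Z" using xy kl k l by (auto simp: Z_def)
    thus ?thesis by (simp add: k l sum_dilated_index WU_complete[OF U] Q_Q) (simp add: Q_def)
  qed
qed

text \<open>The three kinds contribute \<alpha> \<rho>', (1 - \<alpha>) s D and (1 - \<alpha>)
  (\<rho>' - s D), where D is \<open>defect\<close>. The reduced state is thus exactly \<rho>',
  whatever \<alpha> is.\<close>

lemma dilated_ket_reduced:
  assumes U: "spectral_decomposition n \<rho> U p"
    and V: "spectral_decomposition m (\<rho>' - complex_of_real s \<cdot>\<^sub>m defect) V q"
    and \<rho>': "\<rho>' \<in> carrier_mat m m"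
      "\<And>x y. x < m \<Longrightarrow> y < m \<Longrightarrow>
        \<rho>' $$ (x, y) = (\<Sum>k\<in>E. \<Sum>i<n. \<Sum>j<n. G k x i * \<rho> $$ (i, j) * cnj (G k y j))"
    and xy: "x < m" "y < m"
  shows "\<rho>' $$ (x, y) = (\<Sum>k\<in>insert None (Some ` E). \<Sum>i\<in>dilated_index.
    complex_of_real (dilated_weight \<alpha> s p q i) * (dilated_ket U V i x k * cnj (dilated_ket U V i y k)))"
proof -
  have d: "defect \<in> carrier_mat m m" by (simp add: defect_def)
  have "(\<Sum>k\<in>E. \<Sum>i<n. complex_of_real (\<alpha> * p i) * (WU U (x, k) i * cnj (WU U (y, k) i))) =
    complex_of_real \<alpha> * \<rho>' $$ (x, y)"
    using WU_weighted[OF U] xy by (simp add: \<rho>'(2) W_def mult.assoc flip: sum_distrib_left)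
  moreover have "(\<Sum>k\<in>E. \<Sum>z\<in>Z. complex_of_real ((1 - \<alpha>) * s) * (Q (x, k) z * cnj (Q (y, k) z))) =
      complex_of_real ((1 - \<alpha>) * s) * defect $$ (x, y)"
  proof -
    have "(\<Sum>k\<in>E. \<Sum>z\<in>Z. Q (x, k) z * cnj (Q (y, k) z)) = (\<Sum>k\<in>E. Q (x, k) (y, k))"
      using xy by (intro sum.cong refl Q_Q) (auto simp: Z_def)
    thus ?thesis using xy by (simp add: defect_def flip: sum_distrib_left)
  qed
  moreover have "(\<Sum>i<m. complex_of_real ((1 - \<alpha>) * q i) * (V $$ (x, i) * cnj (V $$ (y, i)))) =
      complex_of_real (1 - \<alpha>) * (\<rho>' $$ (x, y) - complex_of_real s * defect $$ (x, y))"
    using spectral_decomposition_index(1)[OF V xy] xy d \<rho>'(1)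
    by (simp add: mult.assoc flip: sum_distrib_left)
  ultimately show ?thesis
    by (simp add: sum_environment sum_dilated_index sum.distrib) (simp add: algebra_simps)
qed

text \<open>Kets on \<open>None\<close> are orthogonal to all others. The overlaps between the range
  of \<open>W\<close> and \<open>Q\<close> are left as sums here; \<open>Q_WU\<close> makes them
  vanish.\<close>

lemma inner_dilated_ket:
  "(\<Sum>x<m. \<Sum>k\<in>insert None (Some ` E). cnj (dilated_ket U V j x k) * dilated_ket U' V' i x k) =
    (case (j, i) of
      (Inl j, Inl i) \<Rightarrow> (\<Sum>x<n. cnj (U $$ (x, j)) * U' $$ (x, i))
    | (Inl j, Inr (Inl z)) \<Rightarrow> (\<Sum>y\<in>Z. cnj (WU U y j) * Q y z)
    | (Inr (Inl z), Inl i) \<Rightarrow> (\<Sum>y\<in>Z. cnj (Q y z) * WU U' y i)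
    | (Inr (Inl z), Inr (Inl z')) \<Rightarrow> (\<Sum>y\<in>Z. cnj (Q y z) * Q y z')
    | (Inr (Inr j), Inr (Inr i)) \<Rightarrow> (\<Sum>x<m. cnj (V $$ (x, j)) * V' $$ (x, i))
    | _ \<Rightarrow> 0)"
  by (auto simp: sum_environment Z_def sum.cartesian_product' WU_WU[symmetric] split: sum.splits)

text \<open>Only kets of the same kind overlap. The frame bound therefore splits into \<alpha> times
  the relative entropy of the inputs, because \<open>W\<close> preserves the overlaps of the
  eigenvectors, and 1 - \<alpha> times a constant.\<close>

theorem f_relative_entropy_mono:
  assumes f: "operator_convex_on {0<..} f"
    and \<rho>: "strictly_positive_mat n \<rho>" and \<sigma>: "strictly_positive_mat n \<sigma>"
    and \<rho>': "strictly_positive_mat m \<rho>'" and \<sigma>': "strictly_positive_mat m \<sigma>'"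
    and \<rho>E: "\<And>x y. x < m \<Longrightarrow> y < m \<Longrightarrow>
      \<rho>' $$ (x, y) = (\<Sum>k\<in>E. \<Sum>i<n. \<Sum>j<n. G k x i * \<rho> $$ (i, j) * cnj (G k y j))"
    and \<sigma>E: "\<And>x y. x < m \<Longrightarrow> y < m \<Longrightarrow>
      \<sigma>' $$ (x, y) = (\<Sum>k\<in>E. \<Sum>i<n. \<Sum>j<n. G k x i * \<sigma> $$ (i, j) * cnj (G k y j))"
  shows "f_relative_entropy f \<rho>' \<sigma>' \<le> f_relative_entropy f \<rho> \<sigma>"
proof -
  have "hermitian_mat m defect"
    unfolding hermitian_mat_def defect_def by (auto simp: cnj_Q intro!: eq_matI)
  then obtain s1 s2 where s: "s1 > 0" "s2 > 0"
    "\<forall>s. 0 \<le> s \<longrightarrow> s \<le> s1 \<longrightarrow> strictly_positive_mat m (\<rho>' - complex_of_real s \<cdot>\<^sub>m defect)"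
    "\<forall>s. 0 \<le> s \<longrightarrow> s \<le> s2 \<longrightarrow> strictly_positive_mat m (\<sigma>' - complex_of_real s \<cdot>\<^sub>m defect)"
    using strictly_positive_perturbation[OF \<rho>'] strictly_positive_perturbation[OF \<sigma>'] by metis
  \<comment> \<open>One common \<open>s\<close> serves both outputs, so that the weights on
    \<open>Q\<close> coincide.\<close>
  define s where "s = min s1 s2"
  have s0: "s > 0" using s by (simp add: s_def)
  obtain U p where U: "spectral_decomposition n \<rho> U p" and p: "\<And>i. i < n \<Longrightarrow> p i > 0"
    using strictly_positive_decomposition[OF \<rho>] by blast
  obtain V q where V: "spectral_decomposition n \<sigma> V q" and q: "\<And>i. i < n \<Longrightarrow> q i > 0"
    using strictly_positive_decomposition[OF \<sigma>] by blast
  have "strictly_positive_mat m (\<rho>' - complex_of_real s \<cdot>\<^sub>m defect)"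
    using s by (simp add: s_def)
  then obtain U' p' where U': "spectral_decomposition m (\<rho>' - complex_of_real s \<cdot>\<^sub>m defect) U' p'"
    and p': "\<And>i. i < m \<Longrightarrow> p' i > 0"
    using strictly_positive_decomposition by blast
  have "strictly_positive_mat m (\<sigma>' - complex_of_real s \<cdot>\<^sub>m defect)"
    using s by (simp add: s_def)
  then obtain V' q' where V': "spectral_decomposition m (\<sigma>' - complex_of_real s \<cdot>\<^sub>m defect) V' q'"
    and q': "\<And>i. i < m \<Longrightarrow> q' i > 0"
    using strictly_positive_decomposition by blast
  have c: "\<rho>' \<in> carrier_mat m m" "\<sigma>' \<in> carrier_mat m m"
    using \<rho>' \<sigma>' by (auto simp: strictly_positive_mat_def hermitian_mat_def)
  \<comment> \<open>Contribution of \<open>Q\<close>, with \<open>f 1\<close> from the equal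
    weights, and of the environment state \<open>None\<close>; it is free of \<alpha>.\<close>
  define L where "L = (\<Sum>z\<in>Z. \<Sum>z'\<in>Z. s * f 1 * (cmod (\<Sum>y\<in>Z. cnj (Q y z') * Q y z))\<^sup>2) +
    (\<Sum>i<m. \<Sum>j<m. p' i * f (q' j / p' i) * (cmod (\<Sum>x<m. cnj (V' $$ (x, j)) * U' $$ (x, i)))\<^sup>2)"
  let ?S = "f_relative_entropy f \<rho>' \<sigma>'" and ?c = "f_relative_entropy f \<rho> \<sigma>"
  have le: "?S \<le> \<alpha> * ?c + (1 - \<alpha>) * L" if \<alpha>: "0 < \<alpha>" "\<alpha> < 1" for \<alpha>
  proof -
    let ?a = "dilated_weight \<alpha> s p p'" and ?b = "dilated_weight \<alpha> s q q'"
    let ?A = "dilated_ket U U'" and ?B = "dilated_ket V V'"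
    have "?S \<le> (\<Sum>i\<in>dilated_index. \<Sum>j\<in>dilated_index. ?a i * f (?b j / ?a i) *
      (cmod (\<Sum>x<m. \<Sum>k\<in>insert None (Some ` E). cnj (?B j x k) * ?A i x k))\<^sup>2)"
    proof (rule f_relative_entropy_le_frame[OF f \<rho>' c(2)])
      show "?a i > 0" if "i \<in> dilated_index" for i
        using that \<alpha> s0 p p' by (auto simp: dilated_index_def)
      show "?b i > 0" if "i \<in> dilated_index" for i
        using that \<alpha> s0 q q' by (auto simp: dilated_index_def)
      show "finite dilated_index" "finite dilated_index" by (simp_all add: dilated_index_def)
      show "finite (insert None (Some ` E))" using finE by simp
    qed (assumption | rule dilated_ket_frame[OF U U'] dilated_ket_frame[OF V V']
        dilated_ket_reduced[OF U U' c(1)] dilated_ket_reduced[OF V V' c(2)] \<rho>E \<sigma>E)+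
    also have "\<dots> = (\<Sum>i<n. \<Sum>j<n. \<alpha> * (p i * f (q j / p i) * (cmod (\<Sum>x<n. cnj (V $$ (x, j)) * U $$ (x, i)))\<^sup>2)) +
      (1 - \<alpha>) * L"
    proof -
      have WQ: "(\<Sum>y\<in>Z. cnj (WU V y j) * Q y z) = 0" if "z \<in> Z" for j z
        using arg_cong[OF Q_WU[OF that, of V j], of cnj] by (simp add: cnj_Q mult.commute)
      have QW: "(\<Sum>y\<in>Z. cnj (Q y z) * WU U y i) = 0" if "z \<in> Z" for i z
        using Q_WU[OF that, of U i] by (simp add: cnj_Q)
      show ?thesis
        using \<alpha> s0
        by (simp add: inner_dilated_ket sum_dilated_index WQ QW L_def sum_distrib_left distrib_left mult.assoc)
    qed
    also have "(\<Sum>i<n. \<Sum>j<n. \<alpha> * (p i * f (q j / p i) * (cmod (\<Sum>x<n. cnj (V $$ (x, j)) * U $$ (x, i)))\<^sup>2)) = \<alpha> * ?c"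
      by (subst sum.swap) (simp add: f_relative_entropy_spectral[OF U p V] sum_distrib_left)
    finally show ?thesis .
  qed
  show ?thesis
  proof (rule ccontr)
    assume "\<not> ?thesis"
    hence lt: "?c < ?S" by simp
    define D where "D = L - ?c"
    have le': "?S - ?c \<le> \<beta> * D" if "0 < \<beta>" "\<beta> < 1" for \<beta>
      using le[of "1 - \<beta>"] that by (simp add: D_def algebra_simps)
    have "0 < D / 2" using le'[of "1/2"] lt by simp
    hence D: "D > 0" by simp
    \<comment> \<open>With \<beta> = 1 - \<alpha>, the supposed gap is at most \<beta> D for every
      \<beta> between 0 and 1. This choice bounds the gap by half of itself.\<close>
    define \<beta> where "\<beta> = min (1/2) ((?S - ?c) / (2 * D))"
    have "0 < \<beta>" "\<beta> < 1" using lt D by (auto simp: \<beta>_def)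
    hence "?S - ?c \<le> \<beta> * D" by (rule le')
    also have "\<dots> \<le> (?S - ?c) / (2 * D) * D" using D by (intro mult_right_mono) (auto simp: \<beta>_def)
    also have "\<dots> = (?S - ?c) / 2" using D by simp
    finally show False using lt by simp
  qed
qed

end

section \<open>Channels with an idle reference system\<close>

lemma tensor_index_less: "a < d \<Longrightarrow> i < r \<Longrightarrow> a * r + i < d * (r::nat)"
  using mult_le_mono1[of "Suc a" d r] by simp

lemma div_mod_less:
  assumes "z < d * (r::nat)"
  shows "z div r < d" "z mod r < r"
  using assms by (auto simp: less_mult_imp_div_less) (cases r; auto)

text \<open>The operator coefficient of the reference matrix unit \<open>(i, j)\<close> in
  \<open>X\<close>, on which \<open>tensor_id\<close> lets \<open>E\<close> act.\<close>

definition block :: "nat \<Rightarrow> nat \<Rightarrow> complex mat \<Rightarrow> nat \<Rightarrow> nat \<Rightarrow> complex mat" where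
  "block d r X i j = mat d d (\<lambda>(a, b). X $$ (a * r + i, b * r + j))"

lemma block_carrier [simp]: "block d r X i j \<in> carrier_mat d d"
  by (simp add: block_def)

lemma tensor_id_carrier [simp]: "tensor_id d d' r E X \<in> carrier_mat (d' * r) (d' * r)"
  by (simp add: tensor_id_def)

lemma tensor_id_index:
  "x < d' * r \<Longrightarrow> y < d' * r \<Longrightarrow>
    tensor_id d d' r E X $$ (x, y) = E (block d r X (x mod r) (y mod r)) $$ (x div r, y div r)"
  by (simp add: tensor_id_def block_def)

lemma block_tensor_id:
  assumes "linear_superop d d' E" "i < r" "j < r"
  shows "block d' r (tensor_id d d' r E X) i j = E (block d r X i j)"
proof -
  have "E (block d r X i j) \<in> carrier_mat d' d'"
    using assms by (simp add: linear_superop_def)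
  thus ?thesis
    using assms(2,3)
    by (intro eq_matI) (auto simp: block_def[of d'] tensor_id_index tensor_index_less)
qed

lemma tensor_id_comp:
  assumes "linear_superop d d' E1"
  shows "tensor_id d' d'' r E2 (tensor_id d d' r E1 X) = tensor_id d d'' r (E2 \<circ> E1) X"
proof (rule eq_matI)
  fix x y assume "x < dim_row (tensor_id d d'' r (E2 \<circ> E1) X)" "y < dim_col (tensor_id d d'' r (E2 \<circ> E1) X)"
  hence xy: "x < d'' * r" "y < d'' * r" by (auto simp: tensor_id_def)
  thus "tensor_id d' d'' r E2 (tensor_id d d' r E1 X) $$ (x, y) = tensor_id d d'' r (E2 \<circ> E1) X $$ (x, y)"
    by (simp add: tensor_id_index block_tensor_id[OF assms] div_mod_less)
qed (auto simp: tensor_id_def)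

section \<open>Linearity, matrix units and the Kraus representation\<close>

lemma superop_sum:
  assumes E: "linear_superop d d' E" and S: "finite S"
    and M: "\<And>s. s \<in> S \<Longrightarrow> M s \<in> carrier_mat d d" and ab: "a < d'" "b < d'"
  shows "E (mat d d (\<lambda>(x, y). \<Sum>s\<in>S. c s * M s $$ (x, y))) $$ (a, b) = (\<Sum>s\<in>S. c s * E (M s) $$ (a, b))"
  using S M
proof (induction S)
  case empty
  have "E (0 \<cdot>\<^sub>m Y) = 0 \<cdot>\<^sub>m E Y" "E Y \<in> carrier_mat d' d'" if "Y \<in> carrier_mat d d" for Y
    using E that by (simp_all add: linear_superop_def)
  note zero = this[OF zero_carrier_mat]
  have "E (0\<^sub>m d d) $$ (a, b) = (0 \<cdot>\<^sub>m E (0\<^sub>m d d)) $$ (a, b)"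
    using arg_cong[OF zero(1), of "\<lambda>M. M $$ (a, b)"] by simp
  also have "\<dots> = 0" using zero(2) ab by simp
  finally have "E (0\<^sub>m d d) $$ (a, b) = 0" .
  moreover have "mat d d (\<lambda>(x, y). \<Sum>s\<in>{}. c s * M s $$ (x, y)) = 0\<^sub>m d d" by (intro eq_matI) auto
  ultimately show ?case by (simp only: sum.empty)
next
  case (insert s S)
  let ?N = "mat d d (\<lambda>(x, y). \<Sum>s\<in>S. c s * M s $$ (x, y))"
  have Ms: "M s \<in> carrier_mat d d" using insert by simp
  have e: "mat d d (\<lambda>(x, y). \<Sum>s\<in>insert s S. c s * M s $$ (x, y)) = c s \<cdot>\<^sub>m M s + ?N"
    using insert.hyps carrier_matD[OF Ms] by (intro eq_matI) auto
  have e': "E (c s \<cdot>\<^sub>m M s + ?N) = c s \<cdot>\<^sub>m E (M s) + E ?N"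
    using E Ms by (simp add: linear_superop_def)
  have c: "E (M s) \<in> carrier_mat d' d'" "E ?N \<in> carrier_mat d' d'"
    using E Ms by (simp_all add: linear_superop_def)
  have "E ?N $$ (a, b) = (\<Sum>s\<in>S. c s * E (M s) $$ (a, b))"
    by (rule insert.IH) (simp add: insert.prems)
  thus ?case unfolding e e' using c ab insert.hyps by simp
qed

definition matrix_unit :: "nat \<Rightarrow> nat \<Rightarrow> nat \<Rightarrow> complex mat" where
  "matrix_unit d i j = mat d d (\<lambda>(x, y). if x = i \<and> y = j then 1 else 0)"

lemma superop_matrix_units:
  assumes E: "linear_superop d d' E" and A: "A \<in> carrier_mat d d" and ab: "a < d'" "b < d'"
  shows "E A $$ (a, b) = (\<Sum>i<d. \<Sum>j<d. A $$ (i, j) * E (matrix_unit d i j) $$ (a, b))"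
proof -
  have "A = mat d d (\<lambda>(x, y). \<Sum>s\<in>{..<d} \<times> {..<d}. A $$ s * matrix_unit d (fst s) (snd s) $$ (x, y))"
  proof (rule eq_matI)
    fix x y assume "x < dim_row (mat d d (\<lambda>(x, y). \<Sum>s\<in>{..<d} \<times> {..<d}. A $$ s * matrix_unit d (fst s) (snd s) $$ (x, y)))"
      "y < dim_col (mat d d (\<lambda>(x, y). \<Sum>s\<in>{..<d} \<times> {..<d}. A $$ s * matrix_unit d (fst s) (snd s) $$ (x, y)))"
    hence xy: "x < d" "y < d" by auto
    have "(\<Sum>s\<in>{..<d} \<times> {..<d}. A $$ s * matrix_unit d (fst s) (snd s) $$ (x, y)) =
      (\<Sum>s\<in>{..<d} \<times> {..<d}. if s = (x, y) then A $$ s else 0)"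
      using xy by (intro sum.cong) (auto simp: matrix_unit_def)
    thus "A $$ (x, y) = mat d d (\<lambda>(x, y). \<Sum>s\<in>{..<d} \<times> {..<d}. A $$ s * matrix_unit d (fst s) (snd s) $$ (x, y)) $$ (x, y)"
      using xy by simp
  qed (use A in auto)
  hence "E A $$ (a, b) = E (mat d d (\<lambda>(x, y). \<Sum>s\<in>{..<d} \<times> {..<d}. A $$ s * matrix_unit d (fst s) (snd s) $$ (x, y))) $$ (a, b)"
    by simp
  also have "\<dots> = (\<Sum>s\<in>{..<d} \<times> {..<d}. A $$ s * E (matrix_unit d (fst s) (snd s)) $$ (a, b))"
    by (rule superop_sum[OF E _ _ ab]) (auto simp: matrix_unit_def)
  finally show ?thesis by (simp add: sum.cartesian_product')
qed

text \<open>The vectors are the eigenvectors scaled by the roots of the eigenvalues.\<close>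

lemma psd_decomposition:
  assumes "psd_mat n X"
  obtains x :: "nat \<Rightarrow> nat \<Rightarrow> complex" where
    "\<And>k l. k < n \<Longrightarrow> l < n \<Longrightarrow> X $$ (k, l) = (\<Sum>i<n. x i k * cnj (x i l))"
proof -
  have "hermitian_mat n X" using assms by (simp add: psd_mat_def)
  then obtain U a where s: "spectral_decomposition n X U a"
    using hermitian_spectral_decomposition by blast
  have a: "a i \<ge> 0" if "i < n" for i
    using assms spectral_decomposition_eigenvalue[OF s that] by (auto simp: psd_mat_def)
  show ?thesis
  proof
    fix k l assume kl: "k < n" "l < n"
    have "X $$ (k, l) = (\<Sum>i<n. complex_of_real (a i) * (U $$ (k, i) * cnj (U $$ (l, i))))"
      by (rule spectral_decomposition_index(1)[OF s kl])
    also have "\<dots> = (\<Sum>i<n. (complex_of_real (sqrt (a i)) * U $$ (k, i)) * cnj (complex_of_real (sqrt (a i)) * U $$ (l, i)))"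
    proof (intro sum.cong refl)
      fix i assume "i \<in> {..<n}"
      hence "complex_of_real (sqrt (a i)) * complex_of_real (sqrt (a i)) = complex_of_real (a i)"
        using a by (simp flip: of_real_mult)
      thus "complex_of_real (a i) * (U $$ (k, i) * cnj (U $$ (l, i))) =
        (complex_of_real (sqrt (a i)) * U $$ (k, i)) * cnj (complex_of_real (sqrt (a i)) * U $$ (l, i))"
        by (simp add: mult_ac)
    qed
    finally show "X $$ (k, l) = (\<Sum>i<n. (complex_of_real (sqrt (a i)) * U $$ (k, i)) * cnj (complex_of_real (sqrt (a i)) * U $$ (l, i)))" .
  qed
qed

lemma ket_bra_carrier: "\<psi> \<in> carrier_vec n \<Longrightarrow> ket_bra \<psi> \<in> carrier_mat n n"
  by (auto simp: ket_bra_def)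

lemma ket_bra_index: "\<psi> \<in> carrier_vec n \<Longrightarrow> k < n \<Longrightarrow> l < n \<Longrightarrow> ket_bra \<psi> $$ (k, l) = \<psi> $ k * cnj (\<psi> $ l)"
  by (auto simp: ket_bra_def)

lemma psd_ket_bra:
  assumes "\<psi> \<in> carrier_vec n"
  shows "psd_mat n (ket_bra \<psi>)"
  unfolding psd_mat_def hermitian_mat_def
proof (intro conjI ballI)
  show "mat_adjoint (ket_bra \<psi>) = ket_bra \<psi>"
    by (intro eq_matI) (auto simp: ket_bra_def)
  fix v :: "complex vec" assume v: "v \<in> carrier_vec n"
  have "(ket_bra \<psi> *\<^sub>v v) \<bullet>c v = (\<Sum>i<n. \<Sum>j<n. (\<psi> $ i * cnj (v $ i)) * cnj (\<psi> $ j * cnj (v $ j)))"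
    unfolding quadratic_form_sum[OF ket_bra_carrier[OF assms] v]
    by (intro sum.cong refl) (use assms in \<open>auto simp: ket_bra_index\<close>)
  also have "\<dots> = (\<Sum>i<n. \<psi> $ i * cnj (v $ i)) * cnj (\<Sum>i<n. \<psi> $ i * cnj (v $ i))"
    by (simp add: sum_product)
  finally have "(ket_bra \<psi> *\<^sub>v v) \<bullet>c v = complex_of_real ((cmod (\<Sum>i<n. \<psi> $ i * cnj (v $ i)))\<^sup>2)"
    by (simp only: complex_norm_square)
  thus "0 \<le> Re ((ket_bra \<psi> *\<^sub>v v) \<bullet>c v)" by simp
qed (rule ket_bra_carrier[OF assms])

text \<open>The Kraus operators are read off from a decomposition of the Choi matrix into rank-one terms.\<close>

lemma cptp_kraus:
  assumes E: "cptp d d' E"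
  obtains K :: "nat \<Rightarrow> nat \<Rightarrow> nat \<Rightarrow> complex" where
    "\<And>A a b. A \<in> carrier_mat d d \<Longrightarrow> a < d' \<Longrightarrow> b < d' \<Longrightarrow>
      E A $$ (a, b) = (\<Sum>k<d' * d. \<Sum>i<d. \<Sum>j<d. K k a i * A $$ (i, j) * cnj (K k b j))"
    "\<And>i j. i < d \<Longrightarrow> j < d \<Longrightarrow> (\<Sum>k<d' * d. \<Sum>a<d'. cnj (K k a i) * K k a j) = (if i = j then 1 else 0)"
proof -
  \<comment> \<open>The unnormalized maximally entangled vector: its blocks are the matrix units, so
    its image under \<open>E\<close> tensored with the identity is the Choi matrix.\<close>
  let ?\<omega> = "vec_rows (1\<^sub>m d)"
  have lin: "linear_superop d d' E" using E by (simp add: cptp_def)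
  have \<omega>: "?\<omega> \<in> carrier_vec (d * d)" by (simp add: vec_rows_def)
  have "psd_mat (d' * d) (tensor_id d d' d E (ket_bra ?\<omega>))"
    using E psd_ket_bra[OF \<omega>] by (simp add: cptp_def completely_positive_def)
  then obtain x where x: "\<And>k l. k < d' * d \<Longrightarrow> l < d' * d \<Longrightarrow>
      tensor_id d d' d E (ket_bra ?\<omega>) $$ (k, l) = (\<Sum>i<d' * d. x i k * cnj (x i l))"
    using psd_decomposition by blast
  define K where "K k a i = x k (a * d + i)" for k a i
  have \<omega>i: "?\<omega> $ (a * d + i) = (if a = i then 1 else 0)" if "a < d" "i < d" for a i
    using that by (simp add: vec_rows_def tensor_index_less)
  have blk: "block d d (ket_bra ?\<omega>) i j = matrix_unit d i j" if "i < d" "j < d" for i j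
    using that
    by (intro eq_matI) (auto simp: block_def matrix_unit_def ket_bra_index[OF \<omega>] tensor_index_less \<omega>i)
  have KE: "E (matrix_unit d i j) $$ (a, b) = (\<Sum>k<d' * d. K k a i * cnj (K k b j))"
    if "i < d" "j < d" "a < d'" "b < d'" for i j a b
    using x[of "a * d + i" "b * d + j"] that
    by (simp add: tensor_index_less tensor_id_index blk K_def)
  show ?thesis
  proof
    fix A :: "complex mat" and a b
    assume A: "A \<in> carrier_mat d d" and ab: "a < d'" "b < d'"
    have "E A $$ (a, b) = (\<Sum>i<d. \<Sum>j<d. \<Sum>k<d' * d. K k a i * A $$ (i, j) * cnj (K k b j))"
      unfolding superop_matrix_units[OF lin A ab]
      by (intro sum.cong refl) (use ab in \<open>simp add: KE sum_distrib_left mult_ac\<close>)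
    also have "\<dots> = (\<Sum>i<d. \<Sum>k<d' * d. \<Sum>j<d. K k a i * A $$ (i, j) * cnj (K k b j))"
      by (rule sum.cong[OF refl]) (rule sum.swap)
    also have "\<dots> = (\<Sum>k<d' * d. \<Sum>i<d. \<Sum>j<d. K k a i * A $$ (i, j) * cnj (K k b j))"
      by (rule sum.swap)
    finally show "E A $$ (a, b) = \<dots>" .
  next
    fix i j assume ij: "i < d" "j < d"
    \<comment> \<open>Trace preservation on this matrix unit is the completeness relation of the
      Kraus operators at the entry \<open>(i, j)\<close>.\<close>
    have c: "matrix_unit d j i \<in> carrier_mat d d" by (simp add: matrix_unit_def)
    have "(\<Sum>k<d' * d. \<Sum>a<d'. cnj (K k a i) * K k a j) = (\<Sum>a<d'. \<Sum>k<d' * d. K k a j * cnj (K k a i))"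
      by (subst sum.swap) (simp add: mult.commute)
    also have "\<dots> = (\<Sum>a<d'. E (matrix_unit d j i) $$ (a, a))"
      using ij by (simp add: KE)
    also have "\<dots> = mat_trace (E (matrix_unit d j i))"
    proof -
      have "E (matrix_unit d j i) \<in> carrier_mat d' d'" using lin c by (simp add: linear_superop_def)
      thus ?thesis by (simp add: mat_trace_def)
    qed
    also have "\<dots> = mat_trace (matrix_unit d j i)"
      using E c by (simp add: cptp_def trace_preserving_def)
    also have "\<dots> = (\<Sum>a<d. if a = j then if j = i then 1 else 0 else 0)"
      by (auto simp: mat_trace_def matrix_unit_def intro!: sum.cong)
    also have "\<dots> = (if i = j then 1 else 0)" using ij by auto
    finally show "(\<Sum>k<d' * d. \<Sum>a<d'. cnj (K k a i) * K k a j) = (if i = j then 1 else 0)" .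
  qed
qed

theorem f_relative_entropy_tensor_id_mono:
  assumes f: "operator_convex_on {0<..} f" and E: "cptp d d' E"
    and pos: "strictly_positive_mat (d * r) \<rho>" "strictly_positive_mat (d * r) \<sigma>"
      "strictly_positive_mat (d' * r) (tensor_id d d' r E \<rho>)"
      "strictly_positive_mat (d' * r) (tensor_id d d' r E \<sigma>)"
  shows "f_relative_entropy f (tensor_id d d' r E \<rho>) (tensor_id d d' r E \<sigma>) \<le> f_relative_entropy f \<rho> \<sigma>"
proof -
  obtain K where K: "\<And>A a b. A \<in> carrier_mat d d \<Longrightarrow> a < d' \<Longrightarrow> b < d' \<Longrightarrow>
      E A $$ (a, b) = (\<Sum>k<d' * d. \<Sum>i<d. \<Sum>j<d. K k a i * A $$ (i, j) * cnj (K k b j))"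
    "\<And>i j. i < d \<Longrightarrow> j < d \<Longrightarrow> (\<Sum>k<d' * d. \<Sum>a<d'. cnj (K k a i) * K k a j) = (if i = j then 1 else 0)"
    using cptp_kraus[OF E] by blast
  \<comment> \<open>The Kraus operators of \<open>E\<close> tensored with the identity on the
    reference.\<close>
  define G where "G k x y = (if x mod r = y mod r then K k (x div r) (y div r) else 0)" for k x y
  have col: "(\<Sum>j<d * r. h j * cnj (G k x j)) = (\<Sum>v<d. h (v * r + x mod r) * cnj (K k (x div r) v))"
    if "x < d' * r" for h k x
  proof -
    have "(\<Sum>j<d * r. h j * cnj (G k x j)) =
      (\<Sum>v<d. \<Sum>j<r. if x mod r = j then h (v * r + j) * cnj (K k (x div r) v) else 0)"
      by (rule sum_lessThan_mult) (auto simp: G_def)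
    also have "\<dots> = (\<Sum>v<d. h (v * r + x mod r) * cnj (K k (x div r) v))"
      using div_mod_less[OF that] by simp
    finally show ?thesis .
  qed
  have G: "tensor_id d d' r E X $$ (x, y) =
      (\<Sum>k<d' * d. \<Sum>i<d * r. \<Sum>j<d * r. G k x i * X $$ (i, j) * cnj (G k y j))"
    if xy: "x < d' * r" "y < d' * r" for X x y
  proof -
    have "(\<Sum>i<d * r. \<Sum>j<d * r. G k x i * X $$ (i, j) * cnj (G k y j)) =
      (\<Sum>i<d. \<Sum>j<d. K k (x div r) i * X $$ (i * r + x mod r, j * r + y mod r) * cnj (K k (y div r) j))" for k
    proof -
      have "(\<Sum>i<d * r. \<Sum>j<d * r. G k x i * X $$ (i, j) * cnj (G k y j)) =
          (\<Sum>i<d * r. cnj ((\<Sum>j<d. cnj (X $$ (i, j * r + y mod r)) * K k (y div r) j) * cnj (G k x i)))"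
        by (intro sum.cong refl, subst col[OF xy(2)]) (simp add: sum_distrib_left mult_ac)
      also have "\<dots> = cnj (\<Sum>i<d * r. (\<Sum>j<d. cnj (X $$ (i, j * r + y mod r)) * K k (y div r) j) * cnj (G k x i))"
        by simp
      also have "\<dots> = (\<Sum>i<d. \<Sum>j<d. K k (x div r) i * X $$ (i * r + x mod r, j * r + y mod r) * cnj (K k (y div r) j))"
        unfolding col[OF xy(1)] by (simp add: sum_distrib_left mult_ac)
      finally show ?thesis .
    qed
    thus ?thesis
      using div_mod_less[OF xy(1)] div_mod_less[OF xy(2)]
      by (simp add: tensor_id_index[OF xy] K(1)) (simp add: block_def)
  qed
  interpret kraus_family "d' * r" "d * r" "{..<d' * d}" G
  proof
    fix i j assume ij: "i < d * r" "j < d * r"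
    have "(\<Sum>x<d' * r. cnj (G k x i) * G k x j) =
      (\<Sum>a<d'. \<Sum>x<r. if x = i mod r then
        if i mod r = j mod r then cnj (K k a (i div r)) * K k a (j div r) else 0 else 0)" for k
      by (rule sum_lessThan_mult) (auto simp: G_def)
    hence "(\<Sum>k<d' * d. \<Sum>x<d' * r. cnj (G k x i) * G k x j) =
      (if i mod r = j mod r then if i div r = j div r then 1 else 0 else 0)"
      using div_mod_less[OF ij(1)] div_mod_less[OF ij(2)] by (simp add: K(2))
    also have "\<dots> = (if i = j then 1 else 0)" by (auto, metis div_mult_mod_eq)
    finally show "(\<Sum>k<d' * d. \<Sum>x<d' * r. cnj (G k x i) * G k x j) = (if i = j then 1 else 0)" .
  qed simp
  show ?thesis by (rule f_relative_entropy_mono[OF f pos G G])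
qed

text \<open>Trace preservation applied to each block: a channel on the system leaves the reference
  marginal unchanged.\<close>

lemma trace_left_tensor_id:
  assumes E: "cptp d d' E"
  shows "trace_left d' r (tensor_id d d' r E X) = trace_left d r X"
proof (rule eq_matI)
  fix i j assume "i < dim_row (trace_left d r X)" "j < dim_col (trace_left d r X)"
  hence ij: "i < r" "j < r" by (auto simp: trace_left_def)
  have lin: "linear_superop d d' E" using E by (simp add: cptp_def)
  have c: "E (block d r X i j) \<in> carrier_mat d' d'" using lin by (simp add: linear_superop_def)
  have "trace_left d' r (tensor_id d d' r E X) $$ (i, j) = mat_trace (E (block d r X i j))"
    using ij c by (simp add: trace_left_def mat_trace_def tensor_id_index tensor_index_less)
  also have "\<dots> = mat_trace (block d r X i j)"
    using E by (simp add: cptp_def trace_preserving_def)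
  finally show "trace_left d' r (tensor_id d d' r E X) $$ (i, j) = trace_left d r X $$ (i, j)"
    using ij by (simp add: trace_left_def mat_trace_def block_def)
qed (auto simp: trace_left_def)

lemma trace_right_tensor_id:
  assumes E: "linear_superop d d' E"
  shows "trace_right d' r (tensor_id d d' r E X) = E (trace_right d r X)"
proof -
  have "E (trace_right d r X) \<in> carrier_mat d' d'"
    using E by (simp add: linear_superop_def trace_right_def)
  moreover have "trace_right d r X = mat d d (\<lambda>(x, y). \<Sum>i<r. 1 * block d r X i i $$ (x, y))"
    by (intro eq_matI) (auto simp: trace_right_def block_def)
  ultimately show ?thesis
    using superop_sum[OF E, of "{..<r}" "\<lambda>i. block d r X i i" _ _ "\<lambda>_. 1"]
    by (intro eq_matI) (auto simp: trace_right_def[of d'] tensor_id_index tensor_index_less)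
qed

text \<open>A channel acting on the reference system commutes with \<open>E \<otimes> I\<close>.\<close>

lemma tensor_id_reference_channel:
  assumes E: "linear_superop d d' E" and S: "finite S"
    and X: "\<And>u v i j. u < d \<Longrightarrow> v < d \<Longrightarrow> i < r \<Longrightarrow> j < r \<Longrightarrow>
      X $$ (u * r + i, v * r + j) =
        (\<Sum>k\<in>S. \<Sum>a<t. \<Sum>b<t. F k i a * Y $$ (u * t + a, v * t + b) * cnj (F k j b))"
    and xy: "x < d' * r" "y < d' * r"
  shows "tensor_id d d' r E X $$ (x, y) =
    (\<Sum>k\<in>S. \<Sum>i<d' * t. \<Sum>j<d' * t.
      (if x div r = i div t then F k (x mod r) (i mod t) else 0) * tensor_id d d' t E Y $$ (i, j) *
      cnj (if y div r = j div t then F k (y mod r) (j mod t) else 0))"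
proof -
  let ?i = "x mod r" and ?j = "y mod r" and ?a = "x div r" and ?b = "y div r"
  let ?I = "S \<times> {..<t} \<times> {..<t}"
  note dm = div_mod_less[OF xy(1)] div_mod_less[OF xy(2)]
  \<comment> \<open>For fixed reference indices the channel only forms scalar combinations of the
    blocks of \<open>Y\<close>, and linearity lets \<open>E\<close> pass through them.\<close>
  have "block d r X ?i ?j = mat d d (\<lambda>(u, v). \<Sum>s\<in>?I.
      (F (fst s) ?i (fst (snd s)) * cnj (F (fst s) ?j (snd (snd s)))) * block d t Y (fst (snd s)) (snd (snd s)) $$ (u, v))"
    using dm by (intro eq_matI) (auto simp: block_def X sum.cartesian_product' mult_ac)
  hence "tensor_id d d' r E X $$ (x, y) = (\<Sum>s\<in>?I.
      (F (fst s) ?i (fst (snd s)) * cnj (F (fst s) ?j (snd (snd s)))) * E (block d t Y (fst (snd s)) (snd (snd s))) $$ (?a, ?b))"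
    unfolding tensor_id_index[OF xy] using superop_sum[OF E, of ?I _ ?a ?b] S dm by simp
  also have "\<dots> = (\<Sum>k\<in>S. \<Sum>a<t. \<Sum>b<t. F k ?i a * cnj (F k ?j b) * E (block d t Y a b) $$ (?a, ?b))"
    by (simp add: sum.cartesian_product')
  also have "\<dots> = (\<Sum>k\<in>S. \<Sum>i<d' * t. \<Sum>j<d' * t.
      (if ?a = i div t then F k ?i (i mod t) else 0) * tensor_id d d' t E Y $$ (i, j) *
      cnj (if ?b = j div t then F k ?j (j mod t) else 0))"
  proof (rule sum.cong[OF refl])
    fix k
    have "(\<Sum>i<d' * t. \<Sum>j<d' * t.
      (if ?a = i div t then F k ?i (i mod t) else 0) * tensor_id d d' t E Y $$ (i, j) *
      cnj (if ?b = j div t then F k ?j (j mod t) else 0)) =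
      (\<Sum>p<d'. \<Sum>a<t. if ?a = p then \<Sum>b<t. F k ?i a * cnj (F k ?j b) * E (block d t Y a b) $$ (?a, ?b) else 0)"
    proof (rule sum_lessThan_mult)
      fix i assume i: "i < d' * t"
      have "(\<Sum>j<d' * t. (if ?a = i div t then F k ?i (i mod t) else 0) * tensor_id d d' t E Y $$ (i, j) *
          cnj (if ?b = j div t then F k ?j (j mod t) else 0)) =
        (\<Sum>q<d'. \<Sum>b<t. if ?b = q then (if ?a = i div t then F k ?i (i mod t) else 0) * cnj (F k ?j b) *
            E (block d t Y (i mod t) b) $$ (i div t, q) else 0)"
        by (rule sum_lessThan_mult) (auto simp: tensor_id_index i)
      also have "\<dots> = (\<Sum>q<d'. if ?b = q then \<Sum>b<t. (if ?a = i div t then F k ?i (i mod t) else 0) * cnj (F k ?j b) *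
            E (block d t Y (i mod t) b) $$ (i div t, q) else 0)"
        by (intro sum.cong refl) auto
      also have "\<dots> = (\<Sum>b<t. (if ?a = i div t then F k ?i (i mod t) else 0) * cnj (F k ?j b) *
            E (block d t Y (i mod t) b) $$ (i div t, ?b))"
        using dm by simp
      also have "\<dots> = (if ?a = i div t then \<Sum>b<t. F k ?i (i mod t) * cnj (F k ?j b) *
            E (block d t Y (i mod t) b) $$ (?a, ?b) else 0)"
        by auto
      finally show "(\<Sum>j<d' * t. (if ?a = i div t then F k ?i (i mod t) else 0) * tensor_id d d' t E Y $$ (i, j) *
          cnj (if ?b = j div t then F k ?j (j mod t) else 0)) = \<dots>" .
    qed
    also have "\<dots> = (\<Sum>p<d'. if ?a = p then \<Sum>a<t. \<Sum>b<t. F k ?i a * cnj (F k ?j b) * E (block d t Y a b) $$ (?a, ?b) else 0)"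
      by (intro sum.cong refl) auto
    also have "\<dots> = (\<Sum>a<t. \<Sum>b<t. F k ?i a * cnj (F k ?j b) * E (block d t Y a b) $$ (?a, ?b))"
      using dm by simp
    finally show "(\<Sum>a<t. \<Sum>b<t. F k ?i a * cnj (F k ?j b) * E (block d t Y a b) $$ (?a, ?b)) =
      (\<Sum>i<d' * t. \<Sum>j<d' * t.
      (if ?a = i div t then F k ?i (i mod t) else 0) * tensor_id d d' t E Y $$ (i, j) *
      cnj (if ?b = j div t then F k ?j (j mod t) else 0))" by (rule sym)
  qed
  finally show ?thesis .
qed

text \<open>The form of the partial trace at \<open>v\<close> is the sum of the forms of
  \<open>X\<close> at \<open>v\<close> tensored with the basis vectors of the reference;
  \<open>r > 0\<close> makes this sum nonempty. It gives full rank to the output of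
  \<open>E1\<close>.\<close>

lemma strictly_positive_trace_right:
  assumes X: "strictly_positive_mat (d * r) X" and r: "r > 0"
  shows "strictly_positive_mat d (trace_right d r X)"
  unfolding strictly_positive_mat_def
proof (intro conjI ballI impI)
  have Xc: "X \<in> carrier_mat (d * r) (d * r)" and Xh: "hermitian_mat (d * r) X"
    using X by (auto simp: strictly_positive_mat_def hermitian_mat_def)
  show "hermitian_mat d (trace_right d r X)"
    unfolding hermitian_mat_def
    using hermitian_mat_index[OF Xh] by (auto simp: trace_right_def tensor_index_less intro!: eq_matI)
  fix v :: "complex vec" assume v: "v \<in> carrier_vec d" "v \<noteq> 0\<^sub>v d"
  define w where "w i = vec (d * r) (\<lambda>k. if k mod r = i then v $ (k div r) else 0)" for i
  have w: "w i \<in> carrier_vec (d * r)" for i by (simp add: w_def)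
  have wv: "w i $ (a * r + i) = v $ a" if "i < r" "a < d" for i a
    using that by (simp add: w_def tensor_index_less)
  have q: "(X *\<^sub>v w i) \<bullet>c w i = (\<Sum>a<d. \<Sum>b<d. X $$ (a * r + i, b * r + i) * v $ b * cnj (v $ a))"
    if i: "i < r" for i
  proof -
    have "(\<Sum>l<d * r. X $$ (k, l) * w i $ l * c) = (\<Sum>b<d. X $$ (k, b * r + i) * v $ b * c)" for k c
    proof -
      have "(\<Sum>l<d * r. X $$ (k, l) * w i $ l * c) =
        (\<Sum>b<d. \<Sum>j<r. if j = i then X $$ (k, b * r + j) * v $ b * c else 0)"
        by (rule sum_lessThan_mult) (auto simp: w_def)
      thus ?thesis using i by simp
    qed
    hence "(X *\<^sub>v w i) \<bullet>c w i = (\<Sum>k<d * r. \<Sum>b<d. X $$ (k, b * r + i) * v $ b * cnj (w i $ k))"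
      by (simp add: quadratic_form_sum[OF Xc w])
    also have "\<dots> = (\<Sum>a<d. \<Sum>j<r. if j = i then \<Sum>b<d. X $$ (a * r + j, b * r + i) * v $ b * cnj (v $ a) else 0)"
      by (rule sum_lessThan_mult) (auto simp: w_def)
    finally show ?thesis using i by simp
  qed
  have "trace_right d r X \<in> carrier_mat d d" by (simp add: trace_right_def)
  hence "(trace_right d r X *\<^sub>v v) \<bullet>c v = (\<Sum>a<d. \<Sum>b<d. \<Sum>i<r. X $$ (a * r + i, b * r + i) * v $ b * cnj (v $ a))"
    using quadratic_form_sum[OF _ v(1)] by (simp add: trace_right_def sum_distrib_right)
  also have "\<dots> = (\<Sum>a<d. \<Sum>i<r. \<Sum>b<d. X $$ (a * r + i, b * r + i) * v $ b * cnj (v $ a))"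
    by (rule sum.cong[OF refl]) (rule sum.swap)
  also have "\<dots> = (\<Sum>i<r. \<Sum>a<d. \<Sum>b<d. X $$ (a * r + i, b * r + i) * v $ b * cnj (v $ a))"
    by (rule sum.swap)
  also have "\<dots> = (\<Sum>i<r. (X *\<^sub>v w i) \<bullet>c w i)" by (simp add: q)
  finally have e: "Re ((trace_right d r X *\<^sub>v v) \<bullet>c v) = (\<Sum>i<r. Re ((X *\<^sub>v w i) \<bullet>c w i))" by simp
  have "w i \<noteq> 0\<^sub>v (d * r)" if i: "i < r" for i
  proof
    assume "w i = 0\<^sub>v (d * r)"
    hence "v $ a = 0" if "a < d" for a
      using wv[OF i that] that i by (simp add: tensor_index_less)
    hence "v = 0\<^sub>v d" using v by (intro eq_vecI) auto
    thus False using v by simp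
  qed
  thus "0 < Re ((trace_right d r X *\<^sub>v v) \<bullet>c v)"
    unfolding e using X w r by (intro sum_pos) (auto simp: strictly_positive_mat_def)
qed

lemma strictly_positive_rank:
  assumes A: "strictly_positive_mat n A"
  shows "vec_space.rank n A = n"
proof -
  obtain U a where s: "spectral_decomposition n A U a" and a: "\<And>i. i < n \<Longrightarrow> a i > 0"
    using strictly_positive_decomposition[OF A] by blast
  let ?S = "mat_fun (\<lambda>x. inverse (sqrt x)) A"
  have c: "A \<in> carrier_mat n n" "?S \<in> carrier_mat n n"
    using spectral_decompositionD(5)[OF s]
      spectral_decompositionD(5)[OF spectral_decomposition_mat_fun[OF s, of "\<lambda>x. inverse (sqrt x)"]] by blast+
  have "det ?S * det A * det ?S = 1"
    using arg_cong[OF positive_square_roots(4)[OF s a], of det] c by (simp add: det_mult[of _ n] mult.assoc)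
  hence "det A \<noteq> 0" by auto
  thus ?thesis using vec_space.det_rank_iff[OF c(1)] by simp
qed

text \<open>The canonical purification: tracing out the reference multiplies the Hermitian square
  root by itself. The reference has dimension \<open>d\<close>, which is the rank of
  \<open>A\<close>.\<close>

lemma purification_square_root:
  assumes A: "strictly_positive_mat d A"
  defines "\<phi> \<equiv> vec_rows (mat_fun sqrt A)"
  shows "\<phi> \<in> carrier_vec (d * d)" "trace_right d d (ket_bra \<phi>) = A"
    "\<And>u j. u < d \<Longrightarrow> j < d \<Longrightarrow> \<phi> $ (u * d + j) = mat_fun sqrt A $$ (u, j)"
proof -
  obtain U a where s: "spectral_decomposition d A U a" and a: "\<And>i. i < d \<Longrightarrow> a i > 0"
    using strictly_positive_decomposition[OF A] by blast
  let ?R = "mat_fun sqrt A"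
  note sR = spectral_decomposition_mat_fun[OF s, of sqrt]
  have c: "A \<in> carrier_mat d d" "?R \<in> carrier_mat d d"
    using spectral_decompositionD(5)[OF s] spectral_decompositionD(5)[OF sR] by blast+
  show \<phi>: "\<phi> \<in> carrier_vec (d * d)" using c by (simp add: \<phi>_def vec_rows_def)
  show R: "\<phi> $ (u * d + j) = ?R $$ (u, j)" if "u < d" "j < d" for u j
    using that c by (simp add: \<phi>_def vec_rows_def tensor_index_less)
  have "A $$ (x, y) = (\<Sum>i<d. ?R $$ (x, i) * cnj (?R $$ (y, i)))" if "x < d" "y < d" for x y
  proof -
    have "A $$ (x, y) = (?R * ?R) $$ (x, y)"
      by (simp only: positive_square_roots(1)[OF s a])
    thus ?thesis
      using that c hermitian_mat_index[OF spectral_decomposition_hermitian[OF sR]]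
      by (simp add: index_mult_mat_sum[of _ _ _ _ d] del: index_mult_mat(1))
  qed
  thus "trace_right d d (ket_bra \<phi>) = A"
    using c \<phi> by (intro eq_matI) (auto simp: trace_right_def ket_bra_index tensor_index_less R)
qed

section \<open>The capacity\<close>

text \<open>Reconciles the second argument of the entropy in \<open>f_capacity\<close>, where the
  channel acts on a product, with the product of output and reference state in
  \<open>strictly_positive_outputs\<close>.\<close>

lemma strictly_positive_outputs_tensor_id:
  assumes "strictly_positive_outputs d E" "linear_superop d d E"
    and \<rho>: "density_matrix d \<rho>" and \<psi>: "purification d \<rho> \<psi>"
  defines "r \<equiv> vec_space.rank d \<rho>"
  shows "strictly_positive_mat (d * r) (tensor_id d d r E (ket_bra \<psi>))"
    "strictly_positive_mat (d * r) (tensor_id d d r E (kronecker \<rho> (reference_state d \<rho> \<psi>)))"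
    "tensor_id d d r E (kronecker \<rho> (reference_state d \<rho> \<psi>)) = kronecker (E \<rho>) (reference_state d \<rho> \<psi>)"
proof -
  have "\<rho> \<in> carrier_mat d d" using \<rho> by (auto simp: density_matrix_def psd_mat_def hermitian_mat_def)
  moreover have "reference_state d \<rho> \<psi> \<in> carrier_mat r r"
    by (simp add: reference_state_def trace_left_def r_def)
  ultimately show e: "tensor_id d d r E (kronecker \<rho> (reference_state d \<rho> \<psi>)) = kronecker (E \<rho>) (reference_state d \<rho> \<psi>)"
    by (rule tensor_id_kronecker[OF assms(2)])
  show "strictly_positive_mat (d * r) (tensor_id d d r E (ket_bra \<psi>))"
    "strictly_positive_mat (d * r) (tensor_id d d r E (kronecker \<rho> (reference_state d \<rho> \<psi>)))"
    using assms(1) \<rho> \<psi> unfolding e unfolding strictly_positive_outputs_def r_def by blast+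
qed

lemma kronecker_index:
  assumes "A \<in> carrier_mat d d" "B \<in> carrier_mat r r" "u < d" "v < d" "i < r" "j < r"
  shows "kronecker A B $$ (u * r + i, v * r + j) = A $$ (u, v) * B $$ (i, j)"
  using assms by (simp add: kronecker_def tensor_index_less)

text \<open>With an empty reference the partial trace would be zero, contradicting unit
  trace.\<close>

lemma purification_rank_pos:
  assumes \<rho>: "density_matrix d \<rho>" and \<psi>: "purification d \<rho> \<psi>"
  shows "vec_space.rank d \<rho> > 0"
proof (rule ccontr)
  assume "\<not> vec_space.rank d \<rho> > 0"
  hence "trace_right d 0 (ket_bra \<psi>) = \<rho>" using \<psi> by (simp add: purification_def)
  hence "mat_trace \<rho> = mat_trace (trace_right d 0 (ket_bra \<psi>))" by simp
  thus False using \<rho> by (simp add: density_matrix_def mat_trace_def trace_right_def)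
qed

text \<open>Seen from \<open>E2\<close>, the input \<open>\<rho>\<close> of \<open>E2 \<circ> E1\<close> is the input \<open>E1 \<rho>\<close>, and \<open>E1 \<otimes> I\<close> applied to \<open>\<psi>\<close>
  is obtained from the canonical purification of \<open>E1 \<rho>\<close> by a channel on the reference system.\<close>

lemma f_relative_entropy_comp_le:
  assumes f: "operator_convex_on {0<..} f" and E1: "cptp d d E1" and E2: "cptp d d E2"
    and out1: "strictly_positive_outputs d E1" and out2: "strictly_positive_outputs d E2"
    and out: "strictly_positive_outputs d (E2 \<circ> E1)"
    and \<rho>: "density_matrix d \<rho>" and \<psi>: "purification d \<rho> \<psi>"
  defines "r \<equiv> vec_space.rank d \<rho>"
    and "\<rho>' \<equiv> E1 \<rho>" and "\<phi> \<equiv> vec_rows (mat_fun sqrt (E1 \<rho>))"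
  shows "density_matrix d \<rho>'" "purification d \<rho>' \<phi>"
    "f_relative_entropy f (tensor_id d d r (E2 \<circ> E1) (ket_bra \<psi>))
       (tensor_id d d r (E2 \<circ> E1) (kronecker \<rho> (reference_state d \<rho> \<psi>))) \<le>
     f_relative_entropy f (tensor_id d d (vec_space.rank d \<rho>') E2 (ket_bra \<phi>))
       (tensor_id d d (vec_space.rank d \<rho>') E2 (kronecker \<rho>' (reference_state d \<rho>' \<phi>)))"
proof -
  have lin1: "linear_superop d d E1" and lin2: "linear_superop d d E2"
    using E1 E2 by (auto simp: cptp_def)
  have lin: "linear_superop d d (E2 \<circ> E1)"
    using lin1 lin2 by (simp add: linear_superop_def)
  have \<rho>c: "\<rho> \<in> carrier_mat d d" using \<rho> by (auto simp: density_matrix_def psd_mat_def hermitian_mat_def)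
  have \<psi>c: "\<psi> \<in> carrier_vec (d * r)" and \<psi>\<rho>: "trace_right d r (ket_bra \<psi>) = \<rho>"
    using \<psi> by (auto simp: purification_def r_def)
  have r: "r > 0" unfolding r_def by (rule purification_rank_pos[OF \<rho> \<psi>])
  define X where "X = tensor_id d d r E1 (ket_bra \<psi>)"
  have X: "strictly_positive_mat (d * r) X"
    unfolding X_def r_def by (rule strictly_positive_outputs_tensor_id(1)[OF out1 lin1 \<rho> \<psi>])
  have trX: "trace_right d r X = \<rho>'"
    unfolding X_def trace_right_tensor_id[OF lin1] \<psi>\<rho> \<rho>'_def ..
  have \<rho>': "strictly_positive_mat d \<rho>'"
    using strictly_positive_trace_right[OF X r] by (simp only: trX)
  have \<rho>'c: "\<rho>' \<in> carrier_mat d d" using \<rho>' by (auto simp: strictly_positive_mat_def hermitian_mat_def)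
  have "psd_mat d \<rho>'" by (rule strictly_positive_imp_psd[OF \<rho>'])
  moreover have "mat_trace \<rho>' = 1"
    using E1 \<rho>c \<rho> by (simp add: \<rho>'_def cptp_def trace_preserving_def density_matrix_def)
  ultimately show d\<rho>': "density_matrix d \<rho>'" by (simp add: density_matrix_def)
  have rank: "vec_space.rank d \<rho>' = d" by (rule strictly_positive_rank[OF \<rho>'])
  have \<phi>': "\<phi> \<in> carrier_vec (d * d)" "trace_right d d (ket_bra \<phi>) = \<rho>'"
    "\<And>u j. u < d \<Longrightarrow> j < d \<Longrightarrow> \<phi> $ (u * d + j) = mat_fun sqrt \<rho>' $$ (u, j)"
    using purification_square_root[OF \<rho>'] unfolding \<phi>_def \<rho>'_def by blast+
  show p\<phi>: "purification d \<rho>' \<phi>" using \<phi>'(1,2) by (simp add: purification_def rank)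
  obtain U p where s: "spectral_decomposition d \<rho>' U p" and p: "\<And>i. i < d \<Longrightarrow> p i > 0"
    using strictly_positive_decomposition[OF \<rho>'] by blast
  define R where "R = mat_fun sqrt \<rho>'"
  define S where "S = mat_fun (\<lambda>x. inverse (sqrt x)) \<rho>'"
  note roots = positive_square_roots[OF s p, folded R_def S_def]
  note sR = spectral_decomposition_mat_fun[OF s, of sqrt, folded R_def]
    and sS = spectral_decomposition_mat_fun[OF s, of "\<lambda>x. inverse (sqrt x)", folded S_def]
  note c = spectral_decompositionD(5)[OF sR] spectral_decompositionD(5)[OF sS]
  note Sh = hermitian_mat_index[OF spectral_decomposition_hermitian[OF sS]]
  have RS: "(\<Sum>j<d. R $$ (u, j) * S $$ (j, a)) = (if u = a then 1 else 0)" if "u < d" "a < d" for u a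
    using that c arg_cong[OF roots(2), of "\<lambda>M. M $$ (u, a)"]
    by (simp add: index_mult_mat_sum[of _ _ _ _ d] del: index_mult_mat(1))
  obtain x where x: "\<And>k l. k < d * r \<Longrightarrow> l < d * r \<Longrightarrow> X $$ (k, l) = (\<Sum>i<d * r. x i k * cnj (x i l))"
    using psd_decomposition[OF strictly_positive_imp_psd[OF X]] by blast
  \<comment> \<open>Reshape the \<open>k\<close>-th vector of a rank-one decomposition of
    \<open>X\<close> into a matrix with system and reference index. Dividing by the square root of
    \<rho>' on the system side gives the Kraus operator that sends \<phi> to this vector;
    \<open>i\<close> is its output and \<open>j\<close> its input index.\<close>
  define F where "F k i j = (\<Sum>a<d. S $$ (j, a) * x k (a * r + i))" for k i j
  have FR: "(\<Sum>j<d. F k i j * R $$ (u, j)) = x k (u * r + i)" if u: "u < d" for k i u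
  proof -
    have "(\<Sum>j<d. F k i j * R $$ (u, j)) = (\<Sum>j<d. \<Sum>a<d. R $$ (u, j) * S $$ (j, a) * x k (a * r + i))"
      by (simp add: F_def sum_distrib_left sum_distrib_right mult_ac)
    also have "\<dots> = (\<Sum>a<d. (\<Sum>j<d. R $$ (u, j) * S $$ (j, a)) * x k (a * r + i))"
      unfolding sum_distrib_right by (rule sum.swap)
    also have "\<dots> = (\<Sum>a<d. if u = a then x k (a * r + i) else 0)"
      using u by (intro sum.cong) (auto simp: RS)
    finally show ?thesis using u by simp
  qed
  \<comment> \<open>Summing over \<open>k\<close> and the output index gives the system marginal
    \<rho>' of \<open>X\<close> between two factors \<open>S\<close>, which is the identity: the
    channel preserves the trace.\<close>
  have FF: "(\<Sum>k<d * r. \<Sum>i<r. cnj (F k i j) * F k i j') = (if j = j' then 1 else 0)" if j: "j < d" "j' < d" for j j'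
  proof -
    have "(\<Sum>k<d * r. \<Sum>i<r. cnj (F k i j) * F k i j') =
      (\<Sum>s\<in>{..<d * r} \<times> {..<r}. 1 * ((\<Sum>a<d. S $$ (a, j) * cnj (x (fst s) (a * r + snd s))) *
        (\<Sum>b<d. S $$ (j', b) * x (fst s) (b * r + snd s))))"
      using j by (simp add: F_def Sh sum.cartesian_product')
    also have "\<dots> = (\<Sum>a<d. \<Sum>b<d. (\<Sum>s\<in>{..<d * r} \<times> {..<r}. 1 * (cnj (x (fst s) (a * r + snd s)) * x (fst s) (b * r + snd s))) *
        (S $$ (a, j) * S $$ (j', b)))"
      by (rule sum_sesquilinear)
    also have "\<dots> = (\<Sum>a<d. \<Sum>b<d. S $$ (j', b) * \<rho>' $$ (b, a) * S $$ (a, j))"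
    proof (intro sum.cong refl)
      fix a b assume "a \<in> {..<d}" "b \<in> {..<d}"
      hence ab: "a < d" "b < d" by auto
      have "(\<Sum>s\<in>{..<d * r} \<times> {..<r}. 1 * (cnj (x (fst s) (a * r + snd s)) * x (fst s) (b * r + snd s))) =
        (\<Sum>k<d * r. \<Sum>i<r. x k (b * r + i) * cnj (x k (a * r + i)))"
        by (simp add: sum.cartesian_product' mult.commute)
      also have "\<dots> = (\<Sum>i<r. \<Sum>k<d * r. x k (b * r + i) * cnj (x k (a * r + i)))" by (rule sum.swap)
      also have "\<dots> = (\<Sum>i<r. X $$ (b * r + i, a * r + i))"
        using ab by (simp add: x tensor_index_less)
      also have "\<dots> = \<rho>' $$ (b, a)"
        using ab by (simp add: trX[symmetric] trace_right_def)
      finally show "(\<Sum>s\<in>{..<d * r} \<times> {..<r}. 1 * (cnj (x (fst s) (a * r + snd s)) * x (fst s) (b * r + snd s))) *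
        (S $$ (a, j) * S $$ (j', b)) = S $$ (j', b) * \<rho>' $$ (b, a) * S $$ (a, j)" by (simp add: mult_ac)
    qed
    also have "\<dots> = (S * \<rho>' * S) $$ (j', j)"
      using j by (simp only: mat_index_mult3[OF c(2) \<rho>'c c(2)])
    finally show ?thesis using j by (simp add: roots(4))
  qed
  have X\<phi>: "X $$ (u * r + i, v * r + i') =
      (\<Sum>k<d * r. \<Sum>a<d. \<Sum>b<d. F k i a * ket_bra \<phi> $$ (u * d + a, v * d + b) * cnj (F k i' b))"
    if u: "u < d" "v < d" "i < r" "i' < r" for u v i i'
  proof -
    have "(\<Sum>a<d. \<Sum>b<d. F k i a * ket_bra \<phi> $$ (u * d + a, v * d + b) * cnj (F k i' b)) =
        x k (u * r + i) * cnj (x k (v * r + i'))" for k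
    proof -
      have "(\<Sum>a<d. \<Sum>b<d. F k i a * ket_bra \<phi> $$ (u * d + a, v * d + b) * cnj (F k i' b)) =
        (\<Sum>a<d. F k i a * R $$ (u, a)) * cnj (\<Sum>b<d. F k i' b * R $$ (v, b))"
        using u unfolding cnj_sum sum_product
        by (intro sum.cong refl) (simp add: ket_bra_index[OF \<phi>'(1)] tensor_index_less \<phi>'(3) R_def)
      thus ?thesis using u by (simp add: FR)
    qed
    thus ?thesis using u by (simp add: x tensor_index_less)
  qed
  \<comment> \<open>Both reference states are obtained by tracing out the system, which commutes
    with a channel on the reference; by \<open>trace_left_tensor_id\<close> the one of \<psi> is
    also the marginal of \<open>X\<close>.\<close>
  have ref: "reference_state d \<rho> \<psi> $$ (i, i') =
      (\<Sum>k<d * r. \<Sum>a<d. \<Sum>b<d. F k i a * reference_state d \<rho>' \<phi> $$ (a, b) * cnj (F k i' b))"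
    if i: "i < r" "i' < r" for i i'
  proof -
    have "reference_state d \<rho> \<psi> = trace_left d r X"
      unfolding reference_state_def X_def trace_left_tensor_id[OF E1] r_def ..
    hence "reference_state d \<rho> \<psi> $$ (i, i') = (\<Sum>u<d. X $$ (u * r + i, u * r + i'))"
      using i by (simp add: trace_left_def)
    also have "\<dots> = (\<Sum>u<d. \<Sum>k<d * r. \<Sum>a<d. \<Sum>b<d. F k i a * ket_bra \<phi> $$ (u * d + a, u * d + b) * cnj (F k i' b))"
      using i by (simp add: X\<phi>)
    also have "\<dots> = (\<Sum>k<d * r. \<Sum>u<d. \<Sum>a<d. \<Sum>b<d. F k i a * ket_bra \<phi> $$ (u * d + a, u * d + b) * cnj (F k i' b))"
      by (rule sum.swap)
    also have "\<dots> = (\<Sum>k<d * r. \<Sum>a<d. \<Sum>u<d. \<Sum>b<d. F k i a * ket_bra \<phi> $$ (u * d + a, u * d + b) * cnj (F k i' b))"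
      by (rule sum.cong[OF refl], rule sum.swap)
    also have "\<dots> = (\<Sum>k<d * r. \<Sum>a<d. \<Sum>b<d. \<Sum>u<d. F k i a * ket_bra \<phi> $$ (u * d + a, u * d + b) * cnj (F k i' b))"
      by (rule sum.cong[OF refl], rule sum.cong[OF refl], rule sum.swap)
    also have "\<dots> = (\<Sum>k<d * r. \<Sum>a<d. \<Sum>b<d. F k i a * reference_state d \<rho>' \<phi> $$ (a, b) * cnj (F k i' b))"
      by (intro sum.cong refl) (simp add: reference_state_def rank trace_left_def sum_distrib_left sum_distrib_right)
    finally show ?thesis .
  qed
  let ?\<sigma> = "kronecker \<rho>' (reference_state d \<rho> \<psi>)" and ?\<sigma>' = "kronecker \<rho>' (reference_state d \<rho>' \<phi>)"
  have refc: "reference_state d \<rho> \<psi> \<in> carrier_mat r r" "reference_state d \<rho>' \<phi> \<in> carrier_mat d d"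
    by (simp_all add: reference_state_def trace_left_def r_def rank)
  have \<sigma>\<phi>: "?\<sigma> $$ (u * r + i, v * r + i') =
      (\<Sum>k<d * r. \<Sum>a<d. \<Sum>b<d. F k i a * ?\<sigma>' $$ (u * d + a, v * d + b) * cnj (F k i' b))"
    if u: "u < d" "v < d" "i < r" "i' < r" for u v i i'
  proof -
    have "?\<sigma> $$ (u * r + i, v * r + i') = \<rho>' $$ (u, v) * reference_state d \<rho> \<psi> $$ (i, i')"
      using u by (rule kronecker_index[OF \<rho>'c refc(1)])
    also have "\<dots> = (\<Sum>k<d * r. \<Sum>a<d. \<Sum>b<d.
        F k i a * (\<rho>' $$ (u, v) * reference_state d \<rho>' \<phi> $$ (a, b)) * cnj (F k i' b))"
      using u by (simp add: ref sum_distrib_left mult_ac)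
    finally show ?thesis using u by (simp add: kronecker_index[OF \<rho>'c refc(2)])
  qed
  \<comment> \<open>The operators \<open>F k\<close> tensored with the identity on the
    system.\<close>
  define G where "G k x i = (if x div r = i div d then F k (x mod r) (i mod d) else 0)" for k x i
  interpret kraus_family "d * r" "d * d" "{..<d * r}" G
  proof
    fix i j assume ij: "i < d * d" "j < d * d"
    have "(\<Sum>y<d * r. cnj (G k y i) * G k y j) =
      (\<Sum>a<d. \<Sum>y<r. if a = i div d then
        if i div d = j div d then cnj (F k y (i mod d)) * F k y (j mod d) else 0 else 0)" for k
      by (rule sum_lessThan_mult) (auto simp: G_def)
    also have "(\<Sum>a<d. \<Sum>y<r. if a = i div d then
        if i div d = j div d then cnj (F k y (i mod d)) * F k y (j mod d) else 0 else 0) =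
      (if i div d = j div d then \<Sum>y<r. cnj (F k y (i mod d)) * F k y (j mod d) else 0)" for k
      using div_mod_less[OF ij(1)] by (subst sum.swap) simp
    finally have "(\<Sum>k<d * r. \<Sum>y<d * r. cnj (G k y i) * G k y j) =
      (if i div d = j div d then if i mod d = j mod d then 1 else 0 else 0)"
      using div_mod_less[OF ij(1)] div_mod_less[OF ij(2)] by (simp add: FF)
    also have "\<dots> = (if i = j then 1 else 0)" by (auto, metis div_mult_mod_eq)
    finally show "(\<Sum>k<d * r. \<Sum>y<d * r. cnj (G k y i) * G k y j) = (if i = j then 1 else 0)" .
  qed simp
  note out2' = strictly_positive_outputs_tensor_id[OF out2 lin2 d\<rho>' p\<phi>, unfolded rank]
  note out' = strictly_positive_outputs_tensor_id[OF out lin \<rho> \<psi>, folded r_def]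
  note out1' = strictly_positive_outputs_tensor_id[OF out1 lin1 \<rho> \<psi>, folded r_def]
  have e1: "tensor_id d d r (E2 \<circ> E1) (ket_bra \<psi>) = tensor_id d d r E2 X"
    unfolding X_def tensor_id_comp[OF lin1] ..
  have e2: "tensor_id d d r (E2 \<circ> E1) (kronecker \<rho> (reference_state d \<rho> \<psi>)) = tensor_id d d r E2 ?\<sigma>"
    unfolding \<rho>'_def out1'(3)[symmetric] tensor_id_comp[OF lin1] ..
  show "f_relative_entropy f (tensor_id d d r (E2 \<circ> E1) (ket_bra \<psi>))
       (tensor_id d d r (E2 \<circ> E1) (kronecker \<rho> (reference_state d \<rho> \<psi>))) \<le>
     f_relative_entropy f (tensor_id d d (vec_space.rank d \<rho>') E2 (ket_bra \<phi>))
       (tensor_id d d (vec_space.rank d \<rho>') E2 ?\<sigma>')"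
    unfolding rank
  \<comment> \<open>Positivity before the reference channel is the hypothesis on \<open>E2\<close>
    at the input \<rho>', positivity after it is the hypothesis on the composition at
    \<rho>.\<close>
  proof (rule f_relative_entropy_mono[OF f out2'(1,2) out'(1,2)])
    fix y z assume yz: "y < d * r" "z < d * r"
    show "tensor_id d d r (E2 \<circ> E1) (ket_bra \<psi>) $$ (y, z) = (\<Sum>k<d * r. \<Sum>i<d * d. \<Sum>j<d * d.
        G k y i * tensor_id d d d E2 (ket_bra \<phi>) $$ (i, j) * cnj (G k z j))"
      unfolding e1 G_def by (rule tensor_id_reference_channel[OF lin2 _ X\<phi> yz]) simp_all
    show "tensor_id d d r (E2 \<circ> E1) (kronecker \<rho> (reference_state d \<rho> \<psi>)) $$ (y, z) =
      (\<Sum>k<d * r. \<Sum>i<d * d. \<Sum>j<d * d. G k y i * tensor_id d d d E2 ?\<sigma>' $$ (i, j) * cnj (G k z j))"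
      unfolding e2 G_def by (rule tensor_id_reference_channel[OF lin2 _ \<sigma>\<phi> yz]) simp_all
  qed
qed

theorem mainTheorem10:
  fixes f :: "real \<Rightarrow> real" and d :: nat and E1 E2 :: "complex mat \<Rightarrow> complex mat"
  assumes "operator_convex_on {0<..} f"
    and "cptp d d E1" and "cptp d d E2"
    and "\<And>E. E \<in> {E1, E2, E2 \<circ> E1} \<Longrightarrow> strictly_positive_outputs d E"
  shows "f_capacity f d (E2 \<circ> E1) \<le> min (f_capacity f d E1) (f_capacity f d E2)"
proof (rule min.boundedI)
  have out: "strictly_positive_outputs d E1" "strictly_positive_outputs d E2"
    "strictly_positive_outputs d (E2 \<circ> E1)" using assms(4) by auto
  have lin1: "linear_superop d d E1" and lin2: "linear_superop d d E2"
    using assms(2,3) by (auto simp: cptp_def)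
  have lin: "linear_superop d d (E2 \<circ> E1)"
    using lin1 lin2 by (simp add: linear_superop_def)
  \<comment> \<open>The same input and purification dominate term by term.\<close>
  show "f_capacity f d (E2 \<circ> E1) \<le> f_capacity f d E1"
    unfolding f_capacity_def
  proof (rule SUP_mono, clarify)
    fix \<rho> \<psi> assume \<rho>\<psi>: "density_matrix d \<rho>" "purification d \<rho> \<psi>"
    have "f_relative_entropy f
          (tensor_id d d (vec_space.rank d \<rho>) (E2 \<circ> E1) (ket_bra \<psi>))
          (tensor_id d d (vec_space.rank d \<rho>) (E2 \<circ> E1) (kronecker \<rho> (reference_state d \<rho> \<psi>)))
      \<le> f_relative_entropy f
          (tensor_id d d (vec_space.rank d \<rho>) E1 (ket_bra \<psi>))
          (tensor_id d d (vec_space.rank d \<rho>) E1 (kronecker \<rho> (reference_state d \<rho> \<psi>)))"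
      unfolding tensor_id_comp[OF lin1, symmetric]
      by (rule f_relative_entropy_tensor_id_mono[OF assms(1,3)
            strictly_positive_outputs_tensor_id(1,2)[OF out(1) lin1 \<rho>\<psi>]
            strictly_positive_outputs_tensor_id(1,2)[OF out(3) lin \<rho>\<psi>,
              unfolded tensor_id_comp[OF lin1, symmetric]]])
    thus "\<exists>m\<in>{(\<rho>, \<psi>). density_matrix d \<rho> \<and> purification d \<rho> \<psi>}.
      ereal (f_relative_entropy f
          (tensor_id d d (vec_space.rank d \<rho>) (E2 \<circ> E1) (ket_bra \<psi>))
          (tensor_id d d (vec_space.rank d \<rho>) (E2 \<circ> E1) (kronecker \<rho> (reference_state d \<rho> \<psi>))))
      \<le> (case m of (\<rho>, \<psi>) \<Rightarrow> ereal (f_relative_entropy f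
          (tensor_id d d (vec_space.rank d \<rho>) E1 (ket_bra \<psi>))
          (tensor_id d d (vec_space.rank d \<rho>) E1 (kronecker \<rho> (reference_state d \<rho> \<psi>)))))"
      using \<rho>\<psi> by (intro bexI[of _ "(\<rho>, \<psi>)"]) auto
  qed
  \<comment> \<open>Here the dominating input depends on the term: it is the output of
    \<open>E1\<close> with its canonical purification.\<close>
  show "f_capacity f d (E2 \<circ> E1) \<le> f_capacity f d E2"
    unfolding f_capacity_def
  proof (rule SUP_mono, clarify)
    fix \<rho> \<psi> assume "density_matrix d \<rho>" "purification d \<rho> \<psi>"
    note * = f_relative_entropy_comp_le[OF assms(1-3) out this]
    show "\<exists>m\<in>{(\<rho>, \<psi>). density_matrix d \<rho> \<and> purification d \<rho> \<psi>}.
      ereal (f_relative_entropy f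
          (tensor_id d d (vec_space.rank d \<rho>) (E2 \<circ> E1) (ket_bra \<psi>))
          (tensor_id d d (vec_space.rank d \<rho>) (E2 \<circ> E1) (kronecker \<rho> (reference_state d \<rho> \<psi>))))
      \<le> (case m of (\<rho>, \<psi>) \<Rightarrow> ereal (f_relative_entropy f
          (tensor_id d d (vec_space.rank d \<rho>) E2 (ket_bra \<psi>))
          (tensor_id d d (vec_space.rank d \<rho>) E2 (kronecker \<rho> (reference_state d \<rho> \<psi>)))))"
      using * by (intro bexI[of _ "(E1 \<rho>, vec_rows (mat_fun sqrt (E1 \<rho>)))"]) auto
  qed
qed

end
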